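(* Let $f\in\mathscr F^n$, $g\in C^0(\overline I\times\mathbb R^n\times\mathbb R;\mathbb R)$, $u_o\in L^\infty(\mathbb R^n;\mathbb R)$ and $u\in L^\infty(I\times\mathbb R^n;\mathbb R)$. Choose $a,b\in\mathbb R$ so that $[a,b]\supseteq J_{u,u_o}$. If $E\in C^2(I\times\mathbb R^n\times\mathbb R;\mathbb R)\cap\mathscr F_c$ and, for all $v\in[a,b]$, the map $(t,x)\mapsto\partial^2_{uu}E(t,x,v)$ belongs to $C^1(I\times\mathbb R^n;\mathbb R)$, then $$\mathcal M^{tx}_u(E)=\frac12\int_a^b\mu_k\big(\partial^2_{uu}E(\cdot,\cdot,k)\big)\,dk+\mathcal M^{tx}_u\left(\frac{\partial_uE(\cdot,\cdot,a)+\partial_uE(\cdot,\cdot,b)}2\otimes\mathrm{Id}_{\mathbb R}\right).$$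
   Context: Let $n\ge1$ be an integer and let $I=[0,+\infty)$ or $I=[0,T)$ for some $T>0$, with closure $\overline I$. $\nabla_x$ and $\operatorname{div}_x$ applied to functions of $(t,x,u)$ denote derivatives with respect to $x$ only, with $t$ and $u$ fixed; e.g. $(\operatorname{div}_xF)(t,x,u(t,x))$ is the partial divergence evaluated at $(t,x,u(t,x))$. Compactly supported functions on $I\times\mathbb R^n$ need not vanish at $t=0$. $\mathscr F$ is the set of $\zeta\in C^1(\overline I\times\mathbb R^n\times\mathbb R;\mathbb R)$, with variables $(t,x,u)$, such that $\partial^2_{tu}\zeta$ and $\nabla_x\partial_u\zeta$ are continuous on $\overline I\times\mathbb R^n\times\mathbb R$; $\mathscr F^n$ is the analogous space of $\mathbb R^n$-valued functions. $\operatorname{spt}_{tx}\zeta$ is the closure in $I\times\mathbb R^n$ of $\{(t,x)\in I\times\mathbb R^n:\exists u\in\mathbb R,\ \zeta(t,x,u)\ne0\}$. $\mathscr F_c$ (resp. $\mathscr F_c^n$) is the set of $\zeta\in\mathscr F$ (resp. $\mathscr F^n$) with $\operatorname{spt}_{tx}\zeta$ a compact subset of $I\times\mathbb R^n$. $J_{u,u_o}=[\min\{\operatorname{ess\,inf}u,\operatorname{ess\,inf}u_o\},\max\{\operatorname{ess\,sup}u,\operatorname{ess\,sup}u_o\}]$, with $u$ over $I\times\mathbb R^n$ and $u_o$ over $\mathbb R^n$. $(\varphi\otimes e)(t,x,u)=\varphi(t,x)\,e(u)$ and $\mathrm{Id}_{\mathbb R}(u)=u$. For $E\in\mathscr F_c$,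 let $F\in\mathscr F_c^n$ be any function with $\partial_uF=\partial_uE\,\partial_uf$ (the choice is irrelevant; e.g. $F(t,x,u)=\int_0^u\partial_uE(t,x,w)\partial_uf(t,x,w)dw$), and set $$\mathcal M^{tx}_u(E)=-\int_I\int_{\mathbb R^n}(\partial_uE)(t,x,u)\,(\operatorname{div}_xf)(t,x,u)\,dx\,dt+\int_I\int_{\mathbb R^n}\big((\operatorname{div}_xF)(t,x,u)+(\partial_tE)(t,x,u)\big)dx\,dt$$ $$+\int_I\int_{\mathbb R^n}(\partial_uE)(t,x,u)\,g(t,x,u)\,dx\,dt+\int_{\mathbb R^n}E(0,x,u_o(x))\,dx .$$ With $\operatorname{sgn}z=1,0,-1$ for $z>0$, $z=0$, $z<0$ and $\Phi(t,x,u,k)=\operatorname{sgn}(u-k)\,(f(t,x,u)-f(t,x,k))$, for $k\in\mathbb R$ and $\varphi\in C^1_c(I\times\mathbb R^n;\mathbb R)$ $$\mu_k(\varphi)=\int_I\int_{\mathbb R^n}\big(|u-k|\,\partial_t\varphi+\Phi(t,x,u,k)\cdot\nabla_x\varphi\big)dx\,dt-\int_I\int_{\mathbb R^n}\operatorname{sgn}(u-k)\,\operatorname{div}_xf(t,x,k)\,\varphi\,dx\,dt$$ $$+\int_I\int_{\mathbb R^n}\operatorname{sgn}(u-k)\,g(t,x,u)\,\varphi\,dx\,dt+\int_{\mathbb R^n}|u_o(x)-k|\,\varphi(0,x)\,dx .$$ In all formulas $u=u(t,x)$ and $\varphi=\varphi(t,x)$.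
   Formalization: Added: the time derivative and the x-gradient of ∂²_uu E are absolutely integrable on I×ℝⁿ×[a,b] (automatic if they are jointly continuous or bounded); with only the C¹ condition for each v separately the identity can fail. It is proved for every admissible choice of both fluxes F. *)

theory Defs
  imports "HOL-Analysis.Analysis" "HOL-Probability.Essential_Supremum"
begin

section \<open>Differentiability classes and partial derivatives\<close>

text \<open>
  All derivatives are taken within the domain, hence one-sided on the boundary of a set such as
  $[0,T] \times \mathbb{R}^n \times \mathbb{R}$. On the sets used here (products of
  nondegenerate intervals and whole spaces) these derivatives are unique.
\<close>

definition C1_on :: "'a::real_normed_vector set \<Rightarrow> ('a \<Rightarrow> 'b::real_normed_vector) \<Rightarrow> bool" where
  "C1_on S h \<longleftrightarrow> (\<exists>D :: 'a \<Rightarrow> 'a \<Rightarrow>\<^sub>L 'b.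
     (\<forall>z\<in>S. (h has_derivative blinfun_apply (D z)) (at z within S)) \<and> continuous_on S D)"

definition C2_on :: "'a::real_normed_vector set \<Rightarrow> ('a \<Rightarrow> 'b::real_normed_vector) \<Rightarrow> bool" where
  "C2_on S h \<longleftrightarrow> (\<exists>D :: 'a \<Rightarrow> 'a \<Rightarrow>\<^sub>L 'b.
     (\<forall>z\<in>S. (h has_derivative blinfun_apply (D z)) (at z within S)) \<and> C1_on S D)"

definition grad :: "(real^'n \<Rightarrow> real) \<Rightarrow> real^'n \<Rightarrow> real^'n" where
  "grad h x = (\<chi> i. frechet_derivative h (at x) (axis i 1))"

definition divergence :: "(real^'n \<Rightarrow> real^'n) \<Rightarrow> real^'n \<Rightarrow> real" where
  "divergence h x = (\<Sum>i\<in>UNIV. frechet_derivative h (at x) (axis i 1) $ i)"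

text \<open>Functions of $(t,x,u)$ are curried.\<close>

definition du :: "(real \<Rightarrow> real^'n \<Rightarrow> real \<Rightarrow> 'b::real_normed_vector) \<Rightarrow> real \<Rightarrow> real^'n \<Rightarrow> real \<Rightarrow> 'b"
  where "du \<zeta> t x u = vector_derivative (\<lambda>w. \<zeta> t x w) (at u)"

definition dt :: "real set \<Rightarrow> (real \<Rightarrow> real^'n \<Rightarrow> real \<Rightarrow> 'b::real_normed_vector)
    \<Rightarrow> real \<Rightarrow> real^'n \<Rightarrow> real \<Rightarrow> 'b"
  where "dt I \<zeta> t x u = vector_derivative (\<lambda>s. \<zeta> s x u) (at t within I)"

definition divx :: "(real \<Rightarrow> real^'n \<Rightarrow> real \<Rightarrow> real^'n) \<Rightarrow> real \<Rightarrow> real^'n \<Rightarrow> real \<Rightarrow> real"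
  where "divx F t x u = divergence (\<lambda>y. F t y u) x"

definition gradx :: "(real \<Rightarrow> real^'n \<Rightarrow> real \<Rightarrow> real) \<Rightarrow> real \<Rightarrow> real^'n \<Rightarrow> real \<Rightarrow> real^'n"
  where "gradx \<zeta> t x u = grad (\<lambda>y. \<zeta> t y u) x"


section \<open>The spaces of fluxes and entropies\<close>

definition time_interval :: "real set \<Rightarrow> bool" where
  "time_interval I \<longleftrightarrow> I = {0..} \<or> (\<exists>T>0. I = {0..<T})"

text \<open>
  The space $\mathscr F$ for \<open>'b = real\<close> and $\mathscr F^n$ for \<open>'b = real^'n\<close>. The second
  and third conjuncts say that $\partial^2_{tu}\zeta$ and $\nabla_x\partial_u\zeta$ exist and
  are jointly continuous.
\<close>

definition space_F :: "real set \<Rightarrow> (real \<Rightarrow> real^'n \<Rightarrow> real \<Rightarrow> 'b::real_normed_vector) set" where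
  "space_F I = {\<zeta>.
     C1_on (closure I \<times> UNIV \<times> UNIV) (\<lambda>(t, x, u). \<zeta> t x u) \<and>
     (\<exists>D :: real \<times> (real^'n) \<times> real \<Rightarrow> 'b.
        (\<forall>t\<in>closure I. \<forall>x u. ((\<lambda>s. du \<zeta> s x u) has_vector_derivative D (t, x, u)) (at t within closure I)) \<and>
        continuous_on (closure I \<times> UNIV \<times> UNIV) D) \<and>
     (\<exists>D :: real \<times> (real^'n) \<times> real \<Rightarrow> (real^'n) \<Rightarrow>\<^sub>L 'b.
        (\<forall>t\<in>closure I. \<forall>x u. ((\<lambda>y. du \<zeta> t y u) has_derivative blinfun_apply (D (t, x, u))) (at x)) \<and>
        continuous_on (closure I \<times> UNIV \<times> UNIV) D)}"

definition spt_tx :: "real set \<Rightarrow> (real \<Rightarrow> real^'n \<Rightarrow> real \<Rightarrow> 'b::real_normed_vector) \<Rightarrow> (real \<times> (real^'n)) set"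
  where "spt_tx I \<zeta> = closure {(t, x). t \<in> I \<and> (\<exists>u. \<zeta> t x u \<noteq> 0)} \<inter> (I \<times> UNIV)"

definition space_Fc :: "real set \<Rightarrow> (real \<Rightarrow> real^'n \<Rightarrow> real \<Rightarrow> 'b::real_normed_vector) set" where
  "space_Fc I = {\<zeta> \<in> space_F I. compact (spt_tx I \<zeta>)}"


section \<open>Essentially bounded functions\<close>

definition Linfty :: "'a measure \<Rightarrow> ('a \<Rightarrow> real) \<Rightarrow> bool" where
  "Linfty M h \<longleftrightarrow> h \<in> borel_measurable M \<and> esssup M (\<lambda>z. ereal \<bar>h z\<bar>) < \<infinity>"

definition ess_sup :: "'a measure \<Rightarrow> ('a \<Rightarrow> real) \<Rightarrow> ereal" where
  "ess_sup M h = esssup M (\<lambda>z. ereal (h z))"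

definition ess_inf :: "'a measure \<Rightarrow> ('a \<Rightarrow> real) \<Rightarrow> ereal" where
  "ess_inf M h = - esssup M (\<lambda>z. - ereal (h z))"

definition J_range :: "real set \<Rightarrow> (real \<times> (real^'n) \<Rightarrow> real) \<Rightarrow> (real^'n \<Rightarrow> real) \<Rightarrow> real set" where
  "J_range I u uo = {v.
     min (ess_inf (lebesgue_on (I \<times> UNIV)) u) (ess_inf lebesgue uo) \<le> ereal v \<and>
     ereal v \<le> max (ess_sup (lebesgue_on (I \<times> UNIV)) u) (ess_sup lebesgue uo)}"


section \<open>The functionals\<close>

text \<open>
  Admissible choices of the entropy flux \<open>F\<close> of \<open>E\<close>. It is determined only up to a compactly
  supported function of $(t,x)$, so it is kept as an argument of \<open>M_tx\<close>.
\<close>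

definition entropy_flux :: "real set \<Rightarrow> (real \<Rightarrow> real^'n \<Rightarrow> real \<Rightarrow> real^'n)
    \<Rightarrow> (real \<Rightarrow> real^'n \<Rightarrow> real \<Rightarrow> real) \<Rightarrow> (real \<Rightarrow> real^'n \<Rightarrow> real \<Rightarrow> real^'n) \<Rightarrow> bool" where
  "entropy_flux I f E F \<longleftrightarrow> F \<in> space_Fc I \<and>
     (\<forall>t\<in>closure I. \<forall>x u. du F t x u = du E t x u *\<^sub>R du f t x u)"

definition M_tx :: "real set \<Rightarrow> (real \<Rightarrow> real^'n \<Rightarrow> real \<Rightarrow> real^'n) \<Rightarrow> (real \<Rightarrow> real^'n \<Rightarrow> real \<Rightarrow> real)
    \<Rightarrow> (real^'n \<Rightarrow> real) \<Rightarrow> (real \<times> (real^'n) \<Rightarrow> real)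
    \<Rightarrow> (real \<Rightarrow> real^'n \<Rightarrow> real \<Rightarrow> real) \<Rightarrow> (real \<Rightarrow> real^'n \<Rightarrow> real \<Rightarrow> real^'n) \<Rightarrow> real" where
  "M_tx I f g uo u E F =
     - (LINT t:I|lebesgue. LINT x|lebesgue. du E t x (u (t, x)) * divx f t x (u (t, x)))
     + (LINT t:I|lebesgue. LINT x|lebesgue. divx F t x (u (t, x)) + dt I E t x (u (t, x)))
     + (LINT t:I|lebesgue. LINT x|lebesgue. du E t x (u (t, x)) * g t x (u (t, x)))
     + (LINT x|lebesgue. E 0 x (uo x))"

definition Phi :: "(real \<Rightarrow> real^'n \<Rightarrow> real \<Rightarrow> real^'n) \<Rightarrow> real \<Rightarrow> real^'n \<Rightarrow> real \<Rightarrow> real \<Rightarrow> real^'n" where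
  "Phi f t x u k = sgn (u - k) *\<^sub>R (f t x u - f t x k)"

definition mu :: "real set \<Rightarrow> (real \<Rightarrow> real^'n \<Rightarrow> real \<Rightarrow> real^'n) \<Rightarrow> (real \<Rightarrow> real^'n \<Rightarrow> real \<Rightarrow> real)
    \<Rightarrow> (real^'n \<Rightarrow> real) \<Rightarrow> (real \<times> (real^'n) \<Rightarrow> real) \<Rightarrow> real \<Rightarrow> (real \<Rightarrow> real^'n \<Rightarrow> real) \<Rightarrow> real" where
  "mu I f g uo u k \<phi> =
     (LINT t:I|lebesgue. LINT x|lebesgue.
        \<bar>u (t, x) - k\<bar> * vector_derivative (\<lambda>s. \<phi> s x) (at t within I)
        + Phi f t x (u (t, x)) k \<bullet> grad (\<phi> t) x)
     - (LINT t:I|lebesgue. LINT x|lebesgue. sgn (u (t, x) - k) * divx f t x k * \<phi> t x)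
     + (LINT t:I|lebesgue. LINT x|lebesgue. sgn (u (t, x) - k) * g t x (u (t, x)) * \<phi> t x)
     + (LINT x|lebesgue. \<bar>uo x - k\<bar> * \<phi> 0 x)"

definition tensor :: "(real \<Rightarrow> real^'n \<Rightarrow> real) \<Rightarrow> (real \<Rightarrow> real) \<Rightarrow> real \<Rightarrow> real^'n \<Rightarrow> real \<Rightarrow> real" where
  "tensor \<phi> e t x u = \<phi> t x * e u"

end

theory Submission
  imports Defs
begin

text \<open>
  Fix a point $(t,x)$ and a state $w \in [a,b]$. Integrating by parts in $k$ gives
  $\frac12\int_a^b |w-k|\,\partial^2_{uu}E(k)\,dk = E(w) - L(w) - C$, where
  $L(w) = \frac12(\partial_uE(a)+\partial_uE(b))\,w$ and $C$ does not depend on $w$. The same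
  computation with the kernel $\mathrm{sgn}(w-k)(h(w)-h(k))$ in place of $|w-k|$ represents the
  fluxes: the flux $F$ of $E$ is the superposition of the Kruzkov fluxes with weight
  $\frac12\partial^2_{uu}E(k)$, plus the flux $G$ of $L$, minus a field $R$ that does not depend
  on $w$. Inserting $w = u(t,x)$ and integrating over time and space gives the theorem, because
  $C$ and $R$ are compactly supported: the integral of $\partial_t C$ cancels the initial value of
  $C$, and the integral of $\mathrm{div}\,R$ vanishes.

  The difficulty is that $\mu_k$ contains the first derivatives in $(t,x)$ of
  $\partial^2_{uu}E(\cdot,\cdot,k)$, which are continuous in $(t,x)$ for each $k$ but jointly
  only integrable, so one cannot differentiate under the integral over $k$ at every point. What
  is true (\<open>AE_dir_derivative_absolutely_continuous\<close>) is that at almost every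
  $(t,x)$ each first derivative of $\partial_uE$ is an absolutely continuous function of $u$ whose
  density is the corresponding derivative of $\partial^2_{uu}E$. This is seen by integrating along
  short segments in the direction of differentiation: Fubini's theorem and the fundamental theorem
  of calculus give the identity in integrated form on almost every segment, hence at almost every
  point of almost every segment, and translation invariance of Lebesgue measure brings it back to
  almost every point of the space.

  At such a point everything else is integration by parts for absolutely continuous functions
  (\<open>kruzkov_kernel_integral\<close>), applied to the derivatives of $\partial_uE$ paired
  with the identity or with $f$, and to $\partial_uE$ paired with $\mathrm{div}_xf$. The derivatives of
  $E$ and $F$ themselves are recovered by the classical Leibniz rule, since the mixed derivatives
  required by the class $\mathscr F$ are continuous. Finally $u$ and $u_o$ are replaced by Borel
  functions with values in $[a,b]$, which makes the integrands jointly Borel measurable, and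
  Fubini's theorem exchanges the integrals over $k$ and over time and space.
\<close>

section \<open>Lebesgue and Borel integrals\<close>

text \<open>
  Lebesgue measure is complete, so \<open>f\<close> inherits measurability from its Borel version
  \<open>g\<close>.
\<close>

lemma integral_lebesgue_eq_lborel:
  fixes f g :: "'a::euclidean_space \<Rightarrow> real"
  assumes eq: "AE x in lborel. f x = g x" and g[measurable]: "g \<in> borel_measurable borel"
  shows "integral\<^sup>L lebesgue f = integral\<^sup>L lborel g"
proof -
  have gm: "g \<in> borel_measurable lebesgue"
    by (intro measurable_completion) simp
  have eq': "AE x in lebesgue. f x = g x"
    using eq by (rule AE_completion)
  have fm: "f \<in> borel_measurable lebesgue"
  proof (rule measurableI)
    fix A :: "real set" assume A: "A \<in> sets borel"
    have "g -` A \<inter> space lebesgue \<in> sets lebesgue"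
      using gm A by (rule measurable_sets)
    then show "f -` A \<inter> space lebesgue \<in> sets lebesgue"
      by (rule completion.in_sets_AE[rotated]) (use eq' in \<open>auto elim: eventually_mono\<close>)
  qed auto
  have "integral\<^sup>L lebesgue f = integral\<^sup>L lebesgue g"
    by (rule integral_cong_AE[OF fm gm eq'])
  also have "\<dots> = integral\<^sup>L lborel g"
    by (rule integral_completion) simp
  finally show ?thesis .
qed

text \<open>
  The functionals are iterated integrals of functions that are only Lebesgue measurable in
  $(t,x)$. A Borel version that vanishes outside $I$ turns them into a single integral for the
  product measure, where Fubini's theorem applies.
\<close>

lemma iterated_lebesgue_integral:
  fixes H H' :: "real \<times> 'b::euclidean_space \<Rightarrow> real"
  assumes int: "integrable lborel H'"
    and eq: "AE z in lborel. fst z \<in> I \<longrightarrow> H z = H' z"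
    and off: "\<And>z. fst z \<notin> I \<Longrightarrow> H' z = 0"
  shows "(LINT t:I|lebesgue. LINT x|lebesgue. H (t, x)) = integral\<^sup>L lborel H'"
proof -
  have int': "integrable (lborel \<Otimes>\<^sub>M lborel) H'"
    using int by (simp add: lborel_prod)
  have mH[measurable]: "H' \<in> borel_measurable (borel \<Otimes>\<^sub>M borel)"
    using int' borel_measurable_integrable by force
  have "AE z in lborel \<Otimes>\<^sub>M lborel. fst z \<in> I \<longrightarrow> H z = H' z"
    using eq unfolding lborel_prod .
  from lborel_pair.AE_pair[OF this]
  have "AE t in lborel. AE x in lborel. t \<in> I \<longrightarrow> H (t, x) = H' (t, x)"
    by simp
  then have AE: "AE t in lborel.
      indicator I t *\<^sub>R (LINT x|lebesgue. H (t, x)) = (LINT x|lborel. H' (t, x))"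
  proof eventually_elim
    case (elim t)
    show ?case
    proof (cases "t \<in> I")
      case True
      then have "(LINT x|lebesgue. H (t, x)) = (LINT x|lborel. H' (t, x))"
        by (intro integral_lebesgue_eq_lborel) (use elim in auto)
      then show ?thesis using True by simp
    next
      case False
      then show ?thesis by (simp add: off)
    qed
  qed
  have "(LINT t:I|lebesgue. LINT x|lebesgue. H (t, x)) = (LINT t|lborel. LINT x|lborel. H' (t, x))"
    unfolding set_lebesgue_integral_def
    by (rule integral_lebesgue_eq_lborel[OF AE]) measurable
  also have "\<dots> = integral\<^sup>L lborel H'"
    using lborel_pair.integral_fst'[OF int'] by (simp add: lborel_prod)
  finally show ?thesis .
qed

text \<open>
  Both sides have the same threefold iterated integral of the absolute value. The lemma mediates
  between points \<open>(t, x, k)\<close> of the slab and pairs \<open>((t, x), k)\<close>, the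
  form in which the level \<open>k\<close> is separated from time and space.
\<close>

lemma integrable_prod_assoc_iff:
  fixes h :: "'a::euclidean_space \<times> 'b::euclidean_space \<times> 'c::euclidean_space \<Rightarrow> real"
  shows "integrable lborel (\<lambda>((x, y), z). h (x, y, z)) \<longleftrightarrow> integrable lborel h"
proof -
  let ?h = "\<lambda>((x, y), z). h (x, y, z)"
  have meas: "?h \<in> borel_measurable borel \<longleftrightarrow> h \<in> borel_measurable borel"
  proof
    assume m: "?h \<in> borel_measurable borel"
    have "(\<lambda>p :: 'a \<times> 'b \<times> 'c. ((fst p, fst (snd p)), snd (snd p))) \<in> borel \<rightarrow>\<^sub>M borel"
      by (intro borel_measurable_continuous_onI continuous_intros)
    from measurable_compose[OF this m] show "h \<in> borel_measurable borel"
      by (simp add: case_prod_unfold)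
  next
    assume m: "h \<in> borel_measurable borel"
    have "(\<lambda>p :: ('a \<times> 'b) \<times> 'c. (fst (fst p), snd (fst p), snd p)) \<in> borel \<rightarrow>\<^sub>M borel"
      by (intro borel_measurable_continuous_onI continuous_intros)
    from measurable_compose[OF this m] show "?h \<in> borel_measurable borel"
      by (simp add: case_prod_unfold)
  qed
  show ?thesis
  proof (cases "h \<in> borel_measurable borel")
    case True
    note [measurable] = True
    have m1[measurable]: "?h \<in> borel_measurable borel"
      using meas True by simp
    have "(\<integral>\<^sup>+w. norm (?h w) \<partial>lborel)
        = (\<integral>\<^sup>+w. norm (?h w) \<partial>((lborel \<Otimes>\<^sub>M lborel) \<Otimes>\<^sub>M lborel))"
      by (simp add: lborel_prod)
    also have "\<dots> = (\<integral>\<^sup>+v. \<integral>\<^sup>+z. norm (?h (v, z)) \<partial>lborel \<partial>(lborel \<Otimes>\<^sub>M lborel))"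
      by (subst lborel.nn_integral_fst[symmetric])
         (use m1 in \<open>auto simp: lborel_prod borel_prod\<close>)
    also have "\<dots> = (\<integral>\<^sup>+x. \<integral>\<^sup>+y. \<integral>\<^sup>+z. norm (h (x, y, z)) \<partial>lborel \<partial>lborel \<partial>lborel)"
    proof (subst lborel.nn_integral_fst[symmetric])
      have "(\<lambda>w. ennreal (norm (?h w)))
          \<in> borel_measurable ((lborel \<Otimes>\<^sub>M lborel) \<Otimes>\<^sub>M lborel)"
        using m1 by (simp add: lborel_prod)
      from lborel.borel_measurable_nn_integral_fst[OF this]
      show "(\<lambda>v. \<integral>\<^sup>+z. ennreal (norm (?h (v, z))) \<partial>lborel)
          \<in> borel_measurable (lborel \<Otimes>\<^sub>M lborel)" .
    qed simp
    also have "\<dots> = (\<integral>\<^sup>+x. \<integral>\<^sup>+v. norm (h (x, v)) \<partial>(lborel \<Otimes>\<^sub>M lborel) \<partial>lborel)"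
    proof (rule nn_integral_cong)
      fix x :: 'a
      have "(\<lambda>v. ennreal (norm (h (x, v)))) \<in> borel_measurable borel" by measurable
      then show "(\<integral>\<^sup>+y. \<integral>\<^sup>+z. norm (h (x, y, z)) \<partial>lborel \<partial>lborel) = (\<integral>\<^sup>+v. norm (h (x, v)) \<partial>(lborel \<Otimes>\<^sub>M lborel))"
        by (subst lborel.nn_integral_fst[symmetric]) (auto simp: borel_prod lborel_prod)
    qed
    also have "\<dots> = (\<integral>\<^sup>+w. norm (h w) \<partial>(lborel \<Otimes>\<^sub>M (lborel \<Otimes>\<^sub>M lborel)))"
      by (simp only: lborel_prod, subst lborel_prod[symmetric], subst lborel.nn_integral_fst[symmetric])
         (auto simp: borel_prod lborel_prod)
    also have "\<dots> = (\<integral>\<^sup>+w. norm (h w) \<partial>lborel)"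
      by (simp add: lborel_prod)
    finally show ?thesis using m1 True by (simp add: integrable_iff_bounded)
  next
    case False
    then show ?thesis using meas borel_measurable_integrable by fastforce
  qed
qed

lemma integrable_bounded_mult:
  fixes c h :: "'a \<Rightarrow> real"
  assumes "integrable M h" "c \<in> borel_measurable M" "\<And>y. h y \<noteq> 0 \<Longrightarrow> \<bar>c y\<bar> \<le> B"
  shows "integrable M (\<lambda>y. c y * h y)"
proof (rule Bochner_Integration.integrable_bound)
  show "integrable M (\<lambda>y. B * h y)" using assms(1) by simp
  show "(\<lambda>y. c y * h y) \<in> borel_measurable M"
    using assms(1,2) by auto
  have "\<bar>c y\<bar> * \<bar>h y\<bar> \<le> \<bar>B\<bar> * \<bar>h y\<bar>" for y
    using assms(3)[of y] by (cases "h y = 0") (auto intro!: mult_right_mono)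
  then show "AE x in M. norm (c x * h x) \<le> norm (B * h x)"
    by (simp add: abs_mult)
qed

text \<open>
  The positive and the negative part of \<open>d\<close> are densities of two finite measures
  that agree on all half-lines, hence everywhere; densities are unique almost everywhere.
\<close>

lemma AE_zero_if_integrals_zero:
  fixes d :: "real \<Rightarrow> real"
  assumes int: "set_integrable lborel {0..c} d"
    and zero: "\<And>h. h \<in> {0..c} \<Longrightarrow> (LBINT s:{0..h}. d s) = 0"
  shows "AE s in lborel. s \<in> {0..c} \<longrightarrow> d s = 0"
proof -
  \<comment> \<open>extension by zero, so that the densities live on the whole line\<close>
  define D where "D s = indicator {0..c} s * d s" for s
  have D: "integrable lborel D"
    using int by (simp add: D_def[abs_def] set_integrable_def)
  have Dm[measurable]: "D \<in> borel_measurable borel"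
    using borel_measurable_integrable[OF D] by simp
  have pos: "integrable lborel (\<lambda>s. max 0 (D s))" and neg: "integrable lborel (\<lambda>s. max 0 (- D s))"
    using D by auto
  have em: "emeasure (density lborel (\<lambda>s. ennreal (max 0 (h s)))) {x<..}
      = ennreal (LBINT s:{x<..}. max 0 (h s))" if "integrable lborel (\<lambda>s. max 0 (h s))" for x and h :: "real \<Rightarrow> real"
  proof -
    have "set_integrable lborel {x<..} (\<lambda>s. max 0 (h s))"
      using that by (auto simp: set_integrable_def intro: integrable_mult_indicator[where 'b=real, simplified])
    moreover have "emeasure (density lborel (\<lambda>s. ennreal (max 0 (h s)))) {x<..}
      = (\<integral>\<^sup>+s. ennreal (indicator {x<..} s *\<^sub>R max 0 (h s)) \<partial>lborel)"
      by (subst emeasure_density) (use borel_measurable_integrable[OF that] in \<open>auto intro!: nn_integral_cong simp: indicator_def\<close>)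
    ultimately show ?thesis
      unfolding set_integrable_def set_lebesgue_integral_def
      by (simp add: nn_integral_eq_integral)
  qed
  have D0: "(LBINT s:{x<..}. D s) = 0" for x
  proof (cases "c \<ge> 0")
    case False
    then show ?thesis by (simp add: D_def set_lebesgue_integral_def)
  next
    case True
    define y where "y = min c (max 0 x)"
    have tot: "(LBINT s. D s) = 0"
      using zero[of c] True unfolding D_def set_lebesgue_integral_def by simp
    have y: "y \<in> {0..c}" using True by (auto simp: y_def)
    have "(LBINT s:{x<..}. D s) = (LBINT s. D s) - (if x < 0 then 0 else (LBINT s:{0..y}. d s))"
    proof (cases "x < 0")
      case True
      then show ?thesis unfolding set_lebesgue_integral_def
        by (auto intro!: Bochner_Integration.integral_cong simp: D_def indicator_def)
    next
      case False
      have s: "integrable lborel (\<lambda>s. indicator {0..y} s *\<^sub>R D s)"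
        by (rule integrable_mult_indicator) (use D in auto)
      have "(LBINT s. D s) - (LBINT s:{0..y}. d s) = (LBINT s. D s) - (LBINT s. indicator {0..y} s *\<^sub>R D s)"
        unfolding set_lebesgue_integral_def using y
        by (auto intro!: Bochner_Integration.integral_cong simp: D_def indicator_def)
      also have "\<dots> = (LBINT s. D s - indicator {0..y} s *\<^sub>R D s)"
        by (rule Bochner_Integration.integral_diff[symmetric]) (use D s in auto)
      also have "\<dots> = (LBINT s:{x<..}. D s)"
        unfolding set_lebesgue_integral_def using False
        by (intro Bochner_Integration.integral_cong) (auto simp: D_def indicator_def y_def)
      finally show ?thesis using False by simp
    qed
    then show ?thesis using tot zero[OF y] by simp
  qed
  have "density lborel (\<lambda>s. ennreal (max 0 (D s))) = density lborel (\<lambda>s. ennreal (max 0 (- D s)))"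
  proof (rule measure_eqI_lessThan)
    fix x
    have i: "integrable lborel (\<lambda>s. indicator {x<..} s *\<^sub>R max 0 (D s))"
       "integrable lborel (\<lambda>s. indicator {x<..} s *\<^sub>R max 0 (- D s))"
      by (rule integrable_mult_indicator; use pos neg in simp)+
    have "(LBINT s:{x<..}. D s) = (LBINT s:{x<..}. max 0 (D s)) - (LBINT s:{x<..}. max 0 (- D s))"
      unfolding set_lebesgue_integral_def
      by (subst Bochner_Integration.integral_diff[symmetric, OF i])
         (auto intro!: Bochner_Integration.integral_cong simp: indicator_def max_def)
    then show "emeasure (density lborel (\<lambda>s. ennreal (max 0 (D s)))) {x<..}
       = emeasure (density lborel (\<lambda>s. ennreal (max 0 (- D s)))) {x<..}"
      using D0[of x] by (simp add: em pos neg)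
    show "emeasure (density lborel (\<lambda>s. ennreal (max 0 (D s)))) {x<..} < \<infinity>"
      by (simp add: em pos)
  qed auto
  then have "AE s in lborel. ennreal (max 0 (D s)) = ennreal (max 0 (- D s))"
    by (intro sigma_finite_measure.density_unique[OF sigma_finite_lborel]) auto
  then show ?thesis
  proof eventually_elim
    case (elim s)
    then have "max 0 (D s) = max 0 (- D s)" by (simp add: ennreal_inj)
    then show ?case by (auto simp: D_def max_def split: if_splits)
  qed
qed

lemma lborel_integrable_translation:
  fixes h :: "'a::euclidean_space \<Rightarrow> real"
  assumes "integrable lborel h"
  shows "integrable lborel (\<lambda>x. h (x + c))" and "(LBINT x. h (x + c)) = integral\<^sup>L lborel h"
proof -
  have *: "(+) c = (\<lambda>x. x + c)" by (auto simp: add.commute)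
  have m: "h \<in> borel_measurable lborel" using assms by auto
  have "integrable (distr lborel borel ((+) c)) h" using assms by (simp add: lborel_distr_plus)
  then show "integrable lborel (\<lambda>x. h (x + c))"
    by (subst (asm) integrable_distr_eq) (use m in \<open>auto simp: add.commute\<close>)
  have "integral\<^sup>L lborel h = integral\<^sup>L (distr lborel borel ((+) c)) h" by (simp add: lborel_distr_plus)
  also have "\<dots> = (LBINT x. h (x + c))"
    by (subst integral_distr) (use m in \<open>auto simp: add.commute\<close>)
  finally show "(LBINT x. h (x + c)) = integral\<^sup>L lborel h" by simp
qed

lemma AE_lborel_translation:
  fixes c :: "'a::euclidean_space"
  assumes "AE x in lborel. Q x"
  shows "AE x in lborel. Q (x + c)"
proof -
  have "AE x in distr lborel borel ((+) c). Q x"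
    using assms unfolding lborel_distr_plus .
  from AE_distrD[OF _ this] show ?thesis by (simp add: add.commute)
qed

text \<open>
  By translation invariance all sections at fixed \<open>s\<close> have the same $L^1$ norm.
\<close>

lemma integrable_along_lines:
  fixes h :: "'a::euclidean_space \<Rightarrow> real"
  assumes "integrable lborel h"
  shows "integrable lborel (\<lambda>(x, s). indicator {0..1::real} s * h (x + s *\<^sub>R v))"
proof -
  have m[measurable]: "h \<in> borel_measurable borel" using assms by auto
  have mm: "(\<lambda>(s, x). indicator {0..1::real} s * h (x + s *\<^sub>R v)) \<in> borel_measurable (borel \<Otimes>\<^sub>M borel)"
    by measurable
  have "integrable (lborel \<Otimes>\<^sub>M lborel) (\<lambda>(s, x). indicator {0..1::real} s * h (x + s *\<^sub>R v))"
  proof (rule lborel_pair.Fubini_integrable)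
    have "(\<lambda>s. LINT y|lborel. norm (case (s, y) of (s, x) \<Rightarrow> indicator {0..1} s * h (x + s *\<^sub>R v)))
       = (\<lambda>s. indicator {0..1} s * (LBINT x. \<bar>h x\<bar>))"
      using lborel_integrable_translation(2)[OF integrable_abs[OF assms]]
      by (auto simp: abs_mult indicator_def)
    then show "integrable lborel (\<lambda>s. LINT y|lborel. norm (case (s, y) of (s, x) \<Rightarrow> indicator {0..1} s * h (x + s *\<^sub>R v)))"
      by simp
  qed (use mm lborel_integrable_translation(1)[OF assms] in auto)
  from lborel_pair.integrable_product_swap[OF this] show ?thesis
    by (simp add: lborel_prod case_prod_unfold)
qed

section \<open>Derivatives along a direction\<close>

text \<open>
  Time and space derivatives are both instances of this notion, so the exchange of derivatives
  and integrals has to be treated only once. The derivative is two-sided, which fits the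
  interior of the time interval; the initial time is a null set.
\<close>

definition has_dir_derivative ::
    "('a::real_normed_vector \<Rightarrow> real) \<Rightarrow> real \<Rightarrow> 'a \<Rightarrow> 'a \<Rightarrow> bool" where
  "has_dir_derivative P p v z \<longleftrightarrow> ((\<lambda>s. P (z + s *\<^sub>R v)) has_real_derivative p) (at 0)"

lemma has_dir_derivative_along_line:
  assumes "has_dir_derivative P p v (z + s *\<^sub>R v)"
  shows "((\<lambda>r. P (z + r *\<^sub>R v)) has_real_derivative p) (at s)"
proof -
  have "((\<lambda>r. P (z + s *\<^sub>R v + (r - s) *\<^sub>R v)) has_real_derivative p) (at (0 + s))"
    using assms unfolding has_dir_derivative_def
    by (subst DERIV_shift) simp
  then show ?thesis by (simp add: algebra_simps)
qed

lemma continuous_on_line: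
  fixes p :: "'a::real_normed_vector \<Rightarrow> 'b::topological_space"
  assumes "continuous_on \<Omega> p" "\<And>s. s \<in> S \<Longrightarrow> z + s *\<^sub>R v \<in> \<Omega>"
  shows "continuous_on S (\<lambda>s. p (z + s *\<^sub>R v))"
  by (rule continuous_on_compose2[OF assms(1)]) (use assms(2) in \<open>auto intro!: continuous_intros\<close>)

lemma integral_along_line:
  fixes P p :: "'a::real_normed_vector \<Rightarrow> real"
  assumes "\<And>y. y \<in> \<Omega> \<Longrightarrow> has_dir_derivative P (p y) v y" "continuous_on \<Omega> p"
    and "0 \<le> h" "\<And>s. s \<in> {0..h} \<Longrightarrow> z + s *\<^sub>R v \<in> \<Omega>"
  shows "(LBINT s:{0..h}. p (z + s *\<^sub>R v)) = P (z + h *\<^sub>R v) - P z"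
proof -
  have "(LBINT s. indicator {0..h} s *\<^sub>R p (z + s *\<^sub>R v)) = P (z + h *\<^sub>R v) - P (z + 0 *\<^sub>R v)"
  proof (rule integral_FTC_atLeastAtMost[OF \<open>0 \<le> h\<close>])
    show "continuous_on {0..h} (\<lambda>s. p (z + s *\<^sub>R v))"
      by (rule continuous_on_line[OF assms(2)]) (use assms in auto)
    fix s assume "0 \<le> s" "s \<le> h"
    then have "((\<lambda>r. P (z + r *\<^sub>R v)) has_real_derivative p (z + s *\<^sub>R v)) (at s)"
      using assms by (intro has_dir_derivative_along_line) auto
    then show "((\<lambda>r. P (z + r *\<^sub>R v)) has_vector_derivative p (z + s *\<^sub>R v)) (at s within {0..h})"
      by (simp add: has_real_derivative_iff_has_vector_derivative has_vector_derivative_at_within)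
  qed
  then show ?thesis by (simp add: set_lebesgue_integral_def)
qed

text \<open>
  The integral of $P(y+v)-P(y)$ vanishes by translation invariance, and equals the integral of
  the derivative of $P$ in direction $v$ over all segments from $y$ to $y+v$. By Fubini's theorem
  and translation invariance again, the latter is the integral of the derivative itself.
\<close>

lemma integral_dir_derivative_compact_support:
  fixes P p :: "'a::euclidean_space \<Rightarrow> real"
  assumes deriv: "\<And>y. has_dir_derivative P (p y) v y" and cont: "continuous_on UNIV p"
    and contP: "continuous_on UNIV P"
    and K: "compact K" "\<And>y. y \<notin> K \<Longrightarrow> P y = 0"
  shows "(LBINT y. p y) = 0"
proof -
  let ?p = "\<lambda>x s. indicator {0..1::real} s * p (x + s *\<^sub>R v)"
  have p0: "p y = 0" if "y \<notin> K" for y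
  proof -
    have "open (- K)" using K by (simp add: compact_imp_closed open_Compl)
    then have "open ((\<lambda>s. y + s *\<^sub>R v) -` (- K))"
      by (intro continuous_open_vimage) (auto intro!: continuous_intros)
    then have "eventually (\<lambda>s. s \<in> (\<lambda>s. y + s *\<^sub>R v) -` (- K)) (nhds 0)"
      using that by (intro eventually_nhds_in_open) auto
    then have "eventually (\<lambda>s. P (y + s *\<^sub>R v) = 0) (nhds 0)"
      by eventually_elim (use K in auto)
    then have "((\<lambda>s. P (y + s *\<^sub>R v)) has_real_derivative p y) (at 0) \<longleftrightarrow> ((\<lambda>s. 0) has_real_derivative p y) (at 0)"
      by (intro DERIV_cong_ev) auto
    then show "p y = 0"
      using deriv[of y] DERIV_const[of 0] DERIV_unique unfolding has_dir_derivative_def by blast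
  qed
  have int: "integrable lborel h" if "continuous_on UNIV h" "\<And>y. y \<notin> K \<Longrightarrow> h y = 0" for h :: "'a \<Rightarrow> real"
  proof -
    have "integrable lborel (\<lambda>y. indicator K y *\<^sub>R h y)"
      by (rule borel_integrable_compact) (use K that in \<open>auto intro: continuous_on_subset\<close>)
    also have "(\<lambda>y. indicator K y *\<^sub>R h y) = h"
      using that(2) by (auto simp: indicator_def fun_eq_iff)
    finally show ?thesis .
  qed
  have iP: "integrable lborel P" and ip: "integrable lborel p"
    using int[OF contP] int[OF cont] K p0 by auto
  have "integrable (lborel \<Otimes>\<^sub>M lborel) (\<lambda>(x, s). ?p x s)"
    using integrable_along_lines[OF ip, of v] by (simp add: lborel_prod)
  from lborel_pair.Fubini_integral[OF this]
  have "(LBINT s. LBINT x. ?p x s)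
      = (LBINT x. LBINT s. ?p x s)" .
  also have "(LBINT x. LBINT s. ?p x s) = (LBINT x. P (x + v) - P x)"
    using integral_along_line[OF deriv cont, of 1]
    by (simp add: set_lebesgue_integral_def)
  also have "\<dots> = 0"
    using lborel_integrable_translation[OF iP, of v] iP by simp
  also have "(LBINT s. LBINT x. ?p x s) = (LBINT s. indicator {0..1::real} s * (LBINT x. p x))"
    using lborel_integrable_translation(2)[OF ip] by simp
  finally show ?thesis by simp
qed

text \<open>
  The classical Leibniz rule for jointly continuous integrands, restricted to one direction.
\<close>

lemma dir_derivative_parametric_integral:
  fixes \<Omega> :: "'a::euclidean_space set" and \<eta> \<eta>' :: "'a \<Rightarrow> real \<Rightarrow> real"
  assumes \<Omega>: "open \<Omega>" "z \<in> \<Omega>"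
    and P: "\<And>y. y \<in> \<Omega> \<Longrightarrow> P y = (LBINT k:{a..w}. \<eta> y k)"
    and \<eta>: "\<And>y k. y \<in> \<Omega> \<Longrightarrow> k \<in> {a..w} \<Longrightarrow> has_dir_derivative (\<lambda>y. \<eta> y k) (\<eta>' y k) v y"
    and cont: "\<And>y. y \<in> \<Omega> \<Longrightarrow> continuous_on {a..w} (\<eta> y)"
    and cont': "continuous_on (\<Omega> \<times> {a..w}) (\<lambda>(y, k). \<eta>' y k)"
    and p: "has_dir_derivative P p v z"
  shows "p = (LBINT k:{a..w}. \<eta>' z k)"
proof -
  have "open ((\<lambda>s. z + s *\<^sub>R v) -` \<Omega>)"
    by (intro continuous_open_vimage) (auto intro!: continuous_intros \<Omega>)
  then obtain \<delta> where \<delta>: "\<delta> > 0" "cball 0 \<delta> \<subseteq> (\<lambda>s. z + s *\<^sub>R v) -` \<Omega>"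
    using \<Omega>(2) open_contains_cball[of "(\<lambda>s. z + s *\<^sub>R v) -` \<Omega>"]
    by (auto dest!: bspec[of _ _ 0])
  define U where "U = cball (0::real) \<delta>"
  have U: "z + s *\<^sub>R v \<in> \<Omega>" if "s \<in> U" for s using that \<delta> by (auto simp: U_def)
  have 0: "0 \<in> U" "convex U" "0 \<in> interior U" using \<delta> by (auto simp: U_def)
  have seti: "(LBINT k:{a..w}. h k) = integral (cbox a w) h" if "continuous_on {a..w} h" for h :: "real \<Rightarrow> real"
    using set_borel_integral_eq_integral[OF borel_integrable_atLeastAtMost'[OF that]] by simp
  have "((\<lambda>s. integral (cbox a w) (\<lambda>k. \<eta> (z + s *\<^sub>R v) k)) has_real_derivative
      integral (cbox a w) (\<lambda>k. \<eta>' (z + 0 *\<^sub>R v) k)) (at 0 within U)"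
  proof (rule leibniz_rule_field_derivative[OF _ _ _ 0(1,2)])
    fix s k assume s: "s \<in> U" and k: "k \<in> cbox a w"
    then show "((\<lambda>s. \<eta> (z + s *\<^sub>R v) k) has_real_derivative \<eta>' (z + s *\<^sub>R v) k) (at s within U)"
      by (intro has_field_derivative_at_within[OF has_dir_derivative_along_line] \<eta>) (auto simp: U)
  next
    fix s assume "s \<in> U"
    then show "\<eta> (z + s *\<^sub>R v) integrable_on cbox a w"
      using integrable_continuous_real[OF cont[OF U]] by simp
  next
    show "continuous_on (U \<times> cbox a w) (\<lambda>(s, k). \<eta>' (z + s *\<^sub>R v) k)"
    proof -
      have "continuous_on (U \<times> cbox a w) (\<lambda>x. (\<lambda>(y, k). \<eta>' y k) (z + fst x *\<^sub>R v, snd x))"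
        by (rule continuous_on_compose2[OF cont']) (auto simp: U intro!: continuous_intros)
      then show ?thesis by (simp add: case_prod_unfold)
    qed
  qed
  then have "((\<lambda>s. integral (cbox a w) (\<lambda>k. \<eta> (z + s *\<^sub>R v) k)) has_real_derivative
      integral (cbox a w) (\<lambda>k. \<eta>' z k)) (at 0)"
    using at_within_interior[OF 0(3)] by simp
  moreover have "eventually (\<lambda>s. P (z + s *\<^sub>R v) = integral (cbox a w) (\<lambda>k. \<eta> (z + s *\<^sub>R v) k)) (nhds 0)"
  proof -
    have "eventually (\<lambda>s. s \<in> interior U) (nhds 0)"
      by (rule eventually_nhds_in_open) (use 0 in auto)
    then show ?thesis
    proof eventually_elim
      case (elim s)
      then have "s \<in> U" using interior_subset by auto
      then show ?case using P[OF U] seti[OF cont[OF U]] by simp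
    qed
  qed
  ultimately have "has_dir_derivative P (integral (cbox a w) (\<eta>' z)) v z"
    unfolding has_dir_derivative_def
    by (subst DERIV_cong_ev[OF refl _ refl])
  moreover have "continuous_on {a..w} (\<eta>' z)"
  proof -
    have "continuous_on {a..w} (\<lambda>k. (\<lambda>(y, k). \<eta>' y k) (z, k))"
      by (rule continuous_on_compose2[OF cont']) (use \<Omega> in \<open>auto intro!: continuous_intros\<close>)
    then show ?thesis by simp
  qed
  ultimately show ?thesis
    using p seti DERIV_unique unfolding has_dir_derivative_def by metis
qed

text \<open>
  A Leibniz rule for derivatives $q(y,k)$ that are continuous in $y$ for each $k$, but jointly only
  integrable. Let $d(y)$ be the difference of the two sides. For almost every $y$ the function
  $q(y+sv,k)$ is integrable in $(s,k)$ for $s \in [0,1]$, so that $d$ has integral zero over every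
  segment $[y, y+hv]$ in $\Omega$ with $h \le 1$ by the fundamental theorem of calculus on both
  sides. Hence $d(y+sv)=0$ for almost all pairs $(y,s)$. Some small $s$ is good for almost all
  $y$, and a translation by $-sv$ gives the claim wherever the shifted segment stays in $\Omega$.
\<close>

lemma AE_dir_derivative_parametric_integral:
  fixes \<Omega> :: "'a::euclidean_space set" and e q :: "'a \<Rightarrow> real \<Rightarrow> real" and P p :: "'a \<Rightarrow> real"
  assumes \<Omega>: "open \<Omega>" "convex \<Omega>"
    and P: "\<And>y. y \<in> \<Omega> \<Longrightarrow> P y = (LBINT k:{a..w}. e y k)"
    and e: "\<And>y. y \<in> \<Omega> \<Longrightarrow> set_integrable lborel {a..w} (e y)"
    and p: "\<And>y. y \<in> \<Omega> \<Longrightarrow> has_dir_derivative P (p y) v y"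
    and contp: "continuous_on \<Omega> p"
    and q: "\<And>y k. y \<in> \<Omega> \<Longrightarrow> k \<in> {a..w} \<Longrightarrow> has_dir_derivative (\<lambda>y. e y k) (q y k) v y"
    and contq: "\<And>k. k \<in> {a..w} \<Longrightarrow> continuous_on \<Omega> (\<lambda>y. q y k)"
    and intq: "integrable lborel (\<lambda>(y, k). indicator (\<Omega> \<times> {a..w}) (y, k) * q y k)"
  shows "AE y in lborel. y \<in> \<Omega> \<longrightarrow> p y = (LBINT k:{a..w}. q y k)"
proof -
  define q' where "q' = (\<lambda>(y, k). indicator (\<Omega> \<times> {a..w}) (y, k) * q y k)"
  have q': "integrable lborel q'" using intq by (simp add: q'_def)
  have q'm[measurable]: "q' \<in> borel_measurable (borel \<Otimes>\<^sub>M borel)"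
    using borel_measurable_integrable[OF q'] by (simp add: borel_prod)
  have [measurable]: "\<Omega> \<in> sets borel" using \<Omega> by auto
  define d where "d y = indicator \<Omega> y * p y - (LBINT k. q' (y, k))" for y
  have pm[measurable]: "(\<lambda>y. indicator \<Omega> y * p y) \<in> borel_measurable borel"
    using borel_measurable_continuous_on_indicator[OF _ contp] by simp
  have dm[measurable]: "d \<in> borel_measurable borel"
    unfolding d_def by measurable
  have line: "y + s *\<^sub>R v \<in> \<Omega>" if "y \<in> \<Omega>" "y + c *\<^sub>R v \<in> \<Omega>" "s \<in> {0..c}" for y s c
  proof (cases "c = 0")
    case False
    then have "(1 - s / c) *\<^sub>R y + (s / c) *\<^sub>R (y + c *\<^sub>R v) \<in> \<Omega>"
      using that \<Omega>(2) by (intro convexD) auto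
    moreover have "(1 - s / c) *\<^sub>R y + (s / c) *\<^sub>R (y + c *\<^sub>R v) = y + s *\<^sub>R v"
      using False by (simp add: algebra_simps)
    ultimately show ?thesis by simp
  qed (use that in auto)
  have "integrable lborel (\<lambda>((y, k), s). indicator {0..1::real} s * q' (y + s *\<^sub>R v, k))"
    using integrable_along_lines[OF q', of "(v, 0)"] by (simp add: case_prod_unfold plus_prod_def)
  then have "integrable lborel (\<lambda>(y, k, s). indicator {0..1::real} s * q' (y + s *\<^sub>R v, k))"
    using integrable_prod_assoc_iff[of "\<lambda>(y, k, s). indicator {0..1::real} s * q' (y + s *\<^sub>R v, k)"]
    by simp
  then have "integrable (lborel \<Otimes>\<^sub>M lborel) (\<lambda>(y, k, s). indicator {0..1::real} s * q' (y + s *\<^sub>R v, k))"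
    by (simp add: lborel_prod)
  from lborel_pair.AE_integrable_fst'[OF this]
  have "AE y in lborel. integrable lborel (\<lambda>(k, s). indicator {0..1::real} s * q' (y + s *\<^sub>R v, k))"
    by simp
  then have AEline: "AE y in lborel. \<forall>c\<in>{0..1}. y \<in> \<Omega> \<and> y + c *\<^sub>R v \<in> \<Omega> \<longrightarrow>
      (AE s in lborel. s \<in> {0..c} \<longrightarrow> d (y + s *\<^sub>R v) = 0)"
  proof eventually_elim
    case (elim y)
    show ?case
    proof (intro ballI impI)
      fix c :: real assume c: "c \<in> {0..1}" and y: "y \<in> \<Omega> \<and> y + c *\<^sub>R v \<in> \<Omega>"
      have int1: "integrable (lborel \<Otimes>\<^sub>M lborel) (\<lambda>(k, s). indicator {0..h} s * q' (y + s *\<^sub>R v, k))"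
        if "h \<in> {0..c}" for h
      proof -
        have "integrable (lborel \<Otimes>\<^sub>M lborel) (\<lambda>(k, s). indicator {0..1} s * q' (y + s *\<^sub>R v, k))"
          using elim by (simp add: lborel_prod)
        then have "integrable (lborel \<Otimes>\<^sub>M lborel) (\<lambda>z. indicator (UNIV \<times> {0..h}) z *\<^sub>R
            (case z of (k, s) \<Rightarrow> indicator {0..1} s * q' (y + s *\<^sub>R v, k)))"
          by (rule integrable_mult_indicator[rotated]) auto
        also have "(\<lambda>z. indicator (UNIV \<times> {0..h}) z *\<^sub>R
            (case z of (k, s) \<Rightarrow> indicator {0..1} s * q' (y + s *\<^sub>R v, k)))
            = (\<lambda>(k, s). indicator {0..h} s * q' (y + s *\<^sub>R v, k))"
          using that c by (auto simp: fun_eq_iff indicator_def)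
        finally show ?thesis .
      qed
      have pc: "set_integrable lborel {0..h} (\<lambda>s. p (y + s *\<^sub>R v))" if "h \<in> {0..c}" for h
        by (rule borel_integrable_atLeastAtMost', rule continuous_on_line[OF contp])
           (use line[of y c] y that in auto)
      have qi: "integrable lborel (\<lambda>s. indicator {0..h} s * (LBINT k. q' (y + s *\<^sub>R v, k)))"
        if "h \<in> {0..c}" for h
        using lborel_pair.integrable_fst'[OF lborel_pair.integrable_product_swap[OF int1[OF that]]]
        by simp
      have deq: "indicator {0..h} s *\<^sub>R d (y + s *\<^sub>R v) = indicator {0..h} s *\<^sub>R p (y + s *\<^sub>R v)
          - indicator {0..h} s * (LBINT k. q' (y + s *\<^sub>R v, k))" if "h \<in> {0..c}" for h s
        using line[of y c s] y that by (auto simp: d_def indicator_def)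
      show "AE s in lborel. s \<in> {0..c} \<longrightarrow> d (y + s *\<^sub>R v) = 0"
      proof (rule AE_zero_if_integrals_zero)
        show "set_integrable lborel {0..c} (\<lambda>s. d (y + s *\<^sub>R v))"
          unfolding set_integrable_def using deq[of c] pc[of c] qi[of c] c
          by (simp add: set_integrable_def)
        fix h assume h: "h \<in> {0..c}"
        have ind: "indicator {0..h} s * q' (y + s *\<^sub>R v, k) =
            indicator {a..w} k * (indicator {0..h} s * q (y + s *\<^sub>R v) k)" for s k
          using line[of y c s] y h by (auto simp: q'_def indicator_def)
        have "(LBINT s. indicator {0..h} s * (LBINT k. q' (y + s *\<^sub>R v, k)))
            = (LBINT s. LBINT k. indicator {0..h} s * q' (y + s *\<^sub>R v, k))"
          by simp
        also have "\<dots> = (LBINT k. LBINT s. indicator {0..h} s * q' (y + s *\<^sub>R v, k))"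
          using lborel_pair.Fubini_integral[OF int1[OF h]] .
        also have "\<dots> = (LBINT k. indicator {a..w} k * (LBINT s:{0..h}. q (y + s *\<^sub>R v) k))"
          by (simp add: ind set_lebesgue_integral_def)
        also have "\<dots> = (LBINT k:{a..w}. e (y + h *\<^sub>R v) k - e y k)"
          unfolding set_lebesgue_integral_def[of _ "{a..w}"]
        proof (rule Bochner_Integration.integral_cong[OF refl])
          fix k
          show "indicator {a..w} k * (LBINT s:{0..h}. q (y + s *\<^sub>R v) k) =
              indicator {a..w} k *\<^sub>R (e (y + h *\<^sub>R v) k - e y k)"
          proof (cases "k \<in> {a..w}")
            case True
            have "(LBINT s:{0..h}. q (y + s *\<^sub>R v) k) = e (y + h *\<^sub>R v) k - e y k"
              by (rule integral_along_line[where \<Omega>=\<Omega>, OF q[OF _ True] contq[OF True]])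
                 (use h line[of y c] y in auto)
            then show ?thesis by simp
          qed simp
        qed
        also have "\<dots> = P (y + h *\<^sub>R v) - P y"
          using line[of y c h] y h by (simp add: set_integral_diff e P)
        also have "\<dots> = (LBINT s:{0..h}. p (y + s *\<^sub>R v))"
          by (rule integral_along_line[OF p contp, symmetric]) (use h line[of y c] y in auto)
        finally show "(LBINT s:{0..h}. d (y + s *\<^sub>R v)) = 0"
          unfolding set_lebesgue_integral_def deq[OF h]
          by (subst Bochner_Integration.integral_diff)
             (use pc[OF h] qi[OF h] in \<open>auto simp: set_integrable_def\<close>)
      qed
    qed
  qed
  \<comment> \<open>for segments of length \<open>c\<close>, one offset \<open>s\<close> serves almost every point \<open>y\<close>\<close>
  have good: "\<exists>s\<in>{0..c}. AE y in lborel. y - s *\<^sub>R v \<in> \<Omega> \<and> y + (c - s) *\<^sub>R v \<in> \<Omega> \<longrightarrow> d y = 0"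
    if c: "c \<in> {0<..1}" for c
  proof -
    have "AE y in lborel. AE s in lborel. y \<in> \<Omega> \<and> y + c *\<^sub>R v \<in> \<Omega> \<and> s \<in> {0..c} \<longrightarrow> d (y + s *\<^sub>R v) = 0"
      using AEline
    proof eventually_elim
      case (elim y)
      have "c \<in> {0..1}" using c by auto
      then show ?case using elim by (cases "y \<in> \<Omega> \<and> y + c *\<^sub>R v \<in> \<Omega>") auto
    qed
    then have "AE s in lborel. AE y in lborel. y \<in> \<Omega> \<and> y + c *\<^sub>R v \<in> \<Omega> \<and> s \<in> {0..c} \<longrightarrow> d (y + s *\<^sub>R v) = 0"
      by (subst (asm) lborel_pair.AE_commute) measurable
    moreover have "\<not> (AE s in lborel. s \<notin> {0<..<c})"
    proof
      assume "AE s in lborel. s \<notin> {0<..<c}"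
      then have "emeasure lborel {0<..<c} = 0"
        by (subst (asm) AE_iff_measurable[of "{0<..<c}"]) auto
      then show False using c by auto
    qed
    ultimately have "\<exists>s\<in>{0<..<c}. AE y in lborel. y \<in> \<Omega> \<and> y + c *\<^sub>R v \<in> \<Omega> \<and> s \<in> {0..c} \<longrightarrow> d (y + s *\<^sub>R v) = 0"
      by (smt (verit, best) eventually_mono)
    then obtain s where s0: "s \<in> {0<..<c}"
      and AE0: "AE y in lborel. y \<in> \<Omega> \<and> y + c *\<^sub>R v \<in> \<Omega> \<and> s \<in> {0..c} \<longrightarrow> d (y + s *\<^sub>R v) = 0"
      by blast
    have s: "s \<in> {0..c}" using s0 by auto
    have AE: "AE y in lborel. y \<in> \<Omega> \<and> y + c *\<^sub>R v \<in> \<Omega> \<longrightarrow> d (y + s *\<^sub>R v) = 0"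
      using AE0 by eventually_elim (use s in auto)
    from AE_lborel_translation[OF AE, of "- s *\<^sub>R v"] s show ?thesis
      by (intro bexI[of _ s]) (auto simp: algebra_simps)
  qed
  \<comment> \<open>lengths tending to \<open>0\<close>, so that the segment around any point of the open set \<open>\<Omega>\<close> is eventually inside\<close>
  have "\<forall>n. \<exists>s\<in>{0..1 / Suc n}. AE y in lborel.
      y - s *\<^sub>R v \<in> \<Omega> \<and> y + (1 / Suc n - s) *\<^sub>R v \<in> \<Omega> \<longrightarrow> d y = 0"
    by (intro allI good) (auto simp: field_simps)
  from choice[OF this[unfolded Bex_def]]
  obtain \<sigma> where \<sigma>_AE: "\<forall>n. \<sigma> n \<in> {0..1 / Suc n} \<and>
      (AE y in lborel. y - \<sigma> n *\<^sub>R v \<in> \<Omega> \<and> y + (1 / Suc n - \<sigma> n) *\<^sub>R v \<in> \<Omega> \<longrightarrow> d y = 0)" ..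
  have \<sigma>: "\<sigma> n \<in> {0..1 / Suc n}" for n
    using \<sigma>_AE by blast
  have AE: "AE y in lborel. y - \<sigma> n *\<^sub>R v \<in> \<Omega> \<and> y + (1 / Suc n - \<sigma> n) *\<^sub>R v \<in> \<Omega> \<longrightarrow> d y = 0" for n
    using \<sigma>_AE by blast
  have "AE y in lborel. \<forall>n. y - \<sigma> n *\<^sub>R v \<in> \<Omega> \<and> y + (1 / Suc n - \<sigma> n) *\<^sub>R v \<in> \<Omega> \<longrightarrow> d y = 0"
    using AE unfolding AE_all_countable by blast
  then show ?thesis
  proof eventually_elim
    case (elim y)
    show ?case
    proof
      assume y: "y \<in> \<Omega>"
      have lim: "(\<lambda>n. 1 / real (Suc n)) \<longlonglongrightarrow> 0" using LIMSEQ_inverse_real_of_nat by (simp add: inverse_eq_divide)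
      have \<sigma>0: "\<sigma> \<longlonglongrightarrow> 0"
        by (rule tendsto_sandwich[OF _ _ tendsto_const lim]) (use \<sigma> in auto)
      have "(\<lambda>n. y - \<sigma> n *\<^sub>R v) \<longlonglongrightarrow> y - 0 *\<^sub>R v"
        by (intro tendsto_intros \<sigma>0)
      then have 1: "eventually (\<lambda>n. y - \<sigma> n *\<^sub>R v \<in> \<Omega>) sequentially"
        by (rule topological_tendstoD) (use y \<Omega> in auto)
      have "(\<lambda>n. y + (1 / real (Suc n) - \<sigma> n) *\<^sub>R v) \<longlonglongrightarrow> y + (0 - 0) *\<^sub>R v"
        by (intro tendsto_intros \<sigma>0 lim)
      then have 2: "eventually (\<lambda>n. y + (1 / real (Suc n) - \<sigma> n) *\<^sub>R v \<in> \<Omega>) sequentially"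
        by (rule topological_tendstoD) (use y \<Omega> in auto)
      from 1 2 have "eventually (\<lambda>n. d y = 0) sequentially"
        by eventually_elim (use elim in auto)
      then have "d y = 0" by simp
      then show "p y = (LBINT k:{a..w}. q y k)"
        using y by (simp add: d_def q'_def set_lebesgue_integral_def indicator_times)
    qed
  qed
qed

section \<open>Absolutely continuous functions of one variable\<close>

lemma integrable_tensor:
  fixes f g :: "real \<Rightarrow> real"
  assumes f: "integrable lborel f" and g: "integrable lborel g"
  shows "integrable (lborel \<Otimes>\<^sub>M lborel) (\<lambda>(x, y). f x * g y)"
proof (rule lborel_pair.Fubini_integrable)
  have [measurable]: "f \<in> borel_measurable borel" "g \<in> borel_measurable borel"
    using f g by auto
  show "(\<lambda>(x, y). f x * g y) \<in> borel_measurable (lborel \<Otimes>\<^sub>M lborel)"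
    by measurable
qed (use f g in \<open>auto simp: abs_mult\<close>)

lemma set_integral_FTC:
  fixes h \<eta> :: "real \<Rightarrow> real"
  assumes "c \<le> d" "\<And>k. k \<in> {c..d} \<Longrightarrow> (h has_real_derivative \<eta> k) (at k within {c..d})"
    and "continuous_on {c..d} \<eta>"
  shows "(LBINT k:{c..d}. \<eta> k) = h d - h c"
  using integral_FTC_atLeastAtMost[OF assms(1), of h \<eta>] assms
  by (simp add: set_lebesgue_integral_def has_real_derivative_iff_has_vector_derivative)

text \<open>
  Write $h(d)-h(k)$ as the integral of $\eta$ over $[k,d]$ and apply Fubini's theorem to
  $\alpha(k)\,\eta(j)$ on the triangle $k \le j$.
\<close>

lemma integral_by_parts_absolutely_continuous:
  fixes A \<alpha> h \<eta> :: "real \<Rightarrow> real"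
  assumes cd: "c \<le> d" and \<alpha>: "set_integrable lborel {c..d} \<alpha>"
    and A: "\<And>k. k \<in> {c..d} \<Longrightarrow> A k - A c = (LBINT j:{c..k}. \<alpha> j)"
    and h: "\<And>k. k \<in> {c..d} \<Longrightarrow> (h has_real_derivative \<eta> k) (at k within {c..d})"
    and \<eta>: "continuous_on {c..d} \<eta>"
  shows "set_integrable lborel {c..d} (\<lambda>k. h k * \<alpha> k)"
    and "(LBINT k:{c..d}. h k * \<alpha> k) = h d * A d - h c * A c - (LBINT k:{c..d}. A k * \<eta> k)"
proof -
  define \<alpha>' where "\<alpha>' k = indicator {c..d} k * \<alpha> k" for k
  define \<eta>' where "\<eta>' k = indicator {c..d} k * \<eta> k" for k
  have \<eta>i: "set_integrable lborel {c..d} \<eta>" by (rule borel_integrable_atLeastAtMost'[OF \<eta>])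
  have i: "integrable lborel \<alpha>'" "integrable lborel \<eta>'"
    using \<alpha> \<eta>i by (simp_all add: set_integrable_def \<alpha>'_def[abs_def] \<eta>'_def[abs_def])
  \<comment> \<open>the integrand on the triangle, as a function on the plane\<close>
  define \<phi> where "\<phi> = (\<lambda>(k, j). indicator {p. fst p \<le> snd p} (k, j) *\<^sub>R (case (k, j) of (k, j) \<Rightarrow> \<alpha>' k * \<eta>' j))"
  have "closed {p :: real \<times> real. fst p \<le> snd p}"
    by (intro closed_Collect_le continuous_intros)
  then have le: "{p :: real \<times> real. fst p \<le> snd p} \<in> sets (lborel \<Otimes>\<^sub>M lborel)"
    unfolding lborel_prod sets_lborel by (rule borel_closed)
  have \<phi>: "integrable (lborel \<Otimes>\<^sub>M lborel) \<phi>"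
    unfolding \<phi>_def case_prod_eta[of "\<lambda>p. indicator {p. fst p \<le> snd p} p *\<^sub>R (case p of (k, j) \<Rightarrow> \<alpha>' k * \<eta>' j)"]
    by (rule integrable_mult_indicator[OF le integrable_tensor[OF i]])
  have h': "(LBINT j:{k..d}. \<eta> j) = h d - h k" if "k \<in> {c..d}" for k
    by (rule set_integral_FTC) 
       (use that in \<open>auto intro: DERIV_subset[OF h] continuous_on_subset[OF \<eta>]\<close>)
  have in1: "(LBINT j. \<phi> (k, j)) = \<alpha>' k * (h d - h k)" for k
  proof (cases "k \<in> {c..d}")
    case True
    have "(LBINT j. \<phi> (k, j)) = (LBINT j. \<alpha>' k * (indicator {k..d} j * \<eta> j))"
      using True by (intro Bochner_Integration.integral_cong) (auto simp: \<phi>_def \<eta>'_def indicator_def)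
    then show ?thesis using h'[OF True] by (simp add: set_lebesgue_integral_def)
  qed (simp add: \<phi>_def \<alpha>'_def)
  have in2: "(LBINT k. \<phi> (k, j)) = \<eta>' j * (A j - A c)" for j
  proof (cases "j \<in> {c..d}")
    case True
    have "(LBINT k. \<phi> (k, j)) = (LBINT k. \<eta>' j * (indicator {c..j} k * \<alpha> k))"
      using True by (intro Bochner_Integration.integral_cong) (auto simp: \<phi>_def \<alpha>'_def indicator_def)
    then show ?thesis using A[OF True] by (simp add: set_lebesgue_integral_def)
  qed (simp add: \<phi>_def \<eta>'_def)
  have I1: "integrable lborel (\<lambda>k. \<alpha>' k * (h d - h k))"
    using lborel_pair.integrable_fst'[OF \<phi>] by (simp add: in1)
  have I2: "integrable lborel (\<lambda>j. \<eta>' j * (A j - A c))"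
    using lborel_pair.integrable_fst'[OF lborel_pair.integrable_product_swap[OF \<phi>]] by (simp add: in2)
  have \<phi>': "integrable (lborel \<Otimes>\<^sub>M lborel) (\<lambda>(k, j). \<phi> (k, j))"
    using \<phi> by simp
  have F: "(LBINT k. \<alpha>' k * (h d - h k)) = (LBINT j. \<eta>' j * (A j - A c))"
    using lborel_pair.Fubini_integral[OF \<phi>'] by (simp add: in1 in2)
  have "integrable lborel (\<lambda>k. h d * \<alpha>' k - \<alpha>' k * (h d - h k))"
    using i I1 by simp
  also have "(\<lambda>k. h d * \<alpha>' k - \<alpha>' k * (h d - h k)) = (\<lambda>k. indicator {c..d} k *\<^sub>R (h k * \<alpha> k))"
    by (auto simp: \<alpha>'_def algebra_simps)
  finally show "set_integrable lborel {c..d} (\<lambda>k. h k * \<alpha> k)" by (simp add: set_integrable_def)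
  have "(LBINT k:{c..d}. h k * \<alpha> k) = (LBINT k. h d * \<alpha>' k - \<alpha>' k * (h d - h k))"
    unfolding set_lebesgue_integral_def by (auto simp: \<alpha>'_def algebra_simps intro!: Bochner_Integration.integral_cong)
  also have "\<dots> = h d * (LBINT k. \<alpha>' k) - (LBINT j. \<eta>' j * (A j - A c))"
    using i I1 F by simp
  also have "(LBINT k. \<alpha>' k) = A d - A c"
    using A[of d] cd by (simp add: set_lebesgue_integral_def \<alpha>'_def)
  also have "(LBINT j. \<eta>' j * (A j - A c)) = (LBINT k:{c..d}. A k * \<eta> k) - A c * (h d - h c)"
  proof -
    have "(LBINT k:{c..d}. A k * \<eta> k) = (LBINT j. \<eta>' j * (A j - A c) + A c * \<eta>' j)"
      unfolding set_lebesgue_integral_def by (auto simp: \<eta>'_def algebra_simps intro!: Bochner_Integration.integral_cong)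
    also have "\<dots> = (LBINT j. \<eta>' j * (A j - A c)) + A c * (LBINT j. \<eta>' j)"
      using i I2 by simp
    also have "(LBINT j. \<eta>' j) = h d - h c"
      using h'[of c] cd by (simp add: set_lebesgue_integral_def \<eta>'_def)
    finally show ?thesis by simp
  qed
  finally show "(LBINT k:{c..d}. h k * \<alpha> k) = h d * A d - h c * A c - (LBINT k:{c..d}. A k * \<eta> k)"
    by (simp add: algebra_simps)
qed

lemma set_integral_sgn_split:
  fixes \<alpha> :: "real \<Rightarrow> real"
  assumes w: "w \<in> {a..b}" and \<alpha>: "set_integrable lborel {a..b} \<alpha>"
  shows "(LBINT k:{a..b}. sgn (w - k) * \<alpha> k) = (LBINT k:{a..w}. \<alpha> k) - (LBINT k:{w..b}. \<alpha> k)"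
proof -
  have s: "set_integrable lborel {a..w} \<alpha>" "set_integrable lborel {w..b} \<alpha>"
    using w by (auto intro: set_integrable_subset[OF \<alpha>])
  have "AE k in lborel. indicator {a..b} k * (sgn (w - k) * \<alpha> k) = indicator {a..w} k * \<alpha> k - indicator {w..b} k * \<alpha> k"
    using AE_lborel_singleton[of w] by eventually_elim (use w in \<open>auto simp: indicator_def sgn_if\<close>)
  moreover have "(\<lambda>k. indicator {a..b} k * (sgn (w - k) * \<alpha> k)) \<in> borel_measurable borel"
  proof -
    have "(\<lambda>k. indicator {a..b} k * \<alpha> k) \<in> borel_measurable borel"
      using borel_measurable_integrable[OF \<alpha>[unfolded set_integrable_def]] by simp
    then have "(\<lambda>k. sgn (w - k) * (indicator {a..b} k * \<alpha> k)) \<in> borel_measurable borel"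
      by measurable
    then show ?thesis by (simp add: ac_simps)
  qed
  ultimately have "(LBINT k. indicator {a..b} k * (sgn (w - k) * \<alpha> k))
      = (LBINT k. indicator {a..w} k * \<alpha> k - indicator {w..b} k * \<alpha> k)"
    using s by (intro integral_cong_AE) (auto simp: set_integrable_def)
  then show ?thesis
    using s by (simp add: set_lebesgue_integral_def set_integrable_def)
qed

text \<open>
  The kernel $\mathrm{sgn}(w-k)(h(w)-h(k))$ vanishes at $k=w$, so integrating by parts on $[a,w]$
  and on $[w,b]$ produces boundary terms at $a$ and $b$ only. For $h$ the identity the kernel is
  the Kruzkov entropy $|w-k|$, and for $h$ a component of $f$ it is the Kruzkov flux.
\<close>

lemma kruzkov_kernel_integral:
  fixes A \<alpha> h \<eta> :: "real \<Rightarrow> real"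
  assumes w: "w \<in> {a..b}" and \<alpha>: "set_integrable lborel {a..b} \<alpha>"
    and A: "\<And>k. k \<in> {a..b} \<Longrightarrow> A k - A a = (LBINT j:{a..k}. \<alpha> j)"
    and h: "\<And>k. k \<in> {a..b} \<Longrightarrow> (h has_real_derivative \<eta> k) (at k within {a..b})"
    and \<eta>: "continuous_on {a..b} \<eta>"
  shows "set_integrable lborel {a..b} (\<lambda>k. sgn (w - k) * (h w - h k) * \<alpha> k)" (is ?i)
    and "(LBINT k:{a..b}. sgn (w - k) * (h w - h k) * \<alpha> k)
      = (LBINT k:{a..w}. A k * \<eta> k) - (LBINT k:{w..b}. A k * \<eta> k)
        + h a * A a + h b * A b - h w * (A a + A b)" (is ?t)
proof -
  have hw: "(h has_real_derivative \<eta> k) (at k within S)" if "k \<in> S" "S \<subseteq> {a..b}" for k S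
    by (rule DERIV_subset[OF h]) (use that in auto)
  have s: "set_integrable lborel {a..w} \<alpha>" "set_integrable lborel {w..b} \<alpha>"
    using w by (auto intro: set_integrable_subset[OF \<alpha>])
  have split: "(LBINT j:{a..k}. \<alpha> j) = (LBINT j:{a..w}. \<alpha> j) + (LBINT j:{w..k}. \<alpha> j)" if "k \<in> {w..b}" for k
  proof -
    have s': "set_integrable lborel {w..k} \<alpha>"
      using w that by (auto intro: set_integrable_subset[OF \<alpha>])
    have "(LBINT j:{a..k}. \<alpha> j) = (LBINT j:{a..w} \<union> {w..k}. \<alpha> j)"
      using w that by (auto intro!: arg_cong[where f="\<lambda>S. LBINT j:S. \<alpha> j"])
    also have "\<dots> = (LBINT j:{a..w}. \<alpha> j) + (LBINT j:{w..k}. \<alpha> j)"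
      by (rule set_integral_Un_AE[OF _ _ _ s(1) s'])
         (use AE_lborel_singleton[of w] in \<open>auto elim!: eventually_mono\<close>)
    finally show ?thesis .
  qed
  have A2: "A k - A w = (LBINT j:{w..k}. \<alpha> j)" if "k \<in> {w..b}" for k
    using A[of k] A[of w] split[OF that] that w by auto
  have \<eta>s: "continuous_on {a..w} \<eta>" "continuous_on {w..b} \<eta>"
    by (rule continuous_on_subset[OF \<eta>], use w in auto)+
  note 1 = integral_by_parts_absolutely_continuous[OF _ s(1) _ hw \<eta>s(1), where A=A]
  note 2 = integral_by_parts_absolutely_continuous[OF _ s(2) _ hw \<eta>s(2), where A=A]
  note ab = integral_by_parts_absolutely_continuous(1)[OF _ \<alpha> _ hw \<eta>, where A=A]
  have i1: "set_integrable lborel {a..w} (\<lambda>k. h k * \<alpha> k)"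
    and e1: "(LBINT k:{a..w}. h k * \<alpha> k) = h w * A w - h a * A a - (LBINT k:{a..w}. A k * \<eta> k)"
    by (rule 1; use w A in auto)+
  have i2: "set_integrable lborel {w..b} (\<lambda>k. h k * \<alpha> k)"
    and e2: "(LBINT k:{w..b}. h k * \<alpha> k) = h b * A b - h w * A w - (LBINT k:{w..b}. A k * \<eta> k)"
    by (rule 2; use w A2 in auto)+
  have iab: "set_integrable lborel {a..b} (\<lambda>k. h k * \<alpha> k)"
    by (rule ab) (use w A in auto)
  have i: "set_integrable lborel {a..b} (\<lambda>k. h w * \<alpha> k - h k * \<alpha> k)"
    by (intro set_integral_diff \<alpha> set_integrable_mult_right iab)
  then have i': "set_integrable lborel {a..b} (\<lambda>k. (h w - h k) * \<alpha> k)"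
    by (simp add: algebra_simps)
  show ?i
  proof -
    have "integrable lborel (\<lambda>k. sgn (w - k) * (indicator {a..b} k *\<^sub>R ((h w - h k) * \<alpha> k)))"
      by (rule integrable_bounded_mult[where B=1])
         (use i' in \<open>auto simp: set_integrable_def sgn_if\<close>)
    then show ?thesis by (simp add: set_integrable_def mult_ac)
  qed
  have "(LBINT k:{a..b}. sgn (w - k) * ((h w - h k) * \<alpha> k))
     = (LBINT k:{a..w}. h w * \<alpha> k - h k * \<alpha> k) - (LBINT k:{w..b}. h w * \<alpha> k - h k * \<alpha> k)"
    using set_integral_sgn_split[OF w i'] by (simp add: algebra_simps)
  also have "\<dots> = (h w * (A w - A a) - (LBINT k:{a..w}. h k * \<alpha> k)) - (h w * (A b - A w) - (LBINT k:{w..b}. h k * \<alpha> k))"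
  proof -
    have "(LBINT k:{a..w}. h w * \<alpha> k - h k * \<alpha> k) = h w * (A w - A a) - (LBINT k:{a..w}. h k * \<alpha> k)"
      using w by (subst set_integral_diff) (auto intro: i1 s set_integrable_mult_right simp: A[of w])
    moreover have "(LBINT k:{w..b}. h w * \<alpha> k - h k * \<alpha> k) = h w * (A b - A w) - (LBINT k:{w..b}. h k * \<alpha> k)"
      using w by (subst set_integral_diff) (auto intro: i2 s set_integrable_mult_right simp: A2[of b])
    ultimately show ?thesis by simp
  qed
  also have "\<dots> = (LBINT k:{a..w}. A k * \<eta> k) - (LBINT k:{w..b}. A k * \<eta> k)
        + h a * A a + h b * A b - h w * (A a + A b)"
    unfolding e1 e2 by (simp add: algebra_simps)
  finally show ?t by (simp add: mult.assoc)
qed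

text \<open>
  The exceptional null set of the preceding Leibniz rule depends on the upper limit $w$ of the
  integral. A single null set suffices for all rational $w$, and both sides are continuous in
  $w$.
\<close>

lemma AE_dir_derivative_absolutely_continuous:
  fixes \<Omega> :: "'a::euclidean_space set" and A e p q :: "'a \<Rightarrow> real \<Rightarrow> real"
  assumes \<Omega>: "open \<Omega>" "convex \<Omega>"
    and A: "\<And>y w. y \<in> \<Omega> \<Longrightarrow> w \<in> {a..b} \<Longrightarrow> A y w - A y a = (LBINT k:{a..w}. e y k)"
    and e: "\<And>y. y \<in> \<Omega> \<Longrightarrow> continuous_on {a..b} (e y)"
    and p: "\<And>y w. y \<in> \<Omega> \<Longrightarrow> w \<in> {a..b} \<Longrightarrow> has_dir_derivative (\<lambda>y. A y w) (p y w) v y"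
    and contp: "continuous_on (\<Omega> \<times> {a..b}) (\<lambda>(y, w). p y w)"
    and q: "\<And>y k. y \<in> \<Omega> \<Longrightarrow> k \<in> {a..b} \<Longrightarrow> has_dir_derivative (\<lambda>y. e y k) (q y k) v y"
    and contq: "\<And>k. k \<in> {a..b} \<Longrightarrow> continuous_on \<Omega> (\<lambda>y. q y k)"
    and intq: "integrable lborel (\<lambda>(y, k). indicator (\<Omega> \<times> {a..b}) (y, k) * q y k)"
  shows "AE y in lborel. y \<in> \<Omega> \<longrightarrow> set_integrable lborel {a..b} (q y) \<and>
           (\<forall>w\<in>{a..b}. p y w - p y a = (LBINT k:{a..w}. q y k))"
proof -
  let ?ac = "\<lambda>y w. p y w - p y a = (LBINT k:{a..w}. q y k)"
  let ?q = "\<lambda>y k. indicator (\<Omega> \<times> {a..b}) (y, k) * q y k"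
  have pw: "continuous_on \<Omega> (\<lambda>y. p y w)" if "w \<in> {a..b}" for w
  proof -
    have "continuous_on \<Omega> (\<lambda>y. (\<lambda>(y, w). p y w) (y, w))"
      by (rule continuous_on_compose2[OF contp]) (use that in \<open>auto intro!: continuous_intros\<close>)
    then show ?thesis by simp
  qed
  have py: "continuous_on {a..b} (p y)" if "y \<in> \<Omega>" for y
  proof -
    have "continuous_on {a..b} (\<lambda>w. (\<lambda>(y, w). p y w) (y, w))"
      by (rule continuous_on_compose2[OF contp]) (use that in \<open>auto intro!: continuous_intros\<close>)
    then show ?thesis by simp
  qed
  have AEw: "AE y in lborel. y \<in> \<Omega> \<longrightarrow> ?ac y w" if w: "w \<in> {a..b}" for w
  proof (rule AE_dir_derivative_parametric_integral[OF \<Omega>, where P="\<lambda>y. A y w - A y a" and e=e and v=v])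
    show "A y w - A y a = (LBINT k:{a..w}. e y k)" if "y \<in> \<Omega>" for y
      by (rule A[OF that w])
    show "set_integrable lborel {a..w} (e y)" if "y \<in> \<Omega>" for y
      by (rule borel_integrable_atLeastAtMost', rule continuous_on_subset[OF e[OF that]]) (use w in auto)
    show "has_dir_derivative (\<lambda>y. A y w - A y a) (p y w - p y a) v y" if "y \<in> \<Omega>" for y
      using p[OF that, of w] p[OF that, of a] w unfolding has_dir_derivative_def
      by (intro DERIV_diff) auto
    show "continuous_on \<Omega> (\<lambda>y. p y w - p y a)"
      using pw[of w] pw[of a] w by (intro continuous_intros) auto
    show "has_dir_derivative (\<lambda>y. e y k) (q y k) v y" if "y \<in> \<Omega>" "k \<in> {a..w}" for y k
      using q that w by auto
    show "continuous_on \<Omega> (\<lambda>y. q y k)" if "k \<in> {a..w}" for k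
      using contq that w by auto
    have "integrable lborel (\<lambda>z. indicator (UNIV \<times> {a..w}) z *\<^sub>R (case z of (y, k) \<Rightarrow> ?q y k))"
      by (rule integrable_mult_indicator[OF _ intq]) (auto intro!: borel_closed closed_Times)
    also have "(\<lambda>z. indicator (UNIV \<times> {a..w}) z *\<^sub>R (case z of (y, k) \<Rightarrow> ?q y k))
       = (\<lambda>(y, k). indicator (\<Omega> \<times> {a..w}) (y, k) * q y k)"
      using w by (auto simp: fun_eq_iff indicator_def)
    finally show "integrable lborel (\<lambda>(y, k). indicator (\<Omega> \<times> {a..w}) (y, k) * q y k)" .
  qed
  have "integrable (lborel \<Otimes>\<^sub>M lborel) (\<lambda>(y, k). ?q y k)"
    using intq by (simp add: lborel_prod)
  from lborel_pair.AE_integrable_fst'[OF this]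
  have AEi: "AE y in lborel. y \<in> \<Omega> \<longrightarrow> set_integrable lborel {a..b} (q y)"
    by eventually_elim (auto simp: set_integrable_def indicator_times)
  define D where "D = \<rat> \<inter> {a<..<b}"
  have "countable D" unfolding D_def by (intro countable_Int1 countable_rat)
  then have "AE y in lborel. \<forall>w\<in>D. y \<in> \<Omega> \<longrightarrow> ?ac y w"
    by (rule AE_ball_countable[THEN iffD2]) (auto simp: D_def intro!: AEw)
  then show ?thesis
    using AEi
  proof eventually_elim
    case (elim y)
    show ?case
    proof
      assume y: "y \<in> \<Omega>"
      then have qi: "set_integrable lborel {a..b} (q y)" using elim by simp
      have eqi: "(LBINT k:{a..w}. q y k) = integral {a..w} (q y)" if "w \<in> {a..b}" for w
        by (rule set_borel_integral_eq_integral, rule set_integrable_subset[OF qi]) (use that in auto)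
      have "continuous_on {a..b} (\<lambda>w. integral {a..w} (q y))"
        by (rule indefinite_integral_continuous_1, rule set_borel_integral_eq_integral(1)[OF qi])
      then have cont: "continuous_on {a..b} (\<lambda>w. p y w - p y a - integral {a..w} (q y))"
        by (intro continuous_intros py y)
      have "?ac y w" if w: "w \<in> {a..b}" for w
      proof (cases "a < b")
        case True
        have cl: "closure D = {a..b}"
        proof -
          have "closure (\<rat> :: real set) = UNIV" by (rule Rats_closure_real)
          then have "closure ({a<..<b} \<inter> \<rat>) = closure {a<..<b}"
            by (intro closure_open_Int_superset) auto
          then show ?thesis using True by (simp add: D_def Int_commute)
        qed
        have "p y w - p y a - integral {a..w} (q y) = 0"
          by (rule continuous_constant_on_closure[of D])
             (use cl cont elim eqi y w in \<open>auto simp: D_def\<close>)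
        then show ?thesis using eqi[OF w] by simp
      next
        case False
        then have "w = a" using w by auto
        then show ?thesis
          using eqi[OF w] by simp
      qed
      then show "set_integrable lborel {a..b} (q y) \<and>
           (\<forall>w\<in>{a..b}. ?ac y w)"
        using qi by blast
    qed
  qed
qed

section \<open>Partial derivatives on a time-space cylinder\<close>

abbreviation jointly_continuous :: "real set \<Rightarrow> (real \<Rightarrow> 'a::topological_space \<Rightarrow> real \<Rightarrow> 'b::topological_space) \<Rightarrow> bool"
  where "jointly_continuous I h \<equiv> continuous_on (I \<times> UNIV \<times> UNIV) (\<lambda>(t, x, u). h t x u)"

text \<open>
  The summands of the divergence and the components of the gradient, in a form that applies to
  scalar and to vector-valued functions.
\<close>

definition pdx :: "'n::finite \<Rightarrow> (real \<Rightarrow> real^'n \<Rightarrow> real \<Rightarrow> 'b::real_normed_vector) \<Rightarrow> real \<Rightarrow> real^'n \<Rightarrow> real \<Rightarrow> 'b"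
  where "pdx i \<zeta> t x u = frechet_derivative (\<lambda>y. \<zeta> t y u) (at x) (axis i 1)"

lemma divx_eq_sum_pdx: "divx F t x u = (\<Sum>i\<in>UNIV. pdx i F t x u $ i)"
  by (simp add: divx_def divergence_def pdx_def)

lemma gradx_nth: "gradx \<zeta> t x u $ i = pdx i \<zeta> t x u"
  by (simp add: gradx_def grad_def pdx_def)

lemma time_interval_cases:
  assumes "time_interval I"
  obtains "I = {0..}" | T where "T > 0" "I = {0..<T}"
  using assms by (auto simp: time_interval_def)

lemma time_interval_basic:
  assumes I: "time_interval I"
  shows "0 \<in> I" "convex I" "I \<in> sets borel" "t \<in> I \<Longrightarrow> t \<ge> 0"
    and "t \<in> I \<Longrightarrow> t \<noteq> 0 \<Longrightarrow> t \<in> interior I"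
    and "t \<in> I \<Longrightarrow> at t within I \<noteq> bot"
    and "t \<in> I \<Longrightarrow> eventually (\<lambda>n. t + 1 / Suc n \<in> I) sequentially"
proof -
  show "0 \<in> I" "convex I" "I \<in> sets borel" "t \<in> I \<Longrightarrow> t \<ge> 0"
    using I by (cases rule: time_interval_cases; auto)+
  show "t \<in> I \<Longrightarrow> t \<noteq> 0 \<Longrightarrow> t \<in> interior I"
    using I
  proof (cases rule: time_interval_cases)
    case (2 T)
    assume "t \<in> I" "t \<noteq> 0"
    then show ?thesis using 2 interior_maximal[of "{0<..<T}" I] by auto
  qed auto
  have lim: "(\<lambda>n. t + 1 / real (Suc n)) \<longlonglongrightarrow> t"
    using tendsto_add[OF tendsto_const[of t] LIMSEQ_inverse_real_of_nat] by (simp add: inverse_eq_divide)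
  show ev: "eventually (\<lambda>n. t + 1 / Suc n \<in> I) sequentially" if "t \<in> I"
    using I
  proof (cases rule: time_interval_cases)
    case 1
    then show ?thesis using that by auto
  next
    case (2 T)
    then have "eventually (\<lambda>n. t + 1 / real (Suc n) < T) sequentially"
      using lim that by (intro order_tendstoD) auto
    then show ?thesis
      by eventually_elim (use 2 that in auto)
  qed
  show "at t within I \<noteq> bot" if "t \<in> I"
  proof -
    have "t islimpt I"
      unfolding islimpt_sequential
    proof -
      from ev[OF that] obtain N where N: "\<And>n. n \<ge> N \<Longrightarrow> t + 1 / real (Suc n) \<in> I"
        by (auto simp: eventually_sequentially)
      show "\<exists>f. (\<forall>n. f n \<in> I - {t}) \<and> f \<longlonglongrightarrow> t"
        using N[OF le_add2] LIMSEQ_ignore_initial_segment[OF lim, of N]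
        by (intro exI[of _ "\<lambda>n. t + 1 / real (Suc (n + N))"]) simp
    qed
    then show ?thesis by (simp add: trivial_limit_within)
  qed
qed

lemma AE_time_interior:
  assumes I: "time_interval I"
  shows "AE z :: real \<times> 'b::euclidean_space in lborel. fst z \<in> I \<longrightarrow> z \<in> interior I \<times> UNIV"
proof -
  have "AE z :: real \<times> 'b in lborel \<Otimes>\<^sub>M lborel. fst z \<noteq> 0"
  proof (rule lborel_pair.AE_pair_measure)
    show "{z \<in> space (lborel \<Otimes>\<^sub>M lborel). fst z \<noteq> (0::real)} \<in> sets (lborel \<Otimes>\<^sub>M (lborel :: 'b measure))"
      by measurable
    show "AE t in lborel. AE y :: 'b in lborel. fst (t, y) \<noteq> (0::real)"
      using AE_lborel_singleton[of 0] by eventually_elim auto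
  qed
  then have "AE z :: real \<times> 'b in lborel. fst z \<noteq> 0"
    unfolding lborel_prod .
  then show ?thesis
    by eventually_elim (use time_interval_basic(5)[OF I] in auto)
qed

lemma has_derivative_slices:
  assumes D: "(h has_derivative D) (at (t, y) within J \<times> UNIV)" and t: "t \<in> J"
  shows "((\<lambda>s. h (s, y)) has_vector_derivative D (1, 0)) (at t within J)"
    and "((\<lambda>y. h (t, y)) has_derivative (\<lambda>d. D (0, d))) (at y)"
proof -
  have lin: "bounded_linear D" using D by (rule has_derivative_bounded_linear)
  have "((\<lambda>s. h (s, y)) has_derivative (\<lambda>d. D (d, 0))) (at t within J)"
  proof (rule has_derivative_in_compose[where f="\<lambda>s. (s, y)" and f'="\<lambda>d. (d, 0)"])
    show "((\<lambda>s. (s, y)) has_derivative (\<lambda>d. (d, 0))) (at t within J)"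
      by (auto intro!: derivative_eq_intros)
    show "(h has_derivative D) (at (t, y) within (\<lambda>s. (s, y)) ` J)"
      by (rule has_derivative_subset[OF D]) auto
  qed
  moreover have "(\<lambda>d. D (d, 0)) = (\<lambda>d. d *\<^sub>R D (1, 0))"
  proof
    fix d
    show "D (d, 0) = d *\<^sub>R D (1, 0)"
    using linear_scale[OF bounded_linear.linear[OF lin], of d "(1, 0)"]
    by (simp only: scaleR_Pair real_scaleR_def mult_1_right scaleR_zero_right)
  qed
  ultimately show "((\<lambda>s. h (s, y)) has_vector_derivative D (1, 0)) (at t within J)"
    by (simp only: has_vector_derivative_def)
  show "((\<lambda>y. h (t, y)) has_derivative (\<lambda>d. D (0, d))) (at y)"
  proof (rule has_derivative_in_compose[where f="\<lambda>y. (t, y)" and f'="\<lambda>d. (0, d)"])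
    show "((\<lambda>y. (t, y)) has_derivative (\<lambda>d. (0, d))) (at y)"
      by (auto intro!: derivative_eq_intros)
    show "(h has_derivative D) (at (t, y) within range (\<lambda>y. (t, y)))"
      by (rule has_derivative_subset[OF D]) (use t in auto)
  qed
qed

lemma has_derivative_slice_triple:
  assumes D: "(h has_derivative D) (at (t, x, u) within J \<times> UNIV \<times> UNIV)" and t: "t \<in> J"
  shows "((\<lambda>s. h (s, x, u)) has_vector_derivative D (1, 0, 0)) (at t within J)"
    and "((\<lambda>y. h (t, y, u)) has_derivative (\<lambda>d. D (0, d, 0))) (at x)"
    and "((\<lambda>w. h (t, x, w)) has_vector_derivative D (0, 0, 1)) (at u)"
proof -
  have D': "(h has_derivative D) (at (t, (x, u)) within J \<times> UNIV)"
    using D by simp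
  show "((\<lambda>s. h (s, x, u)) has_vector_derivative D (1, 0, 0)) (at t within J)"
    using has_derivative_slices(1)[OF D' t] by (simp add: zero_prod_def)
  have 2: "((\<lambda>y. h (t, y)) has_derivative (\<lambda>d. D (0, d))) (at (x, u))"
    by (rule has_derivative_slices(2)[OF D' t])
  have lin: "bounded_linear (\<lambda>d. D (0, d))" using 2 by (rule has_derivative_bounded_linear)
  show "((\<lambda>y. h (t, y, u)) has_derivative (\<lambda>d. D (0, d, 0))) (at x)"
    by (rule has_derivative_compose[where f="\<lambda>y. (y, u)" and f'="\<lambda>d. (d, 0)", OF _ 2])
       (auto intro!: derivative_eq_intros)
  have "((\<lambda>w. h (t, x, w)) has_derivative (\<lambda>d. D (0, 0, d))) (at u)"
    by (rule has_derivative_compose[where f="\<lambda>w. (x, w)" and f'="\<lambda>d. (0, d)", OF _ 2])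
       (auto intro!: derivative_eq_intros)
  moreover have "(\<lambda>d. D (0, 0, d)) = (\<lambda>d. d *\<^sub>R D (0, 0, 1))"
  proof
    fix d
    show "D (0, 0, d) = d *\<^sub>R D (0, 0, 1)"
    using linear_scale[OF bounded_linear.linear[OF lin], of d "(0, 1)"]
    by (simp only: scaleR_Pair real_scaleR_def mult_1_right scaleR_zero_right)
  qed
  ultimately show "((\<lambda>w. h (t, x, w)) has_vector_derivative D (0, 0, 1)) (at u)"
    by (simp only: has_vector_derivative_def)
qed

lemma continuous_on_blinfun_apply_const:
  "continuous_on S D \<Longrightarrow> continuous_on S (\<lambda>z. blinfun_apply (D z) v)"
  by (intro continuous_intros)

lemma C1_on_time_space:
  fixes h :: "real \<Rightarrow> real^'n \<Rightarrow> real"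
  assumes I: "time_interval I" and C1: "C1_on (I \<times> UNIV) (\<lambda>(t, x). h t x)"
  shows "t \<in> I \<Longrightarrow> ((\<lambda>s. h s x) has_vector_derivative vector_derivative (\<lambda>s. h s x) (at t within I)) (at t within I)"
    and "t \<in> I \<Longrightarrow> (h t has_derivative frechet_derivative (h t) (at x)) (at x)"
    and "continuous_on (I \<times> UNIV) (\<lambda>(t, x). vector_derivative (\<lambda>s. h s x) (at t within I))"
    and "continuous_on (I \<times> UNIV) (\<lambda>(t, x). frechet_derivative (h t) (at x) v)"
proof -
  obtain D :: "real \<times> (real^'n) \<Rightarrow> (real \<times> (real^'n)) \<Rightarrow>\<^sub>L real" where
    D: "\<And>z. z \<in> I \<times> UNIV \<Longrightarrow> ((\<lambda>(t, x). h t x) has_derivative blinfun_apply (D z)) (at z within I \<times> UNIV)"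
    and cont: "continuous_on (I \<times> UNIV) D"
    using C1 unfolding C1_on_def by blast
  have 1: "((\<lambda>s. h s x) has_vector_derivative D (t, x) (1, 0)) (at t within I)" if "t \<in> I" for t x
    using has_derivative_slices(1)[OF D, of t x] that by simp
  have 2: "(h t has_derivative (\<lambda>d. D (t, x) (0, d))) (at x)" if "t \<in> I" for t x
    using has_derivative_slices(2)[OF D, of t x] that by simp
  have e1: "vector_derivative (\<lambda>s. h s x) (at t within I) = D (t, x) (1, 0)" if "t \<in> I" for t x
    using 1[OF that] time_interval_basic(6)[OF I that] by (rule vector_derivative_within[rotated])
  have e2: "frechet_derivative (h t) (at x) = (\<lambda>d. D (t, x) (0, d))" if "t \<in> I" for t x
    using frechet_derivative_at[OF 2[OF that]] by simp
  show "t \<in> I \<Longrightarrow> ((\<lambda>s. h s x) has_vector_derivative vector_derivative (\<lambda>s. h s x) (at t within I)) (at t within I)"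
    using 1 e1 by simp
  show "t \<in> I \<Longrightarrow> (h t has_derivative frechet_derivative (h t) (at x)) (at x)"
    using 2 e2 by simp
  show "continuous_on (I \<times> UNIV) (\<lambda>(t, x). vector_derivative (\<lambda>s. h s x) (at t within I))"
    using continuous_on_blinfun_apply_const[OF cont, of "(1, 0)"]
    by (rule continuous_on_eq) (auto simp: e1)
  show "continuous_on (I \<times> UNIV) (\<lambda>(t, x). frechet_derivative (h t) (at x) v)"
    using continuous_on_blinfun_apply_const[OF cont, of "(0, v)"]
    by (rule continuous_on_eq) (auto simp: e2)
qed

text \<open>
  The class $\mathscr F$ speaks of derivatives within the closure of $I$. At points of $I$ they
  coincide with the derivatives within $I$ that occur in the functionals, since $I$ has no
  isolated points.
\<close>

lemma space_F_partials:
  fixes \<zeta> :: "real \<Rightarrow> real^'n \<Rightarrow> real \<Rightarrow> 'b::real_normed_vector"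
  assumes I: "time_interval I" and \<zeta>: "\<zeta> \<in> space_F I"
  shows "t \<in> I \<Longrightarrow> ((\<lambda>s. \<zeta> s x u) has_vector_derivative dt I \<zeta> t x u) (at t within I)"
    and "t \<in> I \<Longrightarrow> ((\<lambda>y. \<zeta> t y u) has_derivative frechet_derivative (\<lambda>y. \<zeta> t y u) (at x)) (at x)"
    and "t \<in> I \<Longrightarrow> ((\<lambda>w. \<zeta> t x w) has_vector_derivative du \<zeta> t x u) (at u)"
    and "t \<in> I \<Longrightarrow> ((\<lambda>s. du \<zeta> s x u) has_vector_derivative dt I (du \<zeta>) t x u) (at t within I)"
    and "t \<in> I \<Longrightarrow> ((\<lambda>y. du \<zeta> t y u) has_derivative frechet_derivative (\<lambda>y. du \<zeta> t y u) (at x)) (at x)"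
    and "jointly_continuous I \<zeta>"
    and "jointly_continuous I (dt I \<zeta>)"
    and "jointly_continuous I (pdx i \<zeta>)"
    and "jointly_continuous I (du \<zeta>)"
    and "jointly_continuous I (dt I (du \<zeta>))"
    and "jointly_continuous I (pdx i (du \<zeta>))"
proof -
  have sub: "I \<subseteq> closure I" by (rule closure_subset)
  then have sub': "I \<times> UNIV \<times> UNIV \<subseteq> closure I \<times> UNIV \<times> UNIV" by auto
  obtain D :: "real \<times> (real^'n) \<times> real \<Rightarrow> (real \<times> (real^'n) \<times> real) \<Rightarrow>\<^sub>L 'b" where
    D: "\<And>z. z \<in> closure I \<times> UNIV \<times> UNIV \<Longrightarrow> ((\<lambda>(t, x, u). \<zeta> t x u) has_derivative blinfun_apply (D z)) (at z within closure I \<times> UNIV \<times> UNIV)"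
    and contD: "continuous_on (closure I \<times> UNIV \<times> UNIV) D"
    using \<zeta> unfolding space_F_def C1_on_def mem_Collect_eq by blast
  obtain Dt :: "real \<times> (real^'n) \<times> real \<Rightarrow> 'b" where
    Dt: "\<And>t x u. t \<in> closure I \<Longrightarrow> ((\<lambda>s. du \<zeta> s x u) has_vector_derivative Dt (t, x, u)) (at t within closure I)"
    and contDt: "continuous_on (closure I \<times> UNIV \<times> UNIV) Dt"
    using \<zeta> unfolding space_F_def mem_Collect_eq by blast
  obtain Dx :: "real \<times> (real^'n) \<times> real \<Rightarrow> (real^'n) \<Rightarrow>\<^sub>L 'b" where
    Dx: "\<And>t x u. t \<in> closure I \<Longrightarrow> ((\<lambda>y. du \<zeta> t y u) has_derivative blinfun_apply (Dx (t, x, u))) (at x)"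
    and contDx: "continuous_on (closure I \<times> UNIV \<times> UNIV) Dx"
    using \<zeta> unfolding space_F_def mem_Collect_eq by blast
  note cD = continuous_on_blinfun_apply_const[OF continuous_on_subset[OF contD sub']]
  have tI: "t \<in> closure I" if "t \<in> I" for t using sub that by auto
  have dt: "vector_derivative h (at t within I) = d \<and> (h has_vector_derivative d) (at t within I)"
    if "t \<in> I" "(h has_vector_derivative d) (at t within closure I)" for h :: "real \<Rightarrow> 'b" and t d
  proof -
    have "(h has_vector_derivative d) (at t within I)"
      using that(2) sub by (rule has_vector_derivative_within_subset)
    then show ?thesis
      using vector_derivative_within[OF time_interval_basic(6)[OF I that(1)]] by auto
  qed
  note sl = has_derivative_slice_triple[OF D, simplified]
  have e1: "dt I \<zeta> t x u = D (t, x, u) (1, 0, 0)" 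
    and d1: "((\<lambda>s. \<zeta> s x u) has_vector_derivative D (t, x, u) (1, 0, 0)) (at t within I)" if "t \<in> I" for t x u
    using dt[OF that sl(1)[OF tI[OF that] tI[OF that]]] by (auto simp: dt_def)
  have d2: "((\<lambda>y. \<zeta> t y u) has_derivative (\<lambda>d. D (t, x, u) (0, d, 0))) (at x)" if "t \<in> I" for t x u
    using sl(2)[OF tI[OF that] tI[OF that]] .
  have e2: "frechet_derivative (\<lambda>y. \<zeta> t y u) (at x) = (\<lambda>d. D (t, x, u) (0, d, 0))" if "t \<in> I" for t x u
    using frechet_derivative_at[OF d2[OF that]] by simp
  have d3: "((\<lambda>w. \<zeta> t x w) has_vector_derivative D (t, x, u) (0, 0, 1)) (at u)" if "t \<in> I" for t x u
    using sl(3)[OF tI[OF that] tI[OF that]] .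
  have e3: "du \<zeta> t x u = D (t, x, u) (0, 0, 1)" if "t \<in> I" for t x u
    using vector_derivative_at[OF d3[OF that]] by (simp add: du_def)
  have e4: "dt I (du \<zeta>) t x u = Dt (t, x, u)"
    and d4: "((\<lambda>s. du \<zeta> s x u) has_vector_derivative Dt (t, x, u)) (at t within I)" if "t \<in> I" for t x u
    using dt[OF that Dt[OF tI[OF that]]] by (auto simp: dt_def)
  have e5: "frechet_derivative (\<lambda>y. du \<zeta> t y u) (at x) = Dx (t, x, u)" if "t \<in> I" for t x u
    using frechet_derivative_at[OF Dx[OF tI[OF that]]] by simp
  show "t \<in> I \<Longrightarrow> ((\<lambda>s. \<zeta> s x u) has_vector_derivative dt I \<zeta> t x u) (at t within I)"
    using d1 e1 by simp
  show "t \<in> I \<Longrightarrow> ((\<lambda>y. \<zeta> t y u) has_derivative frechet_derivative (\<lambda>y. \<zeta> t y u) (at x)) (at x)"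
    using d2 e2 by simp
  show "t \<in> I \<Longrightarrow> ((\<lambda>w. \<zeta> t x w) has_vector_derivative du \<zeta> t x u) (at u)"
    using d3 e3 by simp
  show "t \<in> I \<Longrightarrow> ((\<lambda>s. du \<zeta> s x u) has_vector_derivative dt I (du \<zeta>) t x u) (at t within I)"
    using d4 e4 by simp
  show "t \<in> I \<Longrightarrow> ((\<lambda>y. du \<zeta> t y u) has_derivative frechet_derivative (\<lambda>y. du \<zeta> t y u) (at x)) (at x)"
    using Dx tI e5 by simp
  have "continuous_on (closure I \<times> UNIV \<times> UNIV) (\<lambda>(t, x, u). \<zeta> t x u)"
    by (rule has_derivative_continuous_on[OF D])
  then show "jointly_continuous I \<zeta>"
    using sub' by (rule continuous_on_subset)
  show "jointly_continuous I (dt I \<zeta>)"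
    using cD by (rule continuous_on_eq) (auto simp: e1)
  show "jointly_continuous I (pdx i \<zeta>)"
    using cD by (rule continuous_on_eq) (auto simp: e2 pdx_def)
  show "jointly_continuous I (du \<zeta>)"
    using cD by (rule continuous_on_eq) (auto simp: e3)
  show "jointly_continuous I (dt I (du \<zeta>))"
    using continuous_on_subset[OF contDt sub'] by (rule continuous_on_eq) (auto simp: e4)
  show "jointly_continuous I (pdx i (du \<zeta>))"
    using continuous_on_blinfun_apply_const[OF continuous_on_subset[OF contDx sub']]
    by (rule continuous_on_eq) (auto simp: e5 pdx_def)
qed

lemma C2_on_du:
  fixes E :: "real \<Rightarrow> real^'n \<Rightarrow> real \<Rightarrow> real"
  assumes C2: "C2_on (I \<times> UNIV \<times> UNIV) (\<lambda>(t, x, w). E t x w)"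
  shows "t \<in> I \<Longrightarrow> ((\<lambda>w. du E t x w) has_real_derivative du (du E) t x u) (at u)"
    and "jointly_continuous I (du (du E))"
proof -
  let ?S = "I \<times> (UNIV :: (real^'n) set) \<times> (UNIV :: real set)"
  obtain D :: "real \<times> (real^'n) \<times> real \<Rightarrow> (real \<times> (real^'n) \<times> real) \<Rightarrow>\<^sub>L real" where
    D: "\<And>z. z \<in> ?S \<Longrightarrow> ((\<lambda>(t, x, w). E t x w) has_derivative blinfun_apply (D z)) (at z within ?S)"
    and C1: "C1_on ?S D"
    using C2 unfolding C2_on_def by blast
  obtain D2 where
    D2: "\<And>z. z \<in> ?S \<Longrightarrow> (D has_derivative blinfun_apply (D2 z)) (at z within ?S)"
    and cont: "continuous_on ?S D2"
    using C1 unfolding C1_on_def by blast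
  have d1: "((\<lambda>w. E t x w) has_vector_derivative D (t, x, u) (0, 0, 1)) (at u)" if "t \<in> I" for t x u
    using has_derivative_slice_triple(3)[OF D] that by simp
  have e1: "du E t x u = D (t, x, u) (0, 0, 1)" if "t \<in> I" for t x u
    using vector_derivative_at[OF d1[OF that]] by (simp add: du_def)
  have d2: "((\<lambda>w. D (t, x, w) (0, 0, 1)) has_vector_derivative D2 (t, x, u) (0, 0, 1) (0, 0, 1)) (at u)" if "t \<in> I" for t x u
  proof -
    have "((\<lambda>z. blinfun_apply (D z) (0, 0, 1)) has_derivative (\<lambda>h. D2 (t, x, u) h (0, 0, 1))) (at (t, x, u) within ?S)"
      using bounded_linear.has_derivative[OF blinfun.bounded_linear_left[of "(0, 0, 1)"] D2] that
      by simp
    from has_derivative_slice_triple(3)[OF this that] show ?thesis .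
  qed
  then have d2': "((\<lambda>w. du E t x w) has_vector_derivative D2 (t, x, u) (0, 0, 1) (0, 0, 1)) (at u)" if "t \<in> I" for t x u
    using that by (simp add: e1)
  have e2: "du (du E) t x u = D2 (t, x, u) (0, 0, 1) (0, 0, 1)" if "t \<in> I" for t x u
    unfolding du_def[of "du E"] by (rule vector_derivative_at[OF d2'[OF that]])
  show "t \<in> I \<Longrightarrow> ((\<lambda>w. du E t x w) has_real_derivative du (du E) t x u) (at u)"
    using d2' e2 by (simp add: has_real_derivative_iff_has_vector_derivative)
  show "continuous_on ?S (\<lambda>(t, x, u). du (du E) t x u)"
    using continuous_on_blinfun_apply_const[OF continuous_on_blinfun_apply_const[OF cont]]
    by (rule continuous_on_eq) (auto simp: e2)
qed

lemma derivative_0_if_vanishes_nearby: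
  assumes "eventually (\<lambda>y. h y = 0) (at x within S)" "h x = 0" "x \<in> S" "(h has_derivative D) (at x within S)"
  shows "((\<lambda>_. 0) has_derivative D) (at x within S)"
  using assms has_derivative_transform_eventually[of h D x S "\<lambda>_. 0"] by auto

text \<open>
  The complement of the support is open, so a function that vanishes off the support has zero
  derivatives there as well. This makes all integrands compactly supported.
\<close>

lemma partials_vanish_off_support:
  fixes h :: "real \<Rightarrow> real^'n \<Rightarrow> 'b::real_normed_vector"
  assumes I: "time_interval I" and K: "closed K" and tx: "t \<in> I" "(t, x) \<notin> K"
    and 0: "\<And>s y. s \<in> I \<Longrightarrow> (s, y) \<notin> K \<Longrightarrow> h s y = 0"
  shows "((\<lambda>s. h s x) has_vector_derivative d) (at t within I) \<Longrightarrow> d = 0"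
    and "(h t has_derivative D) (at x) \<Longrightarrow> D = (\<lambda>_. 0)"
proof -
  have op: "open (- K)" using K by auto
  have "open ((\<lambda>s. (s, x)) -` (- K))"
    by (rule continuous_open_vimage[OF op]) (auto intro!: continuous_intros)
  then have "eventually (\<lambda>s. s \<in> (\<lambda>s. (s, x)) -` (- K)) (nhds t)"
    using tx by (intro eventually_nhds_in_open) auto
  then have 1: "eventually (\<lambda>s. h s x = 0) (at t within I)"
    unfolding eventually_at_filter by eventually_elim (use 0 in auto)
  have "open ((\<lambda>y. (t, y)) -` (- K))"
    by (rule continuous_open_vimage[OF op]) (auto intro!: continuous_intros)
  then have "eventually (\<lambda>y. y \<in> (\<lambda>y. (t, y)) -` (- K)) (nhds x)"
    using tx by (intro eventually_nhds_in_open) auto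
  then have 2: "eventually (\<lambda>y. h t y = 0) (at x)"
    unfolding eventually_at_filter by eventually_elim (use 0 tx in auto)
  show "d = 0" if "((\<lambda>s. h s x) has_vector_derivative d) (at t within I)"
  proof -
    have "((\<lambda>s. 0) has_vector_derivative d) (at t within I)"
      using derivative_0_if_vanishes_nearby[OF 1] 0 tx that by (simp add: has_vector_derivative_def)
    then show ?thesis
      by (rule vector_derivative_unique_within[OF time_interval_basic(6)[OF I tx(1)] _ has_vector_derivative_const])
  qed
  show "D = (\<lambda>_. 0)" if "(h t has_derivative D) (at x)"
    by (rule has_derivative_unique[OF derivative_0_if_vanishes_nearby[OF 2 _ UNIV_I that] has_derivative_const])
       (rule 0[OF tx])
qed

lemma has_dir_derivative_time:
  assumes "((\<lambda>s. h s (snd z)) has_vector_derivative d) (at (fst z) within I)" "fst z \<in> interior I"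
  shows "has_dir_derivative (\<lambda>z. h (fst z) (snd z)) d (1, 0) z"
proof -
  have "((\<lambda>s. h s (snd z)) has_real_derivative d) (at (0 + fst z))"
    using assms(1) unfolding at_within_interior[OF assms(2)]
    by (simp only: add_0 has_real_derivative_iff_has_vector_derivative)
  then have "((\<lambda>s. h (s + fst z) (snd z)) has_real_derivative d) (at 0)"
    unfolding DERIV_shift by simp
  then show ?thesis by (simp add: has_dir_derivative_def add.commute)
qed

lemma has_dir_derivative_if_has_derivative:
  assumes "(h has_derivative D) (at x)"
  shows "has_dir_derivative h (D v) v x"
proof -
  have "((\<lambda>s. h (x + s *\<^sub>R v)) has_derivative (\<lambda>s. D (s *\<^sub>R v))) (at 0)"
    by (rule has_derivative_compose[where f="\<lambda>s. x + s *\<^sub>R v"])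
       (use assms in \<open>auto intro!: derivative_eq_intros\<close>)
  moreover have "D (s *\<^sub>R v) = D v * s" for s
    using linear_scale[OF bounded_linear.linear[OF has_derivative_bounded_linear[OF assms]], of s v]
    by (simp only: real_scaleR_def mult.commute)
  ultimately show ?thesis
    by (simp add: has_dir_derivative_def has_field_derivative_def mult.commute[of _ "D v"])
qed

lemma has_dir_derivative_space:
  assumes "has_dir_derivative (h (fst z)) d v (snd z)"
  shows "has_dir_derivative (\<lambda>z. h (fst z) (snd z)) d (0, v) z"
  using assms by (simp add: has_dir_derivative_def)

lemma has_real_derivative_difference_quotients:
  fixes h :: "real \<Rightarrow> real"
  assumes "(h has_real_derivative d) (at t within S)" "eventually (\<lambda>n. t + 1 / Suc n \<in> S) sequentially"
  shows "(\<lambda>n. (h (t + 1 / Suc n) - h t) * Suc n) \<longlonglongrightarrow> d"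
proof -
  have "(\<lambda>n. t + 1 / real (Suc n)) \<longlonglongrightarrow> t"
    using tendsto_add[OF tendsto_const[of t] LIMSEQ_inverse_real_of_nat] by (simp add: inverse_eq_divide)
  then have "filterlim (\<lambda>n. t + 1 / real (Suc n)) (at t within S) sequentially"
    unfolding filterlim_at using assms(2) by (auto elim: eventually_mono)
  from filterlim_compose[OF assms(1)[unfolded has_field_derivative_iff] this]
  show ?thesis by (simp add: field_simps)
qed

text \<open>
  Joint Borel measurability of derivatives of $\partial^2_{uu}E$ in $(t,x,k)$ is not part of their
  definition, but they are pointwise limits of difference quotients of a continuous function.
  Quotients with positive increments stay in the half-open time interval.
\<close>

lemma borel_measurable_limit_of_difference_quotients:
  fixes h q :: "'a::euclidean_space \<Rightarrow> real"
  assumes [measurable]: "S \<in> sets borel" and h: "continuous_on S h"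
    and lim: "\<And>y. y \<in> S \<Longrightarrow> (\<lambda>n. (h (y + (1 / Suc n) *\<^sub>R c) - h y) * Suc n) \<longlonglongrightarrow> q y"
    and ev: "\<And>y. y \<in> S \<Longrightarrow> eventually (\<lambda>n. y + (1 / Suc n) *\<^sub>R c \<in> S) sequentially"
  shows "(\<lambda>y. indicator S y * q y) \<in> borel_measurable borel"
proof -
  define H where "H y = indicator S y *\<^sub>R h y" for y
  have [measurable]: "H \<in> borel_measurable borel"
    unfolding H_def using borel_measurable_continuous_on_indicator[OF assms(1) h] by simp
  show ?thesis
  proof (rule borel_measurable_LIMSEQ_real)
    show "(\<lambda>y. indicator S y * ((H (y + (1 / Suc n) *\<^sub>R c) - H y) * real (Suc n))) \<in> borel_measurable borel" for n
      by measurable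
    fix y :: 'a
    show "(\<lambda>n. indicator S y * ((H (y + (1 / Suc n) *\<^sub>R c) - H y) * real (Suc n))) \<longlonglongrightarrow> indicator S y * q y"
    proof (cases "y \<in> S")
      case True
      have "eventually (\<lambda>n. (h (y + (1 / Suc n) *\<^sub>R c) - h y) * real (Suc n)
          = indicator S y * ((H (y + (1 / Suc n) *\<^sub>R c) - H y) * real (Suc n))) sequentially"
        using ev[OF True] by eventually_elim (use True in \<open>simp add: H_def\<close>)
      from Lim_transform_eventually[OF lim[OF True] this] True show ?thesis by simp
    qed simp
  qed
qed

section \<open>Increments in the state variable\<close>

lemma continuous_on_triple:
  assumes h: "jointly_continuous I h"
    and "continuous_on S \<alpha>" "continuous_on S \<beta>" "continuous_on S \<gamma>" "\<And>y. y \<in> S \<Longrightarrow> \<alpha> y \<in> I"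
  shows "continuous_on S (\<lambda>y. h (\<alpha> y) (\<beta> y) (\<gamma> y))"
proof -
  have "continuous_on S (\<lambda>y. (\<lambda>(t, x, u). h t x u) (\<alpha> y, \<beta> y, \<gamma> y))"
    by (rule continuous_on_compose2[OF h]) (use assms in \<open>auto intro!: continuous_intros\<close>)
  then show ?thesis by simp
qed

text \<open>
  The functional \<open>L\<close> selects a component of a vector-valued function.
\<close>

lemma du_increment:
  fixes \<zeta> :: "real \<Rightarrow> real^'n \<Rightarrow> real \<Rightarrow> 'b::real_normed_vector" and L :: "'b \<Rightarrow> real"
  assumes I: "time_interval I" and \<zeta>: "\<zeta> \<in> space_F I" and L: "bounded_linear L"
    and t: "t \<in> I" and "c \<le> w"
  shows "L (\<zeta> t x w) - L (\<zeta> t x c) = (LBINT k:{c..w}. L (du \<zeta> t x k))"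
proof (rule set_integral_FTC[symmetric, OF \<open>c \<le> w\<close>])
  note P = space_F_partials[OF I \<zeta>]
  show "((\<lambda>k. L (\<zeta> t x k)) has_real_derivative L (du \<zeta> t x k)) (at k within {c..w})" for k
    using bounded_linear.has_vector_derivative[OF L P(3)[OF t, of x k]]
    by (simp add: has_real_derivative_iff_has_vector_derivative has_vector_derivative_at_within)
  show "continuous_on {c..w} (\<lambda>k. L (du \<zeta> t x k))"
    by (intro bounded_linear.continuous_on[OF L] continuous_on_triple[OF P(9)] continuous_intros t)
qed

text \<open>
  The mixed derivatives of a function in $\mathscr F$ are jointly continuous, so the classical
  Leibniz rule applies to the integral of $\partial_u\zeta$ over the state.
\<close>

lemma dt_increment:
  fixes \<zeta> :: "real \<Rightarrow> real^'n \<Rightarrow> real \<Rightarrow> real"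
  assumes I: "time_interval I" and \<zeta>: "\<zeta> \<in> space_F I"
    and t: "t \<in> interior I" and "c \<le> w"
  shows "dt I \<zeta> t x w - dt I \<zeta> t x c = (LBINT k:{c..w}. dt I (du \<zeta>) t x k)"
proof -
  note P = space_F_partials[OF I \<zeta>]
  have sub: "s \<in> I" if "s \<in> interior I" for s using that interior_subset by auto
  show ?thesis
  proof (rule dir_derivative_parametric_integral[where z=t and v="1::real" and \<Omega>="interior I"
      and P="\<lambda>s. \<zeta> s x w - \<zeta> s x c" and \<eta>="\<lambda>s k. du \<zeta> s x k" and \<eta>'="\<lambda>s k. dt I (du \<zeta>) s x k"])
    show "\<zeta> s x w - \<zeta> s x c = (LBINT k:{c..w}. du \<zeta> s x k)" if "s \<in> interior I" for s
      using du_increment[OF I \<zeta> bounded_linear_ident sub[OF that] \<open>c \<le> w\<close>] .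
    have dd: "has_dir_derivative h d 1 s" if "(h has_vector_derivative d) (at s within I)" "s \<in> interior I" for h :: "real \<Rightarrow> real" and d s
    proof -
      have "(h has_derivative (\<lambda>r. r *\<^sub>R d)) (at s)"
        using that(1) unfolding has_vector_derivative_def at_within_interior[OF that(2)] .
      from has_dir_derivative_if_has_derivative[OF this, of 1] show ?thesis by simp
    qed
    show "has_dir_derivative (\<lambda>s. du \<zeta> s x k) (dt I (du \<zeta>) s x k) 1 s" if "s \<in> interior I" for s k
      using P(4)[OF sub[OF that]] that by (rule dd)
    show "has_dir_derivative (\<lambda>s. \<zeta> s x w - \<zeta> s x c) (dt I \<zeta> t x w - dt I \<zeta> t x c) 1 t"
      by (rule dd[OF has_vector_derivative_diff[OF P(1)[OF sub[OF t]] P(1)[OF sub[OF t]]] t])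
    show "continuous_on {c..w} (\<lambda>k. du \<zeta> s x k)" if "s \<in> interior I" for s
      by (intro continuous_on_triple[OF P(9)] continuous_intros sub that)
    show "continuous_on (interior I \<times> {c..w}) (\<lambda>(s, k). dt I (du \<zeta>) s x k)"
      unfolding case_prod_unfold
      by (rule continuous_on_triple[OF P(10)]) (auto intro!: continuous_intros sub)
  qed (use t in auto)
qed

lemma pdx_has_dir_derivative:
  assumes "((\<lambda>y. \<zeta> t y u) has_derivative frechet_derivative (\<lambda>y. \<zeta> t y u) (at x)) (at x)" "bounded_linear L"
  shows "has_dir_derivative (\<lambda>y. L (\<zeta> t y u)) (L (pdx i \<zeta> t x u)) (axis i 1) x"
  unfolding pdx_def
  by (rule has_dir_derivative_if_has_derivative[OF bounded_linear.has_derivative[OF assms(2,1)]])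

lemma pdx_increment:
  fixes \<zeta> :: "real \<Rightarrow> real^'n \<Rightarrow> real \<Rightarrow> 'b::real_normed_vector" and L :: "'b \<Rightarrow> real"
  assumes I: "time_interval I" and \<zeta>: "\<zeta> \<in> space_F I" and L: "bounded_linear L"
    and t: "t \<in> I" and "c \<le> w"
  shows "L (pdx i \<zeta> t x w) - L (pdx i \<zeta> t x c) = (LBINT k:{c..w}. L (pdx i (du \<zeta>) t x k))"
proof -
  note P = space_F_partials[OF I \<zeta>]
  show ?thesis
  proof (rule dir_derivative_parametric_integral[where z=x and v="axis i 1" and \<Omega>=UNIV
      and P="\<lambda>y. L (\<zeta> t y w) - L (\<zeta> t y c)" and \<eta>="\<lambda>y k. L (du \<zeta> t y k)" and \<eta>'="\<lambda>y k. L (pdx i (du \<zeta>) t y k)"])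
    show "L (\<zeta> t y w) - L (\<zeta> t y c) = (LBINT k:{c..w}. L (du \<zeta> t y k))" for y
      by (rule du_increment[OF I \<zeta> L t \<open>c \<le> w\<close>])
    show "has_dir_derivative (\<lambda>y. L (du \<zeta> t y k)) (L (pdx i (du \<zeta>) t y k)) (axis i 1) y" for y k
      by (rule pdx_has_dir_derivative[where \<zeta>="du \<zeta>" and t=t and u=k, OF P(5)[OF t] L])
    show "has_dir_derivative (\<lambda>y. L (\<zeta> t y w) - L (\<zeta> t y c)) (L (pdx i \<zeta> t x w) - L (pdx i \<zeta> t x c)) (axis i 1) x"
      using pdx_has_dir_derivative[where \<zeta>=\<zeta> and t=t, OF P(2)[OF t] L]
      unfolding has_dir_derivative_def by (intro DERIV_diff) auto
    show "continuous_on {c..w} (\<lambda>k. L (du \<zeta> t y k))" for y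
      by (intro bounded_linear.continuous_on[OF L] continuous_on_triple[OF P(9)] continuous_intros t)
    show "continuous_on (UNIV \<times> {c..w}) (\<lambda>(y, k). L (pdx i (du \<zeta>) t y k))"
      unfolding case_prod_unfold
      by (intro bounded_linear.continuous_on[OF L] continuous_on_triple[OF P(11)] continuous_intros t)
  qed auto
qed

lemma has_real_derivative_if_increments:
  fixes d \<delta> :: "real \<Rightarrow> real"
  assumes inc: "\<And>w. w \<in> {a..b} \<Longrightarrow> d w - d a = (LBINT k:{a..w}. \<delta> k)" and cont: "continuous_on {a..b} \<delta>"
    and k: "k \<in> {a..b}"
  shows "(d has_real_derivative \<delta> k) (at k within {a..b})"
proof -
  have "((\<lambda>w. integral {a..w} \<delta>) has_real_derivative \<delta> k) (at k within {a..b})"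
    by (rule integral_has_real_derivative[OF cont k])
  then have "((\<lambda>w. d a + integral {a..w} \<delta>) has_real_derivative \<delta> k) (at k within {a..b})"
    by (auto intro!: derivative_eq_intros)
  then show ?thesis
  proof (rule has_field_derivative_transform_within[OF _ zero_less_one k])
    show "d a + integral {a..w} \<delta> = d w" if "w \<in> {a..b}" for w
  proof -
    have "set_integrable lborel {a..w} \<delta>"
      by (rule borel_integrable_atLeastAtMost'[OF continuous_on_subset[OF cont]]) (use that in auto)
    from set_borel_integral_eq_integral(2)[OF this] show ?thesis using inc[OF that] by simp
    qed
  qed
qed

lemma set_integral_combine_Icc:
  fixes \<alpha> :: "real \<Rightarrow> real"
  assumes w: "w \<in> {a..b}" and \<alpha>: "set_integrable lborel {a..b} \<alpha>"
  shows "(LBINT k:{a..b}. \<alpha> k) = (LBINT k:{a..w}. \<alpha> k) + (LBINT k:{w..b}. \<alpha> k)"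
proof -
  have s: "set_integrable lborel {a..w} \<alpha>" "set_integrable lborel {w..b} \<alpha>"
    using w by (auto intro: set_integrable_subset[OF \<alpha>])
  have "{a..b} = {a..w} \<union> {w..b}" using w by auto
  then show ?thesis
    by (simp only:) (rule set_integral_Un_AE[OF _ _ _ s],
       use AE_lborel_singleton[of w] in \<open>auto elim!: eventually_mono\<close>)
qed

text \<open>
  Here \<open>Z\<close> is an antiderivative of \<open>p\<close>, which in turn has density
  $\alpha$. The identity is used with $Z = E$ at the initial time and with $Z = \partial_t E$.
\<close>

lemma kruzkov_entropy_identity:
  fixes p \<alpha> Z :: "real \<Rightarrow> real"
  assumes w: "w \<in> {a..b}" and \<alpha>: "set_integrable lborel {a..b} \<alpha>"
    and p: "\<And>k. k \<in> {a..b} \<Longrightarrow> p k - p a = (LBINT j:{a..k}. \<alpha> j)"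
    and Z: "\<And>c d. c \<in> {a..b} \<Longrightarrow> d \<in> {c..b} \<Longrightarrow> Z d - Z c = (LBINT k:{c..d}. p k)"
  shows "set_integrable lborel {a..b} (\<lambda>k. \<bar>w - k\<bar> * \<alpha> k)"
    and "(LBINT k:{a..b}. \<bar>w - k\<bar> * \<alpha> k) = 2 * Z w - Z a - Z b + a * p a + b * p b - w * (p a + p b)"
proof -
  have eq: "sgn (w - k) * (w - k) = \<bar>w - k\<bar>" for k by (simp add: abs_sgn mult.commute)
  note K = kruzkov_kernel_integral[OF w \<alpha> p, of "\<lambda>k. k" "\<lambda>_. 1"]
  show "set_integrable lborel {a..b} (\<lambda>k. \<bar>w - k\<bar> * \<alpha> k)"
    using K(1) by (simp add: eq)
  show "(LBINT k:{a..b}. \<bar>w - k\<bar> * \<alpha> k) = 2 * Z w - Z a - Z b + a * p a + b * p b - w * (p a + p b)"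
    using K(2) Z[of a w] Z[of w b] w by (simp add: eq)
qed

text \<open>
  The contribution of one coordinate direction $i$ to the flux identity, as functions of the state
  alone: $A$ stands for $\partial_uE$, $p$ for $\partial_i\partial_uE$, and $e$, $q$ for their
  densities; $f$ is a component of the flux and $d$ its derivative $\partial_i f_i$; $F$ and $G$
  are $\partial_i F_i$ and $\partial_i G_i$. The kernel identity for the pairs $(f,q)$ and $(d,e)$
  yields integrals of $p f' + A d' = \partial_i(\partial_uE\,\partial_uf_i)$, which is the density
  of $\partial_iF_i$. The last line is the part that does not depend on $w$.
\<close>

lemma kruzkov_flux_identity:
  fixes A e p q f f' d d' F G :: "real \<Rightarrow> real"
  assumes w: "w \<in> {a..b}"
    and e: "set_integrable lborel {a..b} e" and q: "set_integrable lborel {a..b} q"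
    and A: "\<And>k. k \<in> {a..b} \<Longrightarrow> A k - A a = (LBINT j:{a..k}. e j)"
    and p: "\<And>k. k \<in> {a..b} \<Longrightarrow> p k - p a = (LBINT j:{a..k}. q j)"
    and f: "\<And>k. k \<in> {a..b} \<Longrightarrow> (f has_real_derivative f' k) (at k within {a..b})" "continuous_on {a..b} f'"
    and d: "\<And>k. k \<in> {a..b} \<Longrightarrow> (d has_real_derivative d' k) (at k within {a..b})" "continuous_on {a..b} d'"
    and F: "\<And>c d. c \<in> {a..b} \<Longrightarrow> d \<in> {c..b} \<Longrightarrow> F d - F c = (LBINT k:{c..d}. p k * f' k + A k * d' k)"
    and pA: "continuous_on {a..b} p" "continuous_on {a..b} A"
    and G: "G w - G a = (p a + p b) / 2 * (f w - f a) + (A a + A b) / 2 * (d w - d a)"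
  shows "set_integrable lborel {a..b} (\<lambda>k. sgn (w - k) * (f w - f k) * q k)"
    and "set_integrable lborel {a..b} (\<lambda>k. sgn (w - k) * d k * e k)"
    and "(LBINT k:{a..b}. sgn (w - k) * (f w - f k) * q k) - (LBINT k:{a..b}. sgn (w - k) * d k * e k)
       = 2 * (F w - A w * d w) - 2 * (G w - (A a + A b) / 2 * d w)
         + 2 * (G a - (F a + F b) / 2 + (p b * (f b - f a) + A b * (d b - d a)) / 2)"
proof -
  let ?q = "\<lambda>k. sgn (w - k) * (f w - f k) * q k"
  let ?d = "\<lambda>k. sgn (w - k) * d k * e k"
  let ?k = "\<lambda>k. sgn (w - k) * (d w - d k) * e k"
  note Kq = kruzkov_kernel_integral[OF w q p f]
  note Ke = kruzkov_kernel_integral[OF w e A d]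
  have q2: "(LBINT k:{a..b}. ?q k)
      = (LBINT k:{a..w}. p k * f' k) - (LBINT k:{w..b}. p k * f' k) + f a * p a + f b * p b - f w * (p a + p b)"
    by (rule Kq(2))
  have e2: "(LBINT k:{a..b}. ?k k)
      = (LBINT k:{a..w}. A k * d' k) - (LBINT k:{w..b}. A k * d' k) + d a * A a + d b * A b - d w * (A a + A b)"
    by (rule Ke(2))
  show "set_integrable lborel {a..b} (\<lambda>k. ?q k)"
    by (rule Kq(1))
  have se: "set_integrable lborel {a..b} (\<lambda>k. sgn (w - k) * e k)"
  proof -
    have "integrable lborel (\<lambda>k. sgn (w - k) * (indicator {a..b} k *\<^sub>R e k))"
      by (rule integrable_bounded_mult[where B=1])
         (use e in \<open>auto simp: set_integrable_def sgn_if\<close>)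
    then show ?thesis by (simp add: set_integrable_def mult_ac)
  qed
  have "set_integrable lborel {a..b} (\<lambda>k. d w * (sgn (w - k) * e k) - ?k k)"
    by (intro set_integral_diff set_integrable_mult_right se Ke(1))
  then show se': "set_integrable lborel {a..b} (\<lambda>k. ?d k)"
    by (simp add: algebra_simps)
  have ds: "(LBINT k:{a..b}. ?d k)
      = d w * (LBINT k:{a..b}. sgn (w - k) * e k) - (LBINT k:{a..b}. ?k k)"
  proof -
    have "(LBINT k:{a..b}. ?d k) = (LBINT k:{a..b}. d w * (sgn (w - k) * e k) - ?k k)"
      by (simp add: algebra_simps)
    also have "\<dots> = d w * (LBINT k:{a..b}. sgn (w - k) * e k) - (LBINT k:{a..b}. ?k k)"
      by (subst set_integral_diff) (use se Ke(1) in \<open>auto intro!: set_integrable_mult_right\<close>)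
    finally show ?thesis .
  qed
  have sgn_e: "(LBINT k:{a..b}. sgn (w - k) * e k) = 2 * A w - A a - A b"
    using set_integral_sgn_split[OF w e] set_integral_combine_Icc[OF w e] A[of w] A[of b] w by auto
  have ci: "set_integrable lborel {c..k} h" if "continuous_on {a..b} h" "c \<in> {a..b}" "k \<in> {a..b}" for h :: "real \<Rightarrow> real" and c k
    by (rule borel_integrable_atLeastAtMost'[OF continuous_on_subset[OF that(1)]]) (use that in auto)
  have split: "F k - F c = (LBINT k:{c..k}. p k * f' k) + (LBINT k:{c..k}. A k * d' k)" if "c \<in> {a..b}" "k \<in> {c..b}" for c k
    unfolding F[OF that]
    by (rule set_integral_add(2)) (use that in \<open>auto intro!: ci continuous_intros pA f(2) d(2)\<close>)
  have "a \<in> {a..b}" "w \<in> {a..b}" "b \<in> {w..b}" "w \<in> {a..b}" using w by auto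
  note F1 = split[OF this(1,2)] and F2 = split[OF this(2,3)]
  show "(LBINT k:{a..b}. ?q k) - (LBINT k:{a..b}. ?d k)
       = 2 * (F w - A w * d w) - 2 * (G w - (A a + A b) / 2 * d w)
         + 2 * (G a - (F a + F b) / 2 + (p b * (f b - f a) + A b * (d b - d a)) / 2)"
    unfolding ds q2 e2 sgn_e using F1 F2 G by (simp add: field_simps)
qed

section \<open>Integrability on compact supports\<close>

lemma borel_measurable_triple:
  fixes h :: "real \<Rightarrow> 'b::euclidean_space \<Rightarrow> real \<Rightarrow> real"
  assumes I: "I \<in> sets borel" and h: "jointly_continuous I h"
    and [measurable]: "\<alpha> \<in> borel_measurable M" "\<beta> \<in> borel_measurable M" "\<gamma> \<in> borel_measurable M"
  shows "(\<lambda>y. indicator I (\<alpha> y) * h (\<alpha> y) (\<beta> y) (\<gamma> y)) \<in> borel_measurable M"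
proof -
  have S: "I \<times> (UNIV :: ('b \<times> real) set) \<in> sets borel"
    by (intro borel_Times I) simp
  then have S': "I \<times> (UNIV :: 'b set) \<times> (UNIV :: real set) \<in> sets borel" by simp
  have "(\<lambda>y. (\<alpha> y, \<beta> y, \<gamma> y)) \<in> M \<rightarrow>\<^sub>M borel"
    unfolding borel_prod[symmetric] by measurable
  from measurable_compose[OF this borel_measurable_continuous_on_indicator[OF S' h]]
  show ?thesis by (simp add: indicator_def cong: if_cong)
qed

lemma integrable_compact_support:
  fixes h :: "'a::euclidean_space \<Rightarrow> real"
  assumes h: "h \<in> borel_measurable borel" and K: "compact K" "\<And>y. h y \<noteq> 0 \<Longrightarrow> y \<in> K"
    and B: "\<And>y. y \<in> K \<Longrightarrow> \<bar>h y\<bar> \<le> B"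
  shows "integrable lborel h"
proof -
  have "integrable lborel (\<lambda>y. h y * indicator K y)"
  proof (rule integrable_bounded_mult)
    show "integrable lborel (indicator K :: 'a \<Rightarrow> real)"
      using K(1) emeasure_bounded_finite[OF compact_imp_bounded[OF K(1)]] borel_compact[OF K(1)]
      by (intro integrable_real_indicator) auto
    show "\<bar>h y\<bar> \<le> B" if "indicator K y \<noteq> (0::real)" for y
      using B that by (auto simp: indicator_def split: if_splits)
  qed (use h in auto)
  moreover have "(\<lambda>y. h y * indicator K y) = h"
    using K(2) by (auto simp: indicator_def fun_eq_iff)
  ultimately show ?thesis by simp
qed

lemma compact_bound_triple:
  fixes h :: "real \<Rightarrow> 'b::euclidean_space \<Rightarrow> real \<Rightarrow> real"
  assumes h: "jointly_continuous I h"
    and K: "compact K" "K \<subseteq> I \<times> UNIV"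
  shows "\<exists>B. \<forall>z\<in>K. \<forall>w\<in>{a..b}. \<bar>h (fst z) (snd z) w\<bar> \<le> B"
proof -
  have "compact ((\<lambda>y. h (fst (fst y)) (snd (fst y)) (snd y)) ` (K \<times> {a..b}))"
    using K by (intro compact_continuous_image compact_Times compact_Icc continuous_on_triple[OF h] continuous_intros) auto
  from compact_imp_bounded[OF this]
  obtain B where B: "\<And>z. z \<in> (\<lambda>y. h (fst (fst y)) (snd (fst y)) (snd y)) ` (K \<times> {a..b}) \<Longrightarrow> norm z \<le> B"
    unfolding bounded_iff by blast
  show ?thesis
  proof (intro exI[of _ B] ballI)
    fix z w assume "z \<in> K" "w \<in> {a..b}"
    then have "h (fst z) (snd z) w \<in> (\<lambda>y. h (fst (fst y)) (snd (fst y)) (snd y)) ` (K \<times> {a..b})"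
      by (intro image_eqI[of _ _ "(z, w)"]) auto
    from B[OF this] show "\<bar>h (fst z) (snd z) w\<bar> \<le> B" by simp
  qed
qed

lemma lborel_Fubini:
  fixes H :: "'a::euclidean_space \<Rightarrow> 'b::euclidean_space \<Rightarrow> real"
  assumes "integrable lborel (\<lambda>(z, k). H z k)"
  shows "AE k in lborel. integrable lborel (\<lambda>z. H z k)"
    and "integrable lborel (\<lambda>z. LBINT k. H z k)"
    and "(LBINT k. LBINT z. H z k) = (LBINT z. LBINT k. H z k)"
    and "(LBINT z. LBINT k. H z k) = integral\<^sup>L lborel (\<lambda>(z, k). H z k)"
proof -
  have i: "integrable (lborel \<Otimes>\<^sub>M lborel) (\<lambda>(z, k). H z k)"
    using assms by (simp add: lborel_prod)
  show "AE k in lborel. integrable lborel (\<lambda>z. H z k)"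
    using lborel_pair.AE_integrable_fst'[OF lborel_pair.integrable_product_swap[OF i]] by simp
  show "integrable lborel (\<lambda>z. LBINT k. H z k)"
    using lborel_pair.integrable_fst'[OF i] by simp
  show "(LBINT k. LBINT z. H z k) = (LBINT z. LBINT k. H z k)"
    by (rule lborel_pair.Fubini_integral[OF i])
  show "(LBINT z. LBINT k. H z k) = integral\<^sup>L lborel (\<lambda>(z, k). H z k)"
    using lborel_pair.integral_fst'[OF i] by (simp add: lborel_prod)
qed

lemma borel_measurable_fst_snd_borel:
  "(fst :: 'a::euclidean_space \<times> 'b::euclidean_space \<Rightarrow> 'a) \<in> borel_measurable borel"
  "(snd :: 'a::euclidean_space \<times> 'b::euclidean_space \<Rightarrow> 'b) \<in> borel_measurable borel"
  by (auto intro!: borel_measurable_continuous_onI continuous_intros)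

lemma du_tensor_id: "du (tensor \<phi> (\<lambda>w. w)) t x w = \<phi> t x"
proof -
  have "((\<lambda>w. \<phi> t x * w) has_vector_derivative \<phi> t x) (at w)"
    by (auto intro!: derivative_eq_intros simp flip: has_real_derivative_iff_has_vector_derivative)
  then show ?thesis
    by (simp add: du_def tensor_def vector_derivative_at)
qed

section \<open>The representation for a fixed entropy\<close>

text \<open>
  The data of the theorem apart from the solution and its initial value. The compact set
  \<open>K\<close> contains the supports of \<open>E\<close> and of both fluxes, and \<open>G\<close> is
  a flux for the entropy that is linear in the state.
\<close>

locale kruzkov_setting =
  fixes I :: "real set"
    and f :: "real \<Rightarrow> real^'n \<Rightarrow> real \<Rightarrow> real^'n"
    and g :: "real \<Rightarrow> real^'n \<Rightarrow> real \<Rightarrow> real"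
    and a b :: real
    and E :: "real \<Rightarrow> real^'n \<Rightarrow> real \<Rightarrow> real"
    and F G :: "real \<Rightarrow> real^'n \<Rightarrow> real \<Rightarrow> real^'n"
    and K :: "(real \<times> (real^'n)) set"
  assumes I: "time_interval I" and ab: "a \<le> b"
    and f: "f \<in> space_F I"
    and g: "jointly_continuous I g"
    and E: "E \<in> space_F I" and F: "F \<in> space_F I" and G: "G \<in> space_F I"
    and C2: "C2_on (I \<times> UNIV \<times> UNIV) (\<lambda>(t, x, w). E t x w)"
    and C1: "\<And>v. v \<in> {a..b} \<Longrightarrow> C1_on (I \<times> UNIV) (\<lambda>(t, x). du (du E) t x v)"
    and int_dt: "(\<lambda>(t, x, v). dt I (du (du E)) t x v) absolutely_integrable_on (I \<times> UNIV \<times> {a..b})"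
    and int_gradx: "(\<lambda>(t, x, v). gradx (du (du E)) t x v) absolutely_integrable_on (I \<times> UNIV \<times> {a..b})"
    and du_F: "\<And>t x w. t \<in> I \<Longrightarrow> du F t x w = du E t x w *\<^sub>R du f t x w"
    and du_G: "\<And>t x w. t \<in> I \<Longrightarrow> du G t x w = ((du E t x a + du E t x b) / 2) *\<^sub>R du f t x w"
    and K: "compact K" "K \<subseteq> I \<times> UNIV"
    and off: "\<And>t x w. t \<in> I \<Longrightarrow> (t, x) \<notin> K \<Longrightarrow> E t x w = 0"
      "\<And>t x w. t \<in> I \<Longrightarrow> (t, x) \<notin> K \<Longrightarrow> F t x w = 0"
      "\<And>t x w. t \<in> I \<Longrightarrow> (t, x) \<notin> K \<Longrightarrow> G t x w = 0"
begin

abbreviation "e \<equiv> du (du E)"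

lemmas Pf = space_F_partials[OF I f]
lemmas PE = space_F_partials[OF I E]
lemmas PF = space_F_partials[OF I F]
lemmas PG = space_F_partials[OF I G]

lemma e_deriv: "t \<in> I \<Longrightarrow> ((\<lambda>w. du E t x w) has_real_derivative e t x u) (at u)"
  by (rule C2_on_du(1)[OF C2])

lemma e_cont: "jointly_continuous I e"
  by (rule C2_on_du(2)[OF C2])

lemma interior_I: "t \<in> interior I \<Longrightarrow> t \<in> I"
  using interior_subset by auto

lemma I_borel: "I \<in> sets borel" using time_interval_basic[OF I] by auto

lemma e_dt: "t \<in> I \<Longrightarrow> v \<in> {a..b} \<Longrightarrow> ((\<lambda>s. e s x v) has_vector_derivative dt I e t x v) (at t within I)"
  unfolding dt_def by (rule C1_on_time_space(1)[OF I C1])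

lemma e_dx: "t \<in> I \<Longrightarrow> v \<in> {a..b} \<Longrightarrow> ((\<lambda>y. e t y v) has_derivative frechet_derivative (\<lambda>y. e t y v) (at x)) (at x)"
  by (rule C1_on_time_space(2)[OF I C1])

lemma e_dt_cont: "v \<in> {a..b} \<Longrightarrow> continuous_on (I \<times> UNIV) (\<lambda>(t, x). dt I e t x v)"
  unfolding dt_def by (rule C1_on_time_space(3)[OF I C1])

lemma e_dx_cont: "v \<in> {a..b} \<Longrightarrow> continuous_on (I \<times> UNIV) (\<lambda>(t, x). pdx i e t x v)"
  unfolding pdx_def by (rule C1_on_time_space(4)[OF I C1])

lemma off_du:
  assumes "t \<in> I" "(t, x) \<notin> K"
  shows "du E t x w = 0" "e t x w = 0"
proof -
  have *: "du E t x w = 0" for w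
    using PE(3)[OF assms(1), of x w] off(1)[OF assms]
    by (intro vector_derivative_unique_at[OF _ has_vector_derivative_const[of 0]]) auto
  then show "du E t x w = 0" .
  show "e t x w = 0"
    using e_deriv[OF assms(1), of x w] * by (intro DERIV_unique[OF _ DERIV_const[of 0]]) auto
qed

lemma off_partials:
  assumes tx: "t \<in> I" "(t, x) \<notin> K"
  shows "dt I E t x w = 0" "dt I (du E) t x w = 0" "pdx i (du E) t x w = 0"
    and "pdx i F t x w = 0" "pdx i G t x w = 0"
    and "w \<in> {a..b} \<Longrightarrow> dt I e t x w = 0" "w \<in> {a..b} \<Longrightarrow> pdx i e t x w = 0"
proof -
  have Kc: "closed K" using K(1) by (rule compact_imp_closed)
  note T = partials_vanish_off_support(1)[OF I Kc tx] and X = partials_vanish_off_support(2)[OF I Kc tx]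
  show "dt I E t x w = 0"
    by (rule T[where h="\<lambda>s y. E s y w"]) (use off PE(1)[OF tx(1)] in auto)
  show "dt I (du E) t x w = 0"
    by (rule T[where h="\<lambda>s y. du E s y w"]) (use off_du PE(4)[OF tx(1)] in auto)
  show "w \<in> {a..b} \<Longrightarrow> dt I e t x w = 0"
    by (rule T[where h="\<lambda>s y. e s y w"]) (use off_du e_dt[OF tx(1)] in auto)
  have "frechet_derivative (\<lambda>y. du E t y w) (at x) = (\<lambda>_. 0)"
    by (rule X[where h="\<lambda>s y. du E s y w"]) (use off_du PE(5)[OF tx(1)] in auto)
  then show "pdx i (du E) t x w = 0" by (simp add: pdx_def)
  have "frechet_derivative (\<lambda>y. F t y w) (at x) = (\<lambda>_. 0)"
    by (rule X[where h="\<lambda>s y. F s y w"]) (use off PF(2)[OF tx(1)] in auto)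
  then show "pdx i F t x w = 0" by (simp add: pdx_def)
  have "frechet_derivative (\<lambda>y. G t y w) (at x) = (\<lambda>_. 0)"
    by (rule X[where h="\<lambda>s y. G s y w"]) (use off PG(2)[OF tx(1)] in auto)
  then show "pdx i G t x w = 0" by (simp add: pdx_def)
  show "pdx i e t x w = 0" if "w \<in> {a..b}"
  proof -
    have "frechet_derivative (\<lambda>y. e t y w) (at x) = (\<lambda>_. 0)"
      by (rule X[where h="\<lambda>s y. e s y w"]) (use off_du e_dx[OF tx(1) that] in auto)
    then show ?thesis by (simp add: pdx_def)
  qed
qed

text \<open>
  Absolute integrability refers to the completed measure on triples; a Borel function is then
  integrable for the Borel measure on pairs \<open>(z, k)\<close>.
\<close>

lemma integrable_lborel_slab:
  fixes q :: "real \<Rightarrow> real^'n \<Rightarrow> real \<Rightarrow> real"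
  assumes int: "(\<lambda>(t, x, v). q t x v) absolutely_integrable_on (I \<times> UNIV \<times> {a..b})"
    and m: "(\<lambda>y. indicator (I \<times> UNIV \<times> {a..b}) y * (case y of (t, x, v) \<Rightarrow> q t x v)) \<in> borel_measurable borel"
  shows "integrable lborel (\<lambda>(z, k). indicator I (fst z) * indicator {a..b} k * q (fst z) (snd z) k)"
proof -
  define Q where "Q y = indicator (I \<times> UNIV \<times> {a..b}) y * (case y of (t, x, v) \<Rightarrow> q t x v)" for y
  have "integrable lebesgue Q"
    using int by (simp add: set_integrable_def Q_def[abs_def])
  then have "integrable lborel Q"
    using integrable_completion[of Q lborel] m by (simp add: Q_def[abs_def])
  then have "integrable lborel (\<lambda>((t, x), k). Q (t, x, k))"
    by (simp only: integrable_prod_assoc_iff)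
  also have "(\<lambda>((t, x), k). Q (t, x, k)) = (\<lambda>(z, k). indicator I (fst z) * indicator {a..b} k * q (fst z) (snd z) k)"
    by (auto simp: Q_def fun_eq_iff indicator_def)
  finally show ?thesis .
qed

lemma slab_borel: "I \<times> (UNIV :: (real^'n) set) \<times> {a..b} \<in> sets borel"
proof -
  have "(UNIV :: (real^'n) set) \<times> {a..b} \<in> sets borel"
    unfolding borel_prod[symmetric] by (intro pair_measureI) auto
  then show ?thesis
    unfolding borel_prod[symmetric, where 'a=real] by (intro pair_measureI I_borel) auto
qed

lemma integrable_dt_e:
  "integrable lborel (\<lambda>(z, k). indicator I (fst z) * indicator {a..b} k * dt I e (fst z) (snd z) k)"
proof (rule integrable_lborel_slab[OF int_dt])
  show "(\<lambda>y. indicator (I \<times> UNIV \<times> {a..b}) y * (case y of (t, x, v) \<Rightarrow> dt I e t x v)) \<in> borel_measurable borel"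
  proof (rule borel_measurable_limit_of_difference_quotients[where h="\<lambda>(t, x, v). e t x v" and c="(1, 0, 0)"])
    show "I \<times> (UNIV :: (real^'n) set) \<times> {a..b} \<in> sets borel" by (rule slab_borel)
    show "continuous_on (I \<times> UNIV \<times> {a..b}) (\<lambda>(t, x, v). e t x v)"
      by (rule continuous_on_subset[OF e_cont]) auto
    fix y :: "real \<times> (real^'n) \<times> real" assume y: "y \<in> I \<times> UNIV \<times> {a..b}"
    obtain t x v where [simp]: "y = (t, x, v)" by (cases y)
    have tv: "t \<in> I" "v \<in> {a..b}" using y by auto
    note ev = time_interval_basic(7)[OF I tv(1)]
    show "eventually (\<lambda>n. y + (1 / Suc n) *\<^sub>R (1, 0, 0) \<in> I \<times> UNIV \<times> {a..b}) sequentially"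
      using ev by eventually_elim (use tv in auto)
    have "((\<lambda>s. e s x v) has_real_derivative dt I e t x v) (at t within I)"
      using e_dt[OF tv] by (simp only: has_real_derivative_iff_has_vector_derivative)
    from has_real_derivative_difference_quotients[OF this ev]
    show "(\<lambda>n. ((case y + (1 / Suc n) *\<^sub>R (1, 0, 0) of (t, x, v) \<Rightarrow> e t x v) - (case y of (t, x, v) \<Rightarrow> e t x v)) * Suc n)
        \<longlonglongrightarrow> (case y of (t, x, v) \<Rightarrow> dt I e t x v)"
      by simp
  qed
qed

lemma integrable_pdx_e:
  "integrable lborel (\<lambda>(z, k). indicator I (fst z) * indicator {a..b} k * pdx i e (fst z) (snd z) k)"
proof (rule integrable_lborel_slab)
  have "((\<lambda>y. y $ i) \<circ> (\<lambda>(t, x, v). gradx e t x v)) absolutely_integrable_on (I \<times> UNIV \<times> {a..b})"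
    by (rule absolutely_integrable_linear[OF int_gradx bounded_linear_vec_nth])
  then show "(\<lambda>(t, x, v). pdx i e t x v) absolutely_integrable_on (I \<times> UNIV \<times> {a..b})"
    by (simp add: o_def case_prod_unfold gradx_nth)
  show "(\<lambda>y. indicator (I \<times> UNIV \<times> {a..b}) y * (case y of (t, x, v) \<Rightarrow> pdx i e t x v)) \<in> borel_measurable borel"
  proof (rule borel_measurable_limit_of_difference_quotients[where h="\<lambda>(t, x, v). e t x v" and c="(0, axis i 1, 0)"])
    show "I \<times> (UNIV :: (real^'n) set) \<times> {a..b} \<in> sets borel" by (rule slab_borel)
    show "continuous_on (I \<times> UNIV \<times> {a..b}) (\<lambda>(t, x, v). e t x v)"
      by (rule continuous_on_subset[OF e_cont]) auto
    fix y :: "real \<times> (real^'n) \<times> real" assume y: "y \<in> I \<times> UNIV \<times> {a..b}"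
    obtain t x v where [simp]: "y = (t, x, v)" by (cases y)
    have tv: "t \<in> I" "v \<in> {a..b}" using y by auto
    show "eventually (\<lambda>n. y + (1 / Suc n) *\<^sub>R (0, axis i 1, 0) \<in> I \<times> UNIV \<times> {a..b}) sequentially"
      using tv by simp
    have "has_dir_derivative (\<lambda>y. e t y v) (pdx i e t x v) (axis i 1) x"
      by (rule pdx_has_dir_derivative[where L="\<lambda>r. r" and \<zeta>=e, OF e_dx[OF tv] bounded_linear_ident])
    from has_real_derivative_difference_quotients[OF this[unfolded has_dir_derivative_def]]
    show "(\<lambda>n. ((case y + (1 / Suc n) *\<^sub>R (0, axis i 1, 0) of (t, x, v) \<Rightarrow> e t x v) - (case y of (t, x, v) \<Rightarrow> e t x v)) * Suc n)
        \<longlonglongrightarrow> (case y of (t, x, v) \<Rightarrow> pdx i e t x v)"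
      by simp
  qed
qed

lemma du_E_increment:
  assumes "t \<in> I" "c \<le> w"
  shows "du E t x w - du E t x c = (LBINT k:{c..w}. e t x k)"
  by (rule set_integral_FTC[symmetric, OF assms(2)])
     (auto intro!: has_field_derivative_at_within e_deriv assms continuous_on_triple[OF e_cont] continuous_intros)

lemma e_set_integrable: "t \<in> I \<Longrightarrow> set_integrable lborel {c..d} (e t x)"
  by (rule borel_integrable_atLeastAtMost') (auto intro!: continuous_on_triple[OF e_cont] continuous_intros)

lemma integrable_on_interior_slab:
  fixes q :: "real \<Rightarrow> real^'n \<Rightarrow> real \<Rightarrow> real"
  assumes "integrable lborel (\<lambda>(z, k). indicator I (fst z) * indicator {a..b} k * q (fst z) (snd z) k)"
  shows "integrable lborel (\<lambda>(z, k). indicator ((interior I \<times> UNIV) \<times> {a..b}) (z, k) * q (fst z) (snd z) k)"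
proof -
  let ?q = "\<lambda>y. indicator ((interior I \<times> UNIV) \<times> UNIV) y *\<^sub>R
      (case y of (z, k) \<Rightarrow> indicator I (fst z) * indicator {a..b} k * q (fst z) (snd z) k)"
  have S: "(interior I \<times> (UNIV :: (real^'n) set)) \<times> (UNIV :: real set) \<in> sets borel"
    by (intro borel_open open_Times) auto
  have "integrable lborel ?q"
    by (rule integrable_mult_indicator[OF _ assms]) (use S in simp)
  also have "?q
     = (\<lambda>(z, k). indicator ((interior I \<times> UNIV) \<times> {a..b}) (z, k) * q (fst z) (snd z) k)"
    by (auto simp: fun_eq_iff indicator_def interior_I)
  finally show ?thesis .
qed

lemma interior_convex_open:
  "open (interior I \<times> (UNIV :: (real^'n) set))" "convex (interior I \<times> (UNIV :: (real^'n) set))"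
  by (auto intro!: open_Times convex_Times convex_interior time_interval_basic[OF I])

lemma continuous_on_e_slice:
  assumes "continuous_on (I \<times> UNIV) (\<lambda>(t, x). h t x)"
  shows "continuous_on (interior I \<times> UNIV) (\<lambda>z. h (fst z) (snd z))"
  by (rule continuous_on_eq[OF continuous_on_subset[OF assms]]) (auto simp: interior_I)

lemma AE_du_E_absolutely_continuous:
  fixes p q :: "real \<Rightarrow> real^'n \<Rightarrow> real \<Rightarrow> real"
  assumes p: "\<And>z w. fst z \<in> interior I \<Longrightarrow> has_dir_derivative (\<lambda>z. du E (fst z) (snd z) w) (p (fst z) (snd z) w) v z"
      "jointly_continuous I p"
    and q: "\<And>z k. fst z \<in> interior I \<Longrightarrow> k \<in> {a..b} \<Longrightarrow>
        has_dir_derivative (\<lambda>z. e (fst z) (snd z) k) (q (fst z) (snd z) k) v z"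
      "\<And>k. k \<in> {a..b} \<Longrightarrow> continuous_on (I \<times> UNIV) (\<lambda>(t, x). q t x k)"
      "integrable lborel (\<lambda>(z, k). indicator I (fst z) * indicator {a..b} k * q (fst z) (snd z) k)"
  shows "AE z in lborel. z \<in> interior I \<times> UNIV \<longrightarrow> set_integrable lborel {a..b} (q (fst z) (snd z)) \<and>
     (\<forall>w\<in>{a..b}. p (fst z) (snd z) w - p (fst z) (snd z) a = (LBINT k:{a..w}. q (fst z) (snd z) k))"
proof (rule AE_dir_derivative_absolutely_continuous[OF interior_convex_open,
    where A="\<lambda>z. du E (fst z) (snd z)" and e="\<lambda>z. e (fst z) (snd z)" and v=v])
  show "continuous_on ((interior I \<times> UNIV) \<times> {a..b}) (\<lambda>(y, w). p (fst y) (snd y) w)"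
    unfolding case_prod_unfold
    by (rule continuous_on_triple[OF p(2)]) (auto intro!: continuous_intros interior_I)
  show "continuous_on (interior I \<times> UNIV) (\<lambda>y. q (fst y) (snd y) k)" if "k \<in> {a..b}" for k
    by (rule continuous_on_e_slice[OF q(2)[OF that]])
  show "integrable lborel (\<lambda>(y, k). indicator ((interior I \<times> UNIV) \<times> {a..b}) (y, k) * q (fst y) (snd y) k)"
    by (rule integrable_on_interior_slab[OF q(3)])
  fix y :: "real \<times> (real^'n)" assume y: "y \<in> interior I \<times> UNIV"
  then have t: "fst y \<in> interior I" "fst y \<in> I" by (auto simp: interior_I)
  show "du E (fst y) (snd y) w - du E (fst y) (snd y) a = (LBINT k:{a..w}. e (fst y) (snd y) k)" if "w \<in> {a..b}" for w
    by (rule du_E_increment) (use t that in auto)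
  show "continuous_on {a..b} (e (fst y) (snd y))"
    by (intro continuous_on_triple[OF e_cont] continuous_intros t)
qed (auto intro: p(1) q(1))

lemma AE_dt_du_E_absolutely_continuous:
  "AE z in lborel. z \<in> interior I \<times> UNIV \<longrightarrow> set_integrable lborel {a..b} (dt I e (fst z) (snd z)) \<and>
     (\<forall>w\<in>{a..b}. dt I (du E) (fst z) (snd z) w - dt I (du E) (fst z) (snd z) a
        = (LBINT k:{a..w}. dt I e (fst z) (snd z) k))"
  by (rule AE_du_E_absolutely_continuous[where v="(1, 0)", OF has_dir_derivative_time PE(10)
        has_dir_derivative_time e_dt_cont integrable_dt_e])
     (auto intro: PE(4) e_dt interior_I)

lemma AE_pdx_du_E_absolutely_continuous:
  "AE z in lborel. z \<in> interior I \<times> UNIV \<longrightarrow> set_integrable lborel {a..b} (pdx i e (fst z) (snd z)) \<and>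
     (\<forall>w\<in>{a..b}. pdx i (du E) (fst z) (snd z) w - pdx i (du E) (fst z) (snd z) a
        = (LBINT k:{a..w}. pdx i e (fst z) (snd z) k))"
proof (rule AE_du_E_absolutely_continuous[where v="(0, axis i 1)", OF _ PE(11) _ e_dx_cont integrable_pdx_e])
  fix z :: "real \<times> (real^'n)" and w assume "fst z \<in> interior I"
  then have t: "fst z \<in> I" by (rule interior_I)
  show "has_dir_derivative (\<lambda>z. du E (fst z) (snd z) w) (pdx i (du E) (fst z) (snd z) w) (0, axis i 1) z"
    by (rule has_dir_derivative_space[where h="\<lambda>s y. du E s y w",
        OF pdx_has_dir_derivative[where L="\<lambda>r. r" and \<zeta>="du E", OF PE(5)[OF t] bounded_linear_ident]])
  show "has_dir_derivative (\<lambda>z. e (fst z) (snd z) w) (pdx i e (fst z) (snd z) w) (0, axis i 1) z" if "w \<in> {a..b}"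
    by (rule has_dir_derivative_space[where h="\<lambda>s y. e s y w",
        OF pdx_has_dir_derivative[where L="\<lambda>r. r" and \<zeta>=e, OF e_dx[OF t that] bounded_linear_ident]])
qed

section \<open>The pointwise identity for almost every point\<close>

definition linear_entropy :: "real \<Rightarrow> real^'n \<Rightarrow> real \<Rightarrow> real" where
  "linear_entropy = tensor (\<lambda>t x. (du E t x a + du E t x b) / 2) (\<lambda>w. w)"

lemma du_linear_entropy: "du linear_entropy t x w = (du E t x a + du E t x b) / 2"
  by (simp add: linear_entropy_def du_tensor_id)

lemma dt_linear_entropy:
  assumes t: "t \<in> I"
  shows "dt I linear_entropy t x w = (dt I (du E) t x a + dt I (du E) t x b) / 2 * w"
proof -
  have d: "((\<lambda>s. du E s x v) has_real_derivative dt I (du E) t x v) (at t within I)" for v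
    using PE(4)[OF t] by (simp only: has_real_derivative_iff_has_vector_derivative)
  have "((\<lambda>s. (du E s x a + du E s x b) / 2 * w) has_real_derivative
      (dt I (du E) t x a + dt I (du E) t x b) / 2 * w) (at t within I)"
    by (intro DERIV_cmult_right DERIV_cdivide DERIV_add d)
  then have "((\<lambda>s. linear_entropy s x w) has_vector_derivative
      (dt I (du E) t x a + dt I (du E) t x b) / 2 * w) (at t within I)"
    by (simp add: linear_entropy_def tensor_def has_real_derivative_iff_has_vector_derivative)
  then show ?thesis
    unfolding dt_def[of I linear_entropy] by (rule vector_derivative_within[OF time_interval_basic(6)[OF I t]])
qed

text \<open>
  The integrand over time and space of the functional \<open>M_tx\<close>, evaluated at the state
  \<open>w\<close>. The three Kruzkov densities play the same role for \<open>mu\<close> with the test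
  function $\partial^2_{uu}E(\cdot,\cdot,k)$.
\<close>

definition entropy_density :: "(real \<Rightarrow> real^'n \<Rightarrow> real \<Rightarrow> real) \<Rightarrow> (real \<Rightarrow> real^'n \<Rightarrow> real \<Rightarrow> real^'n)
    \<Rightarrow> real \<Rightarrow> real^'n \<Rightarrow> real \<Rightarrow> real" where
  "entropy_density \<zeta> Z t x w = - (du \<zeta> t x w * divx f t x w) + (divx Z t x w + dt I \<zeta> t x w)
     + du \<zeta> t x w * g t x w"

definition kruzkov_density1 :: "real \<Rightarrow> real^'n \<Rightarrow> real \<Rightarrow> real \<Rightarrow> real" where
  "kruzkov_density1 t x w k = \<bar>w - k\<bar> * dt I e t x k + Phi f t x w k \<bullet> gradx e t x k"

definition kruzkov_density2 :: "real \<Rightarrow> real^'n \<Rightarrow> real \<Rightarrow> real \<Rightarrow> real" where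
  "kruzkov_density2 t x w k = sgn (w - k) * divx f t x k * e t x k"

definition kruzkov_density3 :: "real \<Rightarrow> real^'n \<Rightarrow> real \<Rightarrow> real \<Rightarrow> real" where
  "kruzkov_density3 t x w k = sgn (w - k) * g t x w * e t x k"

text \<open>
  The time derivative of $C = \frac12(E(a)+E(b)-a\,\partial_uE(a)-b\,\partial_uE(b))$.
\<close>

definition dt_remainder :: "real \<Rightarrow> real^'n \<Rightarrow> real" where
  "dt_remainder t x = (dt I E t x a + dt I E t x b - a * dt I (du E) t x a - b * dt I (du E) t x b) / 2"

text \<open>
  The derivative $\partial_i R_i$ of the $i$-th component of
  $R = G(a) - \frac12(F(a)+F(b)) + \frac12\,\partial_uE(b)\,(f(b)-f(a))$.
\<close>

definition dx_remainder :: "'n \<Rightarrow> real \<Rightarrow> real^'n \<Rightarrow> real" where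
  "dx_remainder i t x = pdx i G t x a $ i - (pdx i F t x a $ i + pdx i F t x b $ i) / 2
     + (pdx i (du E) t x b * (f t x b $ i - f t x a $ i)
        + du E t x b * (pdx i f t x b $ i - pdx i f t x a $ i)) / 2"

lemma pdx_du_F:
  assumes t: "t \<in> I"
  shows "pdx i (du F) t x w $ i = pdx i (du E) t x w * du f t x w $ i + du E t x w * pdx i (du f) t x w $ i"
proof -
  have "has_dir_derivative (\<lambda>y. du F t y w $ i) (pdx i (du F) t x w $ i) (axis i 1) x"
    by (rule pdx_has_dir_derivative[where \<zeta>="du F" and t=t and u=w, OF PF(5)[OF t] bounded_linear_vec_nth])
  moreover have "has_dir_derivative (\<lambda>y. du E t y w * du f t y w $ i)
      (pdx i (du E) t x w * du f t x w $ i + du E t x w * pdx i (du f) t x w $ i) (axis i 1) x"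
  proof -
    have 1: "has_dir_derivative (\<lambda>y. du E t y w) (pdx i (du E) t x w) (axis i 1) x"
      by (rule pdx_has_dir_derivative[where L="\<lambda>r. r" and \<zeta>="du E", OF PE(5)[OF t] bounded_linear_ident])
    have 2: "has_dir_derivative (\<lambda>y. du f t y w $ i) (pdx i (du f) t x w $ i) (axis i 1) x"
      by (rule pdx_has_dir_derivative[where \<zeta>="du f" and t=t and u=w, OF Pf(5)[OF t] bounded_linear_vec_nth])
    from DERIV_mult[OF 1[unfolded has_dir_derivative_def] 2[unfolded has_dir_derivative_def]]
    show ?thesis by (simp add: has_dir_derivative_def algebra_simps)
  qed
  ultimately show ?thesis
    unfolding has_dir_derivative_def by (simp add: du_F[OF t]) (rule DERIV_unique)
qed

lemma G_increment:
  assumes t: "t \<in> I" and w: "a \<le> w"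
  shows "G t x w $ i - G t x a $ i = (du E t x a + du E t x b) / 2 * (f t x w $ i - f t x a $ i)"
proof -
  have "G t x w $ i - G t x a $ i = (LBINT k:{a..w}. du G t x k $ i)"
    by (rule du_increment[OF I G bounded_linear_vec_nth t w])
  also have "\<dots> = (LBINT k:{a..w}. (du E t x a + du E t x b) / 2 * (du f t x k $ i))"
    by (simp add: du_G[OF t])
  also have "\<dots> = (du E t x a + du E t x b) / 2 * (LBINT k:{a..w}. du f t x k $ i)"
    by (rule set_integral_mult_right)
  also have "(LBINT k:{a..w}. du f t x k $ i) = f t x w $ i - f t x a $ i"
    by (rule du_increment[OF I f bounded_linear_vec_nth t w, symmetric])
  finally show ?thesis .
qed

text \<open>
  Integrating $\partial_uG = \frac12(\partial_uE(a)+\partial_uE(b))\,\partial_uf$ in the state first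
  leaves a product that can be differentiated directly.
\<close>

lemma pdx_G_increment:
  assumes t: "t \<in> I" and w: "a \<le> w"
  shows "pdx i G t x w $ i - pdx i G t x a $ i
     = (pdx i (du E) t x a + pdx i (du E) t x b) / 2 * (f t x w $ i - f t x a $ i)
       + (du E t x a + du E t x b) / 2 * (pdx i f t x w $ i - pdx i f t x a $ i)"
proof -
  have G1: "has_dir_derivative (\<lambda>y. G t y v $ i) (pdx i G t x v $ i) (axis i 1) x" for v
    by (rule pdx_has_dir_derivative[where \<zeta>=G and t=t, OF PG(2)[OF t] bounded_linear_vec_nth])
  have f1: "has_dir_derivative (\<lambda>y. f t y v $ i) (pdx i f t x v $ i) (axis i 1) x" for v
    by (rule pdx_has_dir_derivative[where \<zeta>=f and t=t, OF Pf(2)[OF t] bounded_linear_vec_nth])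
  have E1: "has_dir_derivative (\<lambda>y. du E t y v) (pdx i (du E) t x v) (axis i 1) x" for v
    by (rule pdx_has_dir_derivative[where L="\<lambda>r. r" and \<zeta>="du E", OF PE(5)[OF t] bounded_linear_ident])
  have "has_dir_derivative (\<lambda>y. G t y w $ i - G t y a $ i) (pdx i G t x w $ i - pdx i G t x a $ i) (axis i 1) x"
    using G1 unfolding has_dir_derivative_def by (intro DERIV_diff)
  moreover have "has_dir_derivative (\<lambda>y. (du E t y a + du E t y b) / 2 * (f t y w $ i - f t y a $ i))
      ((pdx i (du E) t x a + pdx i (du E) t x b) / 2 * (f t x w $ i - f t x a $ i)
       + (du E t x a + du E t x b) / 2 * (pdx i f t x w $ i - pdx i f t x a $ i)) (axis i 1) x"
    using DERIV_mult[OF DERIV_cdivide[OF DERIV_add[OF E1[of a, unfolded has_dir_derivative_def] E1[of b, unfolded has_dir_derivative_def]], of 2]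
      DERIV_diff[OF f1[of w, unfolded has_dir_derivative_def] f1[of a, unfolded has_dir_derivative_def]]]
    by (simp add: has_dir_derivative_def algebra_simps)
  ultimately show ?thesis
    unfolding has_dir_derivative_def by (simp only: G_increment[OF t w]) (rule DERIV_unique)
qed

text \<open>
  At a point of absolute continuity the Kruzkov densities integrate to the difference of the two
  entropy densities up to the remainders $\partial_tC$ and $\mathrm{div}\,R$. The term
  $\mathrm{sgn}(w-k)\,\mathrm{div}_xf(k)$ in \<open>mu\<close> matches $-\partial_uE\,\mathrm{div}_xf$ in
  \<open>M_tx\<close> because $\frac12\int_a^b\mathrm{sgn}(w-k)\,\partial^2_{uu}E(k)\,dk$ is
  $\partial_uE(w)$ minus the $\partial_u$-derivative of the linear entropy.
\<close>

lemma entropy_density_representation: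
  assumes t: "t \<in> interior I" and w: "w \<in> {a..b}"
    and ac_t: "set_integrable lborel {a..b} (dt I e t x)"
      "\<And>w. w \<in> {a..b} \<Longrightarrow> dt I (du E) t x w - dt I (du E) t x a = (LBINT k:{a..w}. dt I e t x k)"
    and ac_x: "\<And>i. set_integrable lborel {a..b} (pdx i e t x)"
      "\<And>i w. w \<in> {a..b} \<Longrightarrow> pdx i (du E) t x w - pdx i (du E) t x a = (LBINT k:{a..w}. pdx i e t x k)"
  shows "1 / 2 * (LBINT k:{a..b}. kruzkov_density1 t x w k - kruzkov_density2 t x w k + kruzkov_density3 t x w k)
    = entropy_density E F t x w - entropy_density linear_entropy G t x w
      - dt_remainder t x + (\<Sum>i\<in>UNIV. dx_remainder i t x)"
proof -
  let ?q = "\<lambda>i k. sgn (w - k) * (f t x w $ i - f t x k $ i) * pdx i e t x k"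
  let ?d = "\<lambda>i k. sgn (w - k) * pdx i f t x k $ i * e t x k"
  have tI: "t \<in> I" using t by (rule interior_I)
  have e_int: "set_integrable lborel {a..b} (e t x)" by (rule e_set_integrable[OF tI])
  have A: "du E t x k - du E t x a = (LBINT j:{a..k}. e t x j)" if "k \<in> {a..b}" for k
    by (rule du_E_increment[OF tI]) (use that in auto)
  have cont: "continuous_on {a..b} (h t x)" if "jointly_continuous I h"
    for h :: "real \<Rightarrow> real^'n \<Rightarrow> real \<Rightarrow> 'c::topological_space"
    by (intro continuous_on_triple[OF that] continuous_intros tI)
  have T: "set_integrable lborel {a..b} (\<lambda>k. \<bar>w - k\<bar> * dt I e t x k)"
    "(LBINT k:{a..b}. \<bar>w - k\<bar> * dt I e t x k) = 2 * dt I E t x w - dt I E t x a - dt I E t x b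
      + a * dt I (du E) t x a + b * dt I (du E) t x b - w * (dt I (du E) t x a + dt I (du E) t x b)"
    by (rule kruzkov_entropy_identity[where Z="dt I E t x" and p="dt I (du E) t x", OF w ac_t];
        use dt_increment[OF I E t] in auto)+
  have flux: "set_integrable lborel {a..b} (\<lambda>k. ?q i k)"
    "set_integrable lborel {a..b} (\<lambda>k. ?d i k)"
    "(LBINT k:{a..b}. ?q i k)
      - (LBINT k:{a..b}. ?d i k)
     = 2 * (pdx i F t x w $ i - du E t x w * pdx i f t x w $ i)
       - 2 * (pdx i G t x w $ i - (du E t x a + du E t x b) / 2 * pdx i f t x w $ i)
       + 2 * dx_remainder i t x" for i
  proof -
    have f': "((\<lambda>k. f t x k $ i) has_real_derivative du f t x k $ i) (at k within {a..b})" for k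
      using bounded_linear.has_vector_derivative[OF bounded_linear_vec_nth Pf(3)[OF tI, of x k], of i]
      by (simp add: has_real_derivative_iff_has_vector_derivative has_vector_derivative_at_within)
    have f'c: "continuous_on {a..b} (\<lambda>k. du f t x k $ i)"
      by (intro continuous_on_component cont Pf(9))
    have d'c: "continuous_on {a..b} (\<lambda>k. pdx i (du f) t x k $ i)"
      by (intro continuous_on_component cont Pf(11))
    have d': "((\<lambda>k. pdx i f t x k $ i) has_real_derivative pdx i (du f) t x k $ i) (at k within {a..b})"
      if "k \<in> {a..b}" for k
      by (rule has_real_derivative_if_increments[OF _ d'c that])
         (rule pdx_increment[OF I f bounded_linear_vec_nth tI], auto)
    have F': "pdx i F t x k $ i - pdx i F t x c $ i
        = (LBINT j:{c..k}. pdx i (du E) t x j * du f t x j $ i + du E t x j * pdx i (du f) t x j $ i)"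
      if "c \<in> {a..b}" "k \<in> {c..b}" for c k
      using pdx_increment[OF I F bounded_linear_vec_nth tI, of c k i x i] that by (simp add: pdx_du_F[OF tI])
    note R = kruzkov_flux_identity[OF w e_int ac_x(1)[of i] A ac_x(2) f' f'c d' d'c F' cont[OF PE(11)] cont[OF PE(9)]
        pdx_G_increment[OF tI]]
    show "set_integrable lborel {a..b} (\<lambda>k. ?q i k)"
      by (rule R(1)) (use w in auto)
    show "set_integrable lborel {a..b} (\<lambda>k. ?d i k)"
      by (rule R(2)) (use w in auto)
    show "(LBINT k:{a..b}. ?q i k)
      - (LBINT k:{a..b}. ?d i k)
     = 2 * (pdx i F t x w $ i - du E t x w * pdx i f t x w $ i)
       - 2 * (pdx i G t x w $ i - (du E t x a + du E t x b) / 2 * pdx i f t x w $ i)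
       + 2 * dx_remainder i t x"
      unfolding dx_remainder_def by (rule R(3)) (use w in auto)
  qed
  have S: "set_integrable lborel {a..b} (\<lambda>k. sgn (w - k) * e t x k)"
    "(LBINT k:{a..b}. sgn (w - k) * e t x k) = 2 * du E t x w - du E t x a - du E t x b"
  proof -
    have "integrable lborel (\<lambda>k. sgn (w - k) * (indicator {a..b} k *\<^sub>R e t x k))"
      by (rule integrable_bounded_mult[where B=1])
         (use e_int in \<open>auto simp: set_integrable_def sgn_if\<close>)
    then show "set_integrable lborel {a..b} (\<lambda>k. sgn (w - k) * e t x k)" 
      by (simp add: set_integrable_def mult_ac)
    show "(LBINT k:{a..b}. sgn (w - k) * e t x k) = 2 * du E t x w - du E t x a - du E t x b"
      using set_integral_sgn_split[OF w e_int] set_integral_combine_Icc[OF w e_int] A[of w] A[of b] w by auto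
  qed
  have decomp: "kruzkov_density1 t x w k - kruzkov_density2 t x w k + kruzkov_density3 t x w k
     = \<bar>w - k\<bar> * dt I e t x k
       + (\<Sum>i\<in>UNIV. ?q i k
            - ?d i k)
       + g t x w * (sgn (w - k) * e t x k)" for k
    by (simp add: kruzkov_density1_def kruzkov_density2_def kruzkov_density3_def Phi_def inner_vec_def
        gradx_nth divx_eq_sum_pdx sum_subtractf sum_distrib_left sum_distrib_right mult_ac)
  have fluxi: "set_integrable lborel {a..b} (\<lambda>k. ?q i k
            - ?d i k)" for i
    by (rule set_integral_diff(1)[OF flux(1,2)])
  have sumi: "set_integrable lborel {a..b} (\<lambda>k. \<Sum>i\<in>UNIV. ?q i k
            - ?d i k)"
    unfolding set_integrable_def scaleR_sum_right
    by (rule Bochner_Integration.integrable_sum) (use fluxi in \<open>simp add: set_integrable_def\<close>)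
  have sum: "(LBINT k:{a..b}. \<Sum>i\<in>UNIV. ?q i k
            - ?d i k)
     = (\<Sum>i\<in>UNIV. (LBINT k:{a..b}. ?q i k)
            - (LBINT k:{a..b}. ?d i k))"
  proof -
    have "(LBINT k:{a..b}. \<Sum>i\<in>UNIV. ?q i k
            - ?d i k)
       = (\<Sum>i\<in>UNIV. LBINT k:{a..b}. ?q i k
            - ?d i k)"
      unfolding set_lebesgue_integral_def scaleR_sum_right
      by (rule Bochner_Integration.integral_sum) (use fluxi in \<open>simp add: set_integrable_def\<close>)
    then show ?thesis
      by (simp only: set_integral_diff(2)[OF flux(1,2)])
  qed
  have "(LBINT k:{a..b}. kruzkov_density1 t x w k - kruzkov_density2 t x w k + kruzkov_density3 t x w k)
    = (LBINT k:{a..b}. \<bar>w - k\<bar> * dt I e t x k)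
      + (\<Sum>i\<in>UNIV. (LBINT k:{a..b}. ?q i k)
            - (LBINT k:{a..b}. ?d i k))
      + g t x w * (LBINT k:{a..b}. sgn (w - k) * e t x k)"
    unfolding decomp sum[symmetric]
    by (simp add: set_integral_add set_integral_mult_right T(1) sumi S(1) set_integrable_mult_right)
  also have "(\<Sum>i\<in>UNIV. (LBINT k:{a..b}. ?q i k)
            - (LBINT k:{a..b}. ?d i k))
    = 2 * (divx F t x w - du E t x w * divx f t x w)
      - 2 * (divx G t x w - (du E t x a + du E t x b) / 2 * divx f t x w) + 2 * (\<Sum>i\<in>UNIV. dx_remainder i t x)"
  proof -
    define c where "c = (du E t x a + du E t x b) / 2"
    show ?thesis
      unfolding flux(3) c_def[symmetric] divx_eq_sum_pdx
      by (simp add: sum.distrib sum_subtractf sum_distrib_left[symmetric])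
  qed
  also have "(LBINT k:{a..b}. \<bar>w - k\<bar> * dt I e t x k)
      + (2 * (divx F t x w - du E t x w * divx f t x w)
        - 2 * (divx G t x w - (du E t x a + du E t x b) / 2 * divx f t x w) + 2 * (\<Sum>i\<in>UNIV. dx_remainder i t x))
      + g t x w * (LBINT k:{a..b}. sgn (w - k) * e t x k)
    = 2 * (entropy_density E F t x w - entropy_density linear_entropy G t x w
      - dt_remainder t x + (\<Sum>i\<in>UNIV. dx_remainder i t x))"
    unfolding T(2) S(2)
    by (simp add: entropy_density_def du_linear_entropy dt_linear_entropy[OF tI] dt_remainder_def field_simps)
  finally show ?thesis by simp
qed

lemma AE_entropy_density_representation:
  "AE z in lborel. fst z \<in> I \<longrightarrow> (\<forall>w\<in>{a..b}.
     1 / 2 * (LBINT k:{a..b}. kruzkov_density1 (fst z) (snd z) w k - kruzkov_density2 (fst z) (snd z) w k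
        + kruzkov_density3 (fst z) (snd z) w k)
    = entropy_density E F (fst z) (snd z) w - entropy_density linear_entropy G (fst z) (snd z) w
      - dt_remainder (fst z) (snd z) + (\<Sum>i\<in>UNIV. dx_remainder i (fst z) (snd z)))"
proof -
  have "AE z in lborel. \<forall>i. z \<in> interior I \<times> UNIV \<longrightarrow> set_integrable lborel {a..b} (pdx i e (fst z) (snd z)) \<and>
     (\<forall>w\<in>{a..b}. pdx i (du E) (fst z) (snd z) w - pdx i (du E) (fst z) (snd z) a
        = (LBINT k:{a..w}. pdx i e (fst z) (snd z) k))"
    unfolding AE_all_countable using AE_pdx_du_E_absolutely_continuous by blast
  with AE_time_interior[OF I] AE_dt_du_E_absolutely_continuous show ?thesis
  proof eventually_elim
    case (elim z)
    show ?case
    proof (intro impI ballI)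
      fix w assume "fst z \<in> I" and w: "w \<in> {a..b}"
      then have z: "z \<in> interior I \<times> UNIV" using elim by auto
      then have t: "fst z \<in> interior I" by auto
      show "1 / 2 * (LBINT k:{a..b}. kruzkov_density1 (fst z) (snd z) w k - kruzkov_density2 (fst z) (snd z) w k
          + kruzkov_density3 (fst z) (snd z) w k)
        = entropy_density E F (fst z) (snd z) w - entropy_density linear_entropy G (fst z) (snd z) w
        - dt_remainder (fst z) (snd z) + (\<Sum>i\<in>UNIV. dx_remainder i (fst z) (snd z))"
        by (rule entropy_density_representation[OF t w]) (use elim z in blast)+
    qed
  qed
qed

section \<open>Integration of the remainders\<close>

lemma K_I: "(t, x) \<in> K \<Longrightarrow> t \<in> I"
  using K(2) by auto

lemma divx_cont:
  assumes "\<And>i. jointly_continuous I (pdx i Z)"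
  shows "jointly_continuous I (divx Z)"
proof -
  have "continuous_on (I \<times> UNIV \<times> UNIV) (\<lambda>y. \<Sum>i\<in>UNIV. pdx i Z (fst y) (fst (snd y)) (snd (snd y)) $ i)"
    by (intro continuous_on_sum continuous_on_component continuous_on_triple[OF assms] continuous_intros) auto
  then show ?thesis by (simp add: divx_eq_sum_pdx case_prod_unfold)
qed

text \<open>
  The Borel function \<open>U\<close> takes values in $[a,b]$, so the integrand is bounded by the
  maximum of \<open>h\<close> over the compact set \<open>K \<times> {a..b}\<close>.
\<close>

lemma integrable_state:
  fixes h :: "real \<Rightarrow> real^'n \<Rightarrow> real \<Rightarrow> real"
  assumes h: "jointly_continuous I h"
    and 0: "\<And>t x w. t \<in> I \<Longrightarrow> (t, x) \<notin> K \<Longrightarrow> w \<in> {a..b} \<Longrightarrow> h t x w = 0"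
    and U: "U \<in> borel_measurable borel" "\<And>z. U z \<in> {a..b}"
  shows "integrable lborel (\<lambda>z. indicator I (fst z) * h (fst z) (snd z) (U z))"
proof -
  obtain B where B: "\<forall>z\<in>K. \<forall>w\<in>{a..b}. \<bar>h (fst z) (snd z) w\<bar> \<le> B"
    using compact_bound_triple[OF h K, of a b] ..
  show ?thesis
  proof (rule integrable_compact_support)
    show "(\<lambda>z. indicator I (fst z) * h (fst z) (snd z) (U z)) \<in> borel_measurable borel"
      by (rule borel_measurable_triple[OF I_borel h borel_measurable_fst_snd_borel U(1)])
    show "compact K" by (rule K(1))
    show "z \<in> K" if "indicator I (fst z) * h (fst z) (snd z) (U z) \<noteq> 0" for z
      using that 0[of "fst z" "snd z" "U z"] U(2)[of z] by (auto simp: indicator_def split: if_splits)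
    show "\<bar>indicator I (fst z) * h (fst z) (snd z) (U z)\<bar> \<le> B" if "z \<in> K" for z
      using B[rule_format, OF that U(2), of z] that K_I[of "fst z" "snd z"] by (auto simp: indicator_def)
  qed
qed

lemma integrable_initial:
  fixes h :: "real^'n \<Rightarrow> real \<Rightarrow> real"
  assumes h: "continuous_on (UNIV \<times> UNIV) (\<lambda>(x, u). h x u)"
    and 0: "\<And>x w. (0, x) \<notin> K \<Longrightarrow> w \<in> {a..b} \<Longrightarrow> h x w = 0"
    and U: "U \<in> borel_measurable borel" "\<And>z. U z \<in> {a..b}"
  shows "integrable lborel (\<lambda>x. h x (U x))"
proof -
  have h': "continuous_on ({0::real} \<times> UNIV \<times> UNIV) (\<lambda>(t, x, u). h x u)"
  proof -
    have "continuous_on ({0::real} \<times> UNIV \<times> UNIV) (\<lambda>y. (\<lambda>(x, u). h x u) (snd y))"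
      by (rule continuous_on_compose2[OF h]) (auto intro!: continuous_intros)
    then show ?thesis by (simp add: case_prod_unfold)
  qed
  have K0: "compact ({0} \<times> snd ` K)" "{0} \<times> snd ` K \<subseteq> {0} \<times> UNIV"
    using K(1) by (auto intro!: compact_Times compact_continuous_image continuous_intros)
  obtain B where B: "\<forall>z\<in>{0::real} \<times> snd ` K. \<forall>w\<in>{a..b}. \<bar>h (snd z) w\<bar> \<le> B"
    using compact_bound_triple[OF h' K0, of a b] ..
  show ?thesis
  proof (rule integrable_compact_support)
    have "(\<lambda>x. indicator {0::real} 0 * h x (U x)) \<in> borel_measurable borel"
      by (rule borel_measurable_triple[OF _ h']) (use U in auto)
    then show "(\<lambda>x. h x (U x)) \<in> borel_measurable borel" by simp
    show "compact (snd ` K)" using K(1) by (auto intro!: compact_continuous_image continuous_intros)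
    show "x \<in> snd ` K" if "h x (U x) \<noteq> 0" for x
    proof -
      have "(0, x) \<in> K" using that 0[OF _ U(2)] by blast
      then show ?thesis by (rule image_eqI[rotated]) simp
    qed
    show "\<bar>h x (U x)\<bar> \<le> B" if "x \<in> snd ` K" for x
      using B[rule_format, of "(0, x)", OF _ U(2), of x] that by simp
  qed
qed

lemma initial_slice:
  fixes h :: "real \<Rightarrow> real^'n \<Rightarrow> real \<Rightarrow> real"
  assumes "jointly_continuous I h"
  shows "continuous_on (UNIV \<times> UNIV) (\<lambda>(x, u). h 0 x u)"
  unfolding case_prod_unfold
  by (rule continuous_on_triple[OF assms]) (auto intro!: continuous_intros time_interval_basic[OF I])

text \<open>
  For fixed $x$ the function $C(\cdot,x)$ vanishes from some time in $I$ on, so the fundamental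
  theorem of calculus leaves only its initial value.
\<close>

lemma dt_remainder_integral:
  shows "integrable lborel (\<lambda>z. indicator I (fst z) * dt_remainder (fst z) (snd z))"
    and "(LBINT z. indicator I (fst z) * dt_remainder (fst z) (snd z))
       = - (LBINT x. (E 0 x a + E 0 x b - a * du E 0 x a - b * du E 0 x b) / 2)"
proof -
  let ?r = "\<lambda>z. indicator I (fst z) * dt_remainder (fst z) (snd z)"
  have c: "continuous_on (I \<times> UNIV \<times> UNIV) (\<lambda>(t, x, u). dt_remainder t x)"
    unfolding dt_remainder_def case_prod_unfold
    by (intro continuous_intros continuous_on_triple[OF PE(7)] continuous_on_triple[OF PE(10)]) auto
  show int: "integrable lborel (\<lambda>z. ?r z)"
    by (rule integrable_state[OF c, of "\<lambda>_. a"]) (use ab in \<open>auto simp: dt_remainder_def off_partials\<close>)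
  define T where "T t x = (E t x a + E t x b - a * du E t x a - b * du E t x b) / 2" for t x
  obtain t1 where t1: "t1 \<in> I" "\<And>t x. (t, x) \<in> K \<Longrightarrow> t \<le> t1"
  proof (cases "K = {}")
    case True
    then show ?thesis using that[of 0] time_interval_basic[OF I] by auto
  next
    case False
    have "compact (fst ` K)" using K(1) by (auto intro!: compact_continuous_image continuous_intros)
    from compact_attains_sup[OF this] False obtain s where s: "s \<in> fst ` K" "\<forall>t\<in>fst ` K. t \<le> s" by auto
    show ?thesis
    proof (rule that[of s])
      show "s \<in> I" using s(1) K(2) by auto
      show "t \<le> s" if "(t, x) \<in> K" for t x using s(2) that by force
    qed
  qed
  from time_interval_basic(7)[OF I t1(1)] obtain m where m: "t1 + 1 / Suc m \<in> I"
    by (auto simp: eventually_sequentially)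
  \<comment> \<open>a time in \<open>I\<close> strictly after the projection of \<open>K\<close>, even when \<open>I\<close> is bounded\<close>
  define t2 where "t2 = t1 + 1 / Suc m"
  have t2: "t2 \<in> I" "t2 > t1" "t2 \<ge> 0"
    using m t1 time_interval_basic(4)[OF I t1(1)] by (auto simp: t2_def)
  have seg: "t \<in> I" if "t \<in> {0..t2}" for t
    using I
  proof (cases rule: time_interval_cases)
    case 1 then show ?thesis using that by auto
  next
    case (2 S) then show ?thesis using that t2(1) by auto
  qed
  have slice: "(LBINT t. indicator I t * dt_remainder t x) = - T 0 x" for x
  proof -
    have offt: "(t, x) \<notin> K" if "t \<ge> t2" for t using that t1(2)[of t x] t2 by auto
    have "(LBINT t. indicator I t * dt_remainder t x) = (LBINT t:{0..t2}. dt_remainder t x)"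
      unfolding set_lebesgue_integral_def
    proof (rule Bochner_Integration.integral_cong[OF refl])
      fix t
      show "indicator I t * dt_remainder t x = indicator {0..t2} t *\<^sub>R dt_remainder t x"
        using seg[of t] time_interval_basic(4)[OF I, of t] offt[of t]
        by (cases "t \<in> I"; cases "t \<le> t2") (auto simp: indicator_def dt_remainder_def off_partials)
    qed
    also have "\<dots> = T t2 x - T 0 x"
    proof (rule set_integral_FTC[OF t2(3)])
      fix t assume t: "t \<in> {0..t2}"
      have sub: "{0..t2} \<subseteq> I" using seg by auto
      have d1: "((\<lambda>s. E s x v) has_real_derivative dt I E t x v) (at t within {0..t2})" for v
        using has_vector_derivative_within_subset[OF PE(1)[OF seg[OF t], of x v] sub]
        by (simp only: has_real_derivative_iff_has_vector_derivative)
      have d2: "((\<lambda>s. du E s x v) has_real_derivative dt I (du E) t x v) (at t within {0..t2})" for v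
        using has_vector_derivative_within_subset[OF PE(4)[OF seg[OF t], of x v] sub]
        by (simp only: has_real_derivative_iff_has_vector_derivative)
      show "((\<lambda>t. T t x) has_real_derivative dt_remainder t x) (at t within {0..t2})"
        unfolding T_def dt_remainder_def
        by (intro DERIV_cdivide DERIV_diff DERIV_add DERIV_cmult d1 d2)
    next
      show "continuous_on {0..t2} (\<lambda>t. dt_remainder t x)"
        by (rule continuous_on_triple[OF c]) (auto intro!: continuous_intros seg)
    qed
    also have "T t2 x = 0"
      using off(1)[OF t2(1) offt] off_du(1)[OF t2(1) offt] by (simp add: T_def)
    finally show ?thesis by simp
  qed
  have "integrable lborel (\<lambda>(t, x). indicator I t * dt_remainder t x)"
    using int by (simp add: case_prod_unfold)
  from lborel_Fubini(3,4)[OF this] have "(LBINT x. LBINT t. indicator I t * dt_remainder t x)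
      = (LBINT z. ?r z)"
    by (simp add: case_prod_unfold)
  then show "(LBINT z. ?r z)
       = - (LBINT x. (E 0 x a + E 0 x b - a * du E 0 x a - b * du E 0 x b) / 2)"
    unfolding slice by (simp add: T_def)
qed

text \<open>
  At each time $R$ is a compactly supported $C^1$ field on space.
\<close>

lemma dx_remainder_integral:
  shows "integrable lborel (\<lambda>z. indicator I (fst z) * dx_remainder i (fst z) (snd z))"
    and "(LBINT z. indicator I (fst z) * dx_remainder i (fst z) (snd z)) = 0"
proof -
  let ?r = "\<lambda>z. indicator I (fst z) * dx_remainder i (fst z) (snd z)"
  have c: "continuous_on (I \<times> UNIV \<times> UNIV) (\<lambda>(t, x, u). dx_remainder i t x)"
    unfolding dx_remainder_def case_prod_unfold
    by (intro continuous_intros continuous_on_component continuous_on_triple[OF PG(8)] continuous_on_triple[OF PF(8)]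
        continuous_on_triple[OF Pf(8)] continuous_on_triple[OF PE(11)] continuous_on_triple[OF PE(9)]
        continuous_on_triple[OF Pf(6)]) auto
  show int: "integrable lborel (\<lambda>z. ?r z)"
    by (rule integrable_state[OF c, of "\<lambda>_. a"]) (use ab in \<open>auto simp: dx_remainder_def off_partials off_du\<close>)
  have slice: "(LBINT x. indicator I t * dx_remainder i t x) = 0" for t
  proof (cases "t \<in> I")
    case t: True
    \<comment> \<open>the component \<open>R\<^sub>i(t, \<cdot>)\<close> of the remainder field\<close>
    define R where "R x = G t x a $ i - (F t x a $ i + F t x b $ i) / 2 + du E t x b * (f t x b $ i - f t x a $ i) / 2" for x
    have "(LBINT x. dx_remainder i t x) = 0"
    proof (rule integral_dir_derivative_compact_support[where P=R and v="axis i 1" and K="snd ` K"])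
      fix x
      have G1: "has_dir_derivative (\<lambda>y. G t y v $ i) (pdx i G t x v $ i) (axis i 1) x" for v
        by (rule pdx_has_dir_derivative[where \<zeta>=G and t=t, OF PG(2)[OF t] bounded_linear_vec_nth])
      have F1: "has_dir_derivative (\<lambda>y. F t y v $ i) (pdx i F t x v $ i) (axis i 1) x" for v
        by (rule pdx_has_dir_derivative[where \<zeta>=F and t=t, OF PF(2)[OF t] bounded_linear_vec_nth])
      have f1: "has_dir_derivative (\<lambda>y. f t y v $ i) (pdx i f t x v $ i) (axis i 1) x" for v
        by (rule pdx_has_dir_derivative[where \<zeta>=f and t=t, OF Pf(2)[OF t] bounded_linear_vec_nth])
      have E1: "has_dir_derivative (\<lambda>y. du E t y v) (pdx i (du E) t x v) (axis i 1) x" for v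
        by (rule pdx_has_dir_derivative[where L="\<lambda>r. r" and \<zeta>="du E", OF PE(5)[OF t] bounded_linear_ident])
      note dd = G1[unfolded has_dir_derivative_def] F1[unfolded has_dir_derivative_def]
        f1[unfolded has_dir_derivative_def] E1[unfolded has_dir_derivative_def]
      show "has_dir_derivative R (dx_remainder i t x) (axis i 1) x"
        unfolding has_dir_derivative_def R_def
        by (rule DERIV_cong[OF DERIV_add[OF DERIV_diff[OF dd(1) DERIV_cdivide[OF DERIV_add[OF dd(2) dd(2)]]]
              DERIV_cdivide[OF DERIV_mult[OF dd(4) DERIV_diff[OF dd(3) dd(3)]]]]])
           (simp add: dx_remainder_def algebra_simps)
    next
      show "continuous_on UNIV (dx_remainder i t)"
        by (rule continuous_on_triple[OF c]) (auto intro!: continuous_intros t)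
      show "continuous_on UNIV R"
        unfolding R_def
        by (intro continuous_intros continuous_on_component continuous_on_triple[OF PG(6)] continuous_on_triple[OF PF(6)]
          continuous_on_triple[OF Pf(6)] continuous_on_triple[OF PE(9)] t) auto
      show "compact (snd ` K)" using K(1) by (auto intro!: compact_continuous_image continuous_intros)
      show "R x = 0" if "x \<notin> snd ` K" for x
      proof -
        have "(t, x) \<notin> K" using that by force
        from off(2,3)[OF t this] off_du(1)[OF t this] show ?thesis by (simp add: R_def)
      qed
    qed
    then show ?thesis by simp
  qed simp
  have "integrable lborel (\<lambda>(t, x). indicator I t * dx_remainder i t x)"
    using int by (simp add: case_prod_unfold)
  from lborel_Fubini(4)[OF this] show "(LBINT z. ?r z) = 0"
    unfolding slice by (simp add: case_prod_unfold)
qed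

end

section \<open>Integration over time, space and Kruzkov levels\<close>

text \<open>
  \<open>U\<close> and \<open>Uo\<close> are Borel versions of the solution and of the initial value
  whose ranges lie in $[a,b]$ everywhere.
\<close>

locale kruzkov_state = kruzkov_setting I f g a b E F G K
  for I :: "real set" and f :: "real \<Rightarrow> real^'n \<Rightarrow> real \<Rightarrow> real^'n" and g a b E F G K +
  fixes u U :: "real \<times> (real^'n) \<Rightarrow> real" and uo Uo :: "real^'n \<Rightarrow> real"
  assumes U_meas: "U \<in> borel_measurable borel" and Uo_meas: "Uo \<in> borel_measurable borel"
    and U_range: "\<And>z. U z \<in> {a..b}" and Uo_range: "\<And>x. Uo x \<in> {a..b}"
    and u_U: "AE z in lborel. fst z \<in> I \<longrightarrow> u z = U z"
    and uo_Uo: "AE x in lborel. uo x = Uo x"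
begin

lemma state_integral:
  fixes h :: "real \<Rightarrow> real^'n \<Rightarrow> real \<Rightarrow> real"
  assumes "integrable lborel (\<lambda>z. indicator I (fst z) * h (fst z) (snd z) (U z))"
  shows "(LINT t:I|lebesgue. LINT x|lebesgue. h t x (u (t, x)))
     = (LBINT z. indicator I (fst z) * h (fst z) (snd z) (U z))"
proof -
  have "AE z in lborel. fst z \<in> I \<longrightarrow> h (fst z) (snd z) (u z) = indicator I (fst z) * h (fst z) (snd z) (U z)"
    using u_U by eventually_elim auto
  from iterated_lebesgue_integral[OF assms this] show ?thesis by simp
qed

lemma M_tx_density:
  assumes c: "jointly_continuous I \<zeta>"
      "jointly_continuous I (du \<zeta>)"
      "jointly_continuous I (dt I \<zeta>)"
      "\<And>i. jointly_continuous I (pdx i Z)"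
    and 0: "\<And>t x w. t \<in> I \<Longrightarrow> (t, x) \<notin> K \<Longrightarrow> du \<zeta> t x w = 0"
      "\<And>t x w. t \<in> I \<Longrightarrow> (t, x) \<notin> K \<Longrightarrow> dt I \<zeta> t x w = 0"
      "\<And>t x w i. t \<in> I \<Longrightarrow> (t, x) \<notin> K \<Longrightarrow> pdx i Z t x w = 0"
  shows "integrable lborel (\<lambda>z. indicator I (fst z) * entropy_density \<zeta> Z (fst z) (snd z) (U z))"
    and "M_tx I f g uo u \<zeta> Z
       = (LBINT z. indicator I (fst z) * entropy_density \<zeta> Z (fst z) (snd z) (U z)) + (LBINT x. \<zeta> 0 x (Uo x))"
proof -
  let ?m = "\<lambda>z. indicator I (fst z) * entropy_density \<zeta> Z (fst z) (snd z) (U z)"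
  define h1 where "h1 t x w = du \<zeta> t x w * divx f t x w" for t x w
  define h2 where "h2 t x w = divx Z t x w + dt I \<zeta> t x w" for t x w
  define h3 where "h3 t x w = du \<zeta> t x w * g t x w" for t x w
  have c1: "jointly_continuous I h1"
    unfolding h1_def case_prod_unfold
    by (intro continuous_intros continuous_on_triple[OF c(2)] continuous_on_triple[OF divx_cont[OF Pf(8)]]) auto
  have c2: "jointly_continuous I h2"
    unfolding h2_def case_prod_unfold
    by (intro continuous_intros continuous_on_triple[OF c(3)] continuous_on_triple[OF divx_cont[OF c(4)]]) auto
  have c3: "jointly_continuous I h3"
    unfolding h3_def case_prod_unfold
    by (intro continuous_intros continuous_on_triple[OF c(2)] continuous_on_triple[OF g]) auto
  have i1: "integrable lborel (\<lambda>z. indicator I (fst z) * h1 (fst z) (snd z) (U z))"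
    by (rule integrable_state[OF c1 _ U_meas U_range]) (simp add: h1_def 0)
  have i2: "integrable lborel (\<lambda>z. indicator I (fst z) * h2 (fst z) (snd z) (U z))"
    by (rule integrable_state[OF c2 _ U_meas U_range]) (simp add: h2_def 0 divx_eq_sum_pdx)
  have i3: "integrable lborel (\<lambda>z. indicator I (fst z) * h3 (fst z) (snd z) (U z))"
    by (rule integrable_state[OF c3 _ U_meas U_range]) (simp add: h3_def 0)
  have eq: "?m z
     = - (indicator I (fst z) * h1 (fst z) (snd z) (U z)) + indicator I (fst z) * h2 (fst z) (snd z) (U z)
       + indicator I (fst z) * h3 (fst z) (snd z) (U z)" for z
    by (simp add: entropy_density_def h1_def h2_def h3_def algebra_simps)
  show "integrable lborel (\<lambda>z. ?m z)"
    unfolding eq using i1 i2 i3 by simp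
  have "(LINT x|lebesgue. \<zeta> 0 x (uo x)) = (LBINT x. \<zeta> 0 x (Uo x))"
  proof (rule integral_lebesgue_eq_lborel)
    show "AE x in lborel. \<zeta> 0 x (uo x) = \<zeta> 0 x (Uo x)"
      using uo_Uo by eventually_elim simp
    have "(\<lambda>x. indicator I 0 * \<zeta> 0 x (Uo x)) \<in> borel_measurable borel"
      by (rule borel_measurable_triple[OF I_borel c(1)]) (use Uo_meas in auto)
    then show "(\<lambda>x. \<zeta> 0 x (Uo x)) \<in> borel_measurable borel"
      using time_interval_basic(1)[OF I] by simp
  qed
  then show "M_tx I f g uo u \<zeta> Z
       = (LBINT z. ?m z) + (LBINT x. \<zeta> 0 x (Uo x))"
    using state_integral[OF i1] state_integral[OF i2] state_integral[OF i3] i1 i2 i3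
    unfolding M_tx_def eq by (simp add: h1_def h2_def h3_def)
qed

lemma linear_entropy_cont:
  "jointly_continuous I linear_entropy"
  "jointly_continuous I (du linear_entropy)"
  "jointly_continuous I (dt I linear_entropy)"
proof -
  show "jointly_continuous I linear_entropy"
    unfolding linear_entropy_def tensor_def case_prod_unfold
    by (intro continuous_intros continuous_on_triple[OF PE(9)]) auto
  show "jointly_continuous I (du linear_entropy)"
    unfolding du_linear_entropy case_prod_unfold
    by (intro continuous_intros continuous_on_triple[OF PE(9)]) auto
  have "continuous_on (I \<times> UNIV \<times> UNIV) (\<lambda>(t, x, w). (dt I (du E) t x a + dt I (du E) t x b) / 2 * w)"
    unfolding case_prod_unfold
    by (intro continuous_intros continuous_on_triple[OF PE(10)]) auto
  then show "jointly_continuous I (dt I linear_entropy)"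
    by (rule continuous_on_eq) (auto simp: dt_linear_entropy)
qed

lemma M_tx_E:
  "integrable lborel (\<lambda>z. indicator I (fst z) * entropy_density E F (fst z) (snd z) (U z))"
  "M_tx I f g uo u E F
     = (LBINT z. indicator I (fst z) * entropy_density E F (fst z) (snd z) (U z)) + (LBINT x. E 0 x (Uo x))"
  by (rule M_tx_density[OF PE(6) PE(9) PE(7) PF(8)]; simp add: off_du off_partials)+

lemma M_tx_linear_entropy:
  "integrable lborel (\<lambda>z. indicator I (fst z) * entropy_density linear_entropy G (fst z) (snd z) (U z))"
  "M_tx I f g uo u linear_entropy G
     = (LBINT z. indicator I (fst z) * entropy_density linear_entropy G (fst z) (snd z) (U z)) + (LBINT x. linear_entropy 0 x (Uo x))"
  by (rule M_tx_density[OF linear_entropy_cont PG(8)]; simp add: off_du off_partials du_linear_entropy dt_linear_entropy)+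

lemma borel_measurable_pair_coordinates:
  "(\<lambda>p :: (real \<times> (real^'n)) \<times> real. fst (fst p)) \<in> borel_measurable borel"
  "(\<lambda>p :: (real \<times> (real^'n)) \<times> real. snd (fst p)) \<in> borel_measurable borel"
  "(\<lambda>p :: (real \<times> (real^'n)) \<times> real. snd p) \<in> borel_measurable borel"
  "(\<lambda>p :: (real \<times> (real^'n)) \<times> real. U (fst p)) \<in> borel_measurable borel"
  by (auto intro!: borel_measurable_continuous_onI continuous_intros
      measurable_compose[OF borel_measurable_fst_snd_borel(1) U_meas])

text \<open>
  The factor \<open>q\<close>, which will be $\partial^2_{uu}E$ or one of its derivatives, is only
  integrable on the slab, but its coefficient is Borel measurable, and bounded where \<open>q\<close>
  does not vanish. The state \<open>\<gamma>\<close> in the coefficient is either the solution or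
  the level \<open>k\<close>.
\<close>

lemma integrable_sgn_product:
  fixes h q :: "real \<Rightarrow> real^'n \<Rightarrow> real \<Rightarrow> real"
  assumes h: "jointly_continuous I h"
    and \<gamma>: "\<gamma> \<in> borel_measurable borel" "\<And>p. snd p \<in> {a..b} \<Longrightarrow> \<gamma> p \<in> {a..b}"
    and q: "integrable lborel (\<lambda>(z, k). indicator I (fst z) * indicator {a..b} k * q (fst z) (snd z) k)"
      "\<And>t x k. t \<in> I \<Longrightarrow> (t, x) \<notin> K \<Longrightarrow> k \<in> {a..b} \<Longrightarrow> q t x k = 0"
  shows "integrable lborel (\<lambda>(z, k). indicator I (fst z) * indicator {a..b} k *
     (sgn (U z - k) * h (fst z) (snd z) (\<gamma> (z, k)) * q (fst z) (snd z) k))"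
proof -
  let ?q = "\<lambda>(z, k). indicator I (fst z) * indicator {a..b} k * q (fst z) (snd z) k"
  let ?c = "\<lambda>p. sgn (U (fst p) - snd p) * (indicator I (fst (fst p)) * h (fst (fst p)) (snd (fst p)) (\<gamma> p))"
  obtain B where B: "\<forall>z\<in>K. \<forall>w\<in>{a..b}. \<bar>h (fst z) (snd z) w\<bar> \<le> B"
    using compact_bound_triple[OF h K, of a b] ..
  note [measurable] = borel_measurable_pair_coordinates
    borel_measurable_triple[OF I_borel h borel_measurable_pair_coordinates(1,2) \<gamma>(1)]
  have "integrable lborel (\<lambda>p. ?c p * ?q p)"
  proof (rule integrable_bounded_mult[OF q(1)])
    show "?c \<in> borel_measurable lborel" by measurable
    fix p assume p: "?q p \<noteq> 0"
    then have k: "fst (fst p) \<in> I" "snd p \<in> {a..b}"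
      by (auto simp: case_prod_unfold indicator_def split: if_splits)
    moreover have "fst p \<in> K"
      using p q(2)[OF k(1) _ k(2), of "snd (fst p)"]
      by (cases "fst p \<in> K") (auto simp: case_prod_unfold)
    ultimately have "\<bar>h (fst (fst p)) (snd (fst p)) (\<gamma> p)\<bar> \<le> B"
      using B \<gamma>(2) by blast
    then show "\<bar>?c p\<bar> \<le> B"
      using k by (auto simp: abs_mult sgn_if)
  qed
  also have "(\<lambda>p. ?c p * ?q p) = (\<lambda>(z, k). indicator I (fst z) * indicator {a..b} k *
     (sgn (U z - k) * h (fst z) (snd z) (\<gamma> (z, k)) * q (fst z) (snd z) k))"
    by (auto simp: fun_eq_iff indicator_def)
  finally show ?thesis .
qed

lemma integrable_e:
  "integrable lborel (\<lambda>(z, k). indicator I (fst z) * indicator {a..b} k * e (fst z) (snd z) k)"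
proof -
  obtain B where B: "\<forall>z\<in>K. \<forall>w\<in>{a..b}. \<bar>e (fst z) (snd z) w\<bar> \<le> B"
    using compact_bound_triple[OF e_cont K, of a b] ..
  note [measurable] = borel_measurable_pair_coordinates
    borel_measurable_triple[OF I_borel e_cont borel_measurable_pair_coordinates(1,2,3)]
  let ?h = "\<lambda>p. indicator {a..b} (snd p) * (indicator I (fst (fst p)) * e (fst (fst p)) (snd (fst p)) (snd p))"
  have "integrable lborel ?h"
  proof (rule integrable_compact_support)
    show "?h \<in> borel_measurable borel" by measurable
    show "compact (K \<times> {a..b})" by (intro compact_Times K compact_Icc)
    show "p \<in> K \<times> {a..b}" if "?h p \<noteq> 0" for p
      using that off_du(2)[of "fst (fst p)" "snd (fst p)"]
      by (cases p) (auto simp: indicator_def split: if_splits)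
    show "\<bar>?h p\<bar> \<le> B" if "p \<in> K \<times> {a..b}" for p
      using that B[rule_format, of "fst p" "snd p"] K(2) by (cases p) (auto simp: indicator_def)
  qed
  then show ?thesis by (simp add: case_prod_unfold mult_ac)
qed

lemma integrable_density1:
  "integrable lborel (\<lambda>(z, k). indicator I (fst z) * indicator {a..b} k * kruzkov_density1 (fst z) (snd z) (U z) k)"
proof -
  let ?t = "\<lambda>(z, k). \<bar>U z - k\<bar> * (indicator I (fst z) * indicator {a..b} k * dt I e (fst z) (snd z) k)"
  let ?x = "\<lambda>i \<gamma>. \<lambda>(z, k). indicator I (fst z) * indicator {a..b} k *
     (sgn (U z - k) * (f (fst z) (snd z) (\<gamma> (z, k)) $ i) * pdx i e (fst z) (snd z) k)"
  note [measurable] = borel_measurable_pair_coordinates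
  have t: "integrable lborel ?t"
    unfolding case_prod_unfold
  proof (rule integrable_bounded_mult[OF integrable_dt_e[unfolded case_prod_unfold]])
    show "(\<lambda>p :: (real \<times> (real^'n)) \<times> real. \<bar>U (fst p) - snd p\<bar>) \<in> borel_measurable lborel"
      by measurable
    show "\<bar>\<bar>U (fst p) - snd p\<bar>\<bar> \<le> b - a"
      if "indicator I (fst (fst p)) * indicator {a..b} (snd p) * dt I e (fst (fst p)) (snd (fst p)) (snd p) \<noteq> 0" for p
      using that U_range[of "fst p"] by (auto simp: indicator_def split: if_splits)
  qed
  have x: "integrable lborel (?x i \<gamma>)"
    if "\<gamma> \<in> borel_measurable borel" "\<And>p. snd p \<in> {a..b} \<Longrightarrow> \<gamma> p \<in> {a..b}" for i \<gamma>
  proof (rule integrable_sgn_product[where h="\<lambda>t x w. f t x w $ i", OF _ that integrable_pdx_e off_partials(7)])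
    show "jointly_continuous I (\<lambda>t x w. f t x w $ i)"
      unfolding case_prod_unfold
      by (intro continuous_on_component continuous_on_triple[OF Pf(6)] continuous_intros) auto
  qed
  have "integrable lborel (\<lambda>p. ?t p + (\<Sum>i\<in>UNIV. ?x i (\<lambda>p. U (fst p)) p - ?x i snd p))"
    by (intro Bochner_Integration.integrable_add Bochner_Integration.integrable_sum
        Bochner_Integration.integrable_diff t x borel_measurable_pair_coordinates U_range)
  also have "(\<lambda>p. ?t p + (\<Sum>i\<in>UNIV. ?x i (\<lambda>p. U (fst p)) p - ?x i snd p))
    = (\<lambda>(z, k). indicator I (fst z) * indicator {a..b} k * kruzkov_density1 (fst z) (snd z) (U z) k)"
    by (auto simp: fun_eq_iff kruzkov_density1_def Phi_def inner_vec_def gradx_nth indicator_def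
        algebra_simps sum_distrib_left)
  finally show ?thesis .
qed

lemma integrable_density2:
  "integrable lborel (\<lambda>(z, k). indicator I (fst z) * indicator {a..b} k * kruzkov_density2 (fst z) (snd z) (U z) k)"
  using integrable_sgn_product[OF divx_cont[OF Pf(8)] borel_measurable_pair_coordinates(3) _ integrable_e off_du(2)]
  by (simp add: kruzkov_density2_def)

lemma integrable_density3:
  "integrable lborel (\<lambda>(z, k). indicator I (fst z) * indicator {a..b} k * kruzkov_density3 (fst z) (snd z) (U z) k)"
  using integrable_sgn_product[OF g borel_measurable_pair_coordinates(4) U_range integrable_e off_du(2)]
  by (simp add: kruzkov_density3_def)

lemma e_initial_cont: "continuous_on UNIV (\<lambda>p :: (real^'n) \<times> real. e 0 (fst p) (snd p))"
  by (rule continuous_on_triple[OF e_cont]) (auto intro!: continuous_intros time_interval_basic[OF I])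

lemma integrable_density_initial:
  "integrable lborel (\<lambda>(x, k). indicator {a..b} k * (\<bar>Uo x - k\<bar> * e 0 x k))"
proof -
  let ?h = "\<lambda>x k. indicator {a..b} k * (\<bar>Uo x - k\<bar> * e 0 x k)"
  have e[measurable]: "(\<lambda>p :: (real^'n) \<times> real. e 0 (fst p) (snd p)) \<in> borel_measurable borel"
    by (rule borel_measurable_continuous_onI[OF e_initial_cont])
  obtain B where B: "\<forall>z\<in>K. \<forall>w\<in>{a..b}. \<bar>e (fst z) (snd z) w\<bar> \<le> B"
    using compact_bound_triple[OF e_cont K, of a b] ..
  have cp: "compact (snd ` K \<times> {a..b})"
    using K(1) by (auto intro!: compact_Times compact_continuous_image continuous_intros)
  have off0: "e 0 x k = 0" if "(0, x) \<notin> K" for x k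
    using off_du(2)[OF time_interval_basic(1)[OF I] that] .
  note [measurable] = borel_measurable_fst_snd_borel[where 'a="real^'n" and 'b=real]
    measurable_compose[OF borel_measurable_fst_snd_borel(1) Uo_meas]
  show ?thesis
  proof (rule integrable_compact_support[OF _ cp])
    have "(\<lambda>p :: (real^'n) \<times> real. indicator {a..b} (snd p) * (\<bar>Uo (fst p) - snd p\<bar> * e 0 (fst p) (snd p))) \<in> borel_measurable borel"
      by measurable
    then show "(\<lambda>(x, k). ?h x k) \<in> borel_measurable borel"
      by (simp add: case_prod_unfold)
    show "p \<in> snd ` K \<times> {a..b}" if "(case p of (x, k) \<Rightarrow> ?h x k) \<noteq> 0" for p
    proof -
      have "(0, fst p) \<in> K" "snd p \<in> {a..b}"
        using that off0[of "fst p" "snd p"] by (auto simp: case_prod_unfold indicator_def split: if_splits)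
      moreover from this(1) have "fst p \<in> snd ` K" by (rule image_eqI[rotated]) simp
      ultimately show ?thesis by (cases p) simp
    qed
    show "\<bar>case p of (x, k) \<Rightarrow> ?h x k\<bar> \<le> (b - a) * \<bar>B\<bar>"
      if "p \<in> snd ` K \<times> {a..b}" for p
    proof (cases "(0, fst p) \<in> K")
      case True
      have k: "snd p \<in> {a..b}" using that by auto
      have "\<bar>e 0 (fst p) (snd p)\<bar> \<le> B" using B[rule_format, OF True k] by simp
      moreover have "\<bar>Uo (fst p) - snd p\<bar> \<le> b - a" using k Uo_range[of "fst p"] by auto
      ultimately have "\<bar>Uo (fst p) - snd p\<bar> * \<bar>e 0 (fst p) (snd p)\<bar> \<le> (b - a) * \<bar>B\<bar>"
        by (intro mult_mono) auto
      then show ?thesis using k by (simp add: case_prod_unfold abs_mult)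
    next
      case False
      then show ?thesis using off0 ab by (simp add: case_prod_unfold)
    qed
  qed
qed

text \<open>
  The hypotheses hold for almost every level \<open>k\<close> by Fubini's theorem.
\<close>

lemma mu_density:
  assumes i: "integrable lborel (\<lambda>z. indicator I (fst z) * kruzkov_density1 (fst z) (snd z) (U z) k)"
    "integrable lborel (\<lambda>z. indicator I (fst z) * kruzkov_density2 (fst z) (snd z) (U z) k)"
    "integrable lborel (\<lambda>z. indicator I (fst z) * kruzkov_density3 (fst z) (snd z) (U z) k)"
  shows "mu I f g uo u k (\<lambda>t x. e t x k)
    = (LBINT z. indicator I (fst z) * kruzkov_density1 (fst z) (snd z) (U z) k
        - indicator I (fst z) * kruzkov_density2 (fst z) (snd z) (U z) k
        + indicator I (fst z) * kruzkov_density3 (fst z) (snd z) (U z) k)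
      + (LBINT x. \<bar>Uo x - k\<bar> * e 0 x k)"
proof -
  have "(LINT x|lebesgue. \<bar>uo x - k\<bar> * e 0 x k) = (LBINT x. \<bar>Uo x - k\<bar> * e 0 x k)"
  proof (rule integral_lebesgue_eq_lborel)
    show "AE x in lborel. \<bar>uo x - k\<bar> * e 0 x k = \<bar>Uo x - k\<bar> * e 0 x k"
      using uo_Uo by eventually_elim simp
    have "(\<lambda>x. e 0 x k) \<in> borel_measurable borel"
      by (rule borel_measurable_continuous_onI, rule continuous_on_triple[OF e_cont])
         (auto intro!: continuous_intros time_interval_basic[OF I])
    then show "(\<lambda>x. \<bar>Uo x - k\<bar> * e 0 x k) \<in> borel_measurable borel"
      using Uo_meas by measurable
  qed
  then show ?thesis
    using state_integral[where h="\<lambda>t x w. kruzkov_density1 t x w k", OF i(1)]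
      state_integral[where h="\<lambda>t x w. kruzkov_density2 t x w k", OF i(2)]
      state_integral[where h="\<lambda>t x w. kruzkov_density3 t x w k", OF i(3)] i
    unfolding mu_def
    by (simp add: kruzkov_density1_def[abs_def] kruzkov_density2_def[abs_def] kruzkov_density3_def[abs_def] dt_def gradx_def)
qed

lemma entropy_initial_representation:
  "1 / 2 * (LBINT k:{a..b}. \<bar>Uo x - k\<bar> * e 0 x k)
     = E 0 x (Uo x) - linear_entropy 0 x (Uo x) - (E 0 x a + E 0 x b - a * du E 0 x a - b * du E 0 x b) / 2"
proof -
  have 0: "0 \<in> I" by (rule time_interval_basic(1)[OF I])
  have "(LBINT k:{a..b}. \<bar>Uo x - k\<bar> * e 0 x k) = 2 * E 0 x (Uo x) - E 0 x a - E 0 x b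
      + a * du E 0 x a + b * du E 0 x b - Uo x * (du E 0 x a + du E 0 x b)"
  proof (rule kruzkov_entropy_identity(2)[OF Uo_range e_set_integrable[OF 0]])
    show "du E 0 x k - du E 0 x a = (LBINT j:{a..k}. e 0 x j)" if "k \<in> {a..b}" for k
      by (rule du_E_increment[OF 0]) (use that in auto)
    show "E 0 x d - E 0 x c = (LBINT k:{c..d}. du E 0 x k)" if "c \<in> {a..b}" "d \<in> {c..b}" for c d
      using du_increment[OF I E bounded_linear_ident 0] that by auto
  qed
  then show ?thesis by (simp add: linear_entropy_def tensor_def field_simps)
qed

text \<open>
  For almost every level, \<open>mu\<close> is an integral over time and space plus an integral over
  the initial values; both are exchanged with the integral over the levels. The pointwise identities
  then leave the two functionals \<open>M_tx\<close>, and the integrals of the remainders cancel.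
\<close>

lemma entropy_representation:
  "M_tx I f g uo u E F =
     1 / 2 * (LINT k:{a..b}|lebesgue. mu I f g uo u k (\<lambda>t x. e t x k)) + M_tx I f g uo u linear_entropy G"
proof -
  let ?E = "\<lambda>z. indicator I (fst z) * entropy_density E F (fst z) (snd z) (U z)"
  let ?L = "\<lambda>z. indicator I (fst z) * entropy_density linear_entropy G (fst z) (snd z) (U z)"
  let ?T = "\<lambda>z. indicator I (fst z) * dt_remainder (fst z) (snd z)"
  let ?X = "\<lambda>i z. indicator I (fst z) * dx_remainder i (fst z) (snd z)"
  let ?C = "\<lambda>x. (E 0 x a + E 0 x b - a * du E 0 x a - b * du E 0 x b) / 2"
  define H where "H j z k = indicator I (fst z) * indicator {a..b} k * j (fst z) (snd z) (U z) k"
    for j :: "real \<Rightarrow> real^'n \<Rightarrow> real \<Rightarrow> real \<Rightarrow> real" and z k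
  define H0 where "H0 x k = indicator {a..b} k * (\<bar>Uo x - k\<bar> * e 0 x k)" for x k
  define HH where "HH z k = H kruzkov_density1 z k - H kruzkov_density2 z k + H kruzkov_density3 z k" for z k
  have i: "integrable lborel (\<lambda>(z, k). H kruzkov_density1 z k)"
    "integrable lborel (\<lambda>(z, k). H kruzkov_density2 z k)"
    "integrable lborel (\<lambda>(z, k). H kruzkov_density3 z k)"
    "integrable lborel (\<lambda>(x, k). H0 x k)"
    unfolding H_def H0_def
    by (rule integrable_density1 integrable_density2 integrable_density3 integrable_density_initial)+
  have iH: "integrable lborel (\<lambda>(z, k). HH z k)"
    using i(1-3) by (simp add: HH_def case_prod_unfold)
  have mu_AE: "AE k in lborel. indicator {a..b} k *\<^sub>R mu I f g uo u k (\<lambda>t x. e t x k)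
      = (LBINT z. HH z k) + (LBINT x. H0 x k)"
    using lborel_Fubini(1)[OF i(1)] lborel_Fubini(1)[OF i(2)] lborel_Fubini(1)[OF i(3)]
  proof eventually_elim
    case (elim k)
    show ?case
    proof (cases "k \<in> {a..b}")
      case True
      then have "integrable lborel (\<lambda>z. indicator I (fst z) * kruzkov_density1 (fst z) (snd z) (U z) k)"
        "integrable lborel (\<lambda>z. indicator I (fst z) * kruzkov_density2 (fst z) (snd z) (U z) k)"
        "integrable lborel (\<lambda>z. indicator I (fst z) * kruzkov_density3 (fst z) (snd z) (U z) k)"
        using elim by (simp_all add: H_def)
      from mu_density[OF this] True show ?thesis
        by (simp add: HH_def H_def H0_def)
    next
      case False
      then show ?thesis by (simp add: HH_def H_def H0_def)
    qed
  qed
  have ik: "integrable lborel (\<lambda>k. LBINT z. HH z k)" "integrable lborel (\<lambda>k. LBINT x. H0 x k)"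
  proof -
    have "integrable (lborel \<Otimes>\<^sub>M lborel) (\<lambda>(z, k). HH z k)" "integrable (lborel \<Otimes>\<^sub>M lborel) (\<lambda>(x, k). H0 x k)"
      using iH i(4) by (simp_all add: lborel_prod)
    from this[THEN lborel_pair.integrable_product_swap, THEN lborel_pair.integrable_fst']
    show "integrable lborel (\<lambda>k. LBINT z. HH z k)" "integrable lborel (\<lambda>k. LBINT x. H0 x k)"
      by simp_all
  qed
  have "(LINT k:{a..b}|lebesgue. mu I f g uo u k (\<lambda>t x. e t x k)) = (LBINT k. (LBINT z. HH z k) + (LBINT x. H0 x k))"
    unfolding set_lebesgue_integral_def
    by (rule integral_lebesgue_eq_lborel[OF mu_AE]) (use ik in auto)
  also have "\<dots> = (LBINT z. LBINT k. HH z k) + (LBINT x. LBINT k. H0 x k)"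
    using ik lborel_Fubini(3)[OF iH] lborel_Fubini(3)[OF i(4)] by simp
  finally have lhs: "(LINT k:{a..b}|lebesgue. mu I f g uo u k (\<lambda>t x. e t x k))
      = (LBINT z. LBINT k. HH z k) + (LBINT x. LBINT k. H0 x k)" .
  have inner: "AE z in lborel. 1 / 2 * (LBINT k. HH z k)
      = ?E z
        - ?L z
        - ?T z
        + (\<Sum>i\<in>UNIV. ?X i z)"
    using AE_entropy_density_representation
  proof eventually_elim
    case (elim z)
    have eq: "(LBINT k. HH z k) = indicator I (fst z) * (LBINT k:{a..b}. kruzkov_density1 (fst z) (snd z) (U z) k
        - kruzkov_density2 (fst z) (snd z) (U z) k + kruzkov_density3 (fst z) (snd z) (U z) k)"
      unfolding set_lebesgue_integral_def Bochner_Integration.integral_mult_right_zero[symmetric]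
      by (rule Bochner_Integration.integral_cong[OF refl]) (simp add: HH_def H_def algebra_simps)
    show ?case
    proof (cases "fst z \<in> I")
      case True
      then have ind: "indicator I (fst z) = (1 :: real)" by simp
      show ?thesis
        unfolding eq ind mult_1_left by (rule elim[rule_format, OF True U_range])
    next
      case False
      then have ind: "indicator I (fst z) = (0 :: real)" by simp
      show ?thesis
        unfolding eq ind by simp
    qed
  qed
  have iz: "integrable lborel (\<lambda>z. LBINT k. HH z k)" by (rule lborel_Fubini(2)[OF iH])
  have ir: "integrable lborel (\<lambda>z. ?E z
        - ?L z
        - ?T z
        + (\<Sum>i\<in>UNIV. ?X i z))"
    by (intro Bochner_Integration.integrable_add Bochner_Integration.integrable_diff
        Bochner_Integration.integrable_sum M_tx_E(1) M_tx_linear_entropy(1) dt_remainder_integral(1) dx_remainder_integral(1))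
  have "1 / 2 * (LBINT z. LBINT k. HH z k) = (LBINT z. 1 / 2 * (LBINT k. HH z k))"
    by simp
  also have "\<dots> = (LBINT z. ?E z
        - ?L z
        - ?T z
        + (\<Sum>i\<in>UNIV. ?X i z))"
    by (rule integral_cong_AE[OF _ borel_measurable_integrable[OF ir] inner])
       (use borel_measurable_integrable[OF iz] in simp)
  also have "\<dots> = (LBINT z. ?E z)
      - (LBINT z. ?L z)
      - (LBINT z. ?T z)
      + (\<Sum>i\<in>UNIV. LBINT z. ?X i z)"
    by (simp only: Bochner_Integration.integral_add Bochner_Integration.integral_diff Bochner_Integration.integral_sum
        Bochner_Integration.integrable_add Bochner_Integration.integrable_diff Bochner_Integration.integrable_sum
        M_tx_E(1) M_tx_linear_entropy(1) dt_remainder_integral(1) dx_remainder_integral(1))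
  also have "(\<Sum>i\<in>UNIV. LBINT z. ?X i z) = 0"
    by (simp only: dx_remainder_integral(2) sum.neutral_const)
  finally have part1: "1 / 2 * (LBINT z. LBINT k. HH z k)
     = (LBINT z. ?E z)
      - (LBINT z. ?L z)
      + (LBINT x. ?C x)"
    unfolding dt_remainder_integral(2) by simp
  have offE: "E 0 x w = 0" "du E 0 x w = 0" if "(0, x) \<notin> K" for x w
    using off(1)[OF time_interval_basic(1)[OF I] that] off_du(1)[OF time_interval_basic(1)[OF I] that] by auto
  have iE: "integrable lborel (\<lambda>x. E 0 x (Uo x))"
    by (rule integrable_initial[OF initial_slice[OF PE(6)] _ Uo_meas Uo_range]) (simp add: offE)
  have iL: "integrable lborel (\<lambda>x. linear_entropy 0 x (Uo x))"
    by (rule integrable_initial[OF initial_slice[OF linear_entropy_cont(1)] _ Uo_meas Uo_range]) (simp add: offE linear_entropy_def tensor_def)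
  have iC: "integrable lborel (\<lambda>x. ?C x)"
  proof -
    have c: "continuous_on (I \<times> UNIV \<times> UNIV) (\<lambda>(t, x, w). (E t x a + E t x b - a * du E t x a - b * du E t x b) / 2)"
      unfolding case_prod_unfold
      by (intro continuous_intros continuous_on_triple[OF PE(6)] continuous_on_triple[OF PE(9)]) auto
    show ?thesis
      by (rule integrable_initial[OF initial_slice[OF c], of "\<lambda>_. a"]) (use ab in \<open>auto simp: offE\<close>)
  qed
  have "1 / 2 * (LBINT x. LBINT k. H0 x k)
      = (LBINT x. E 0 x (Uo x) - linear_entropy 0 x (Uo x) - ?C x)"
    unfolding Bochner_Integration.integral_mult_right_zero[symmetric]
      entropy_initial_representation[symmetric]
    by (simp add: H0_def set_lebesgue_integral_def)
  also have "\<dots> = (LBINT x. E 0 x (Uo x)) - (LBINT x. linear_entropy 0 x (Uo x))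
      - (LBINT x. ?C x)"
    by (simp only: Bochner_Integration.integral_diff Bochner_Integration.integrable_diff iE iL iC)
  finally have part2: "1 / 2 * (LBINT x. LBINT k. H0 x k) = (LBINT x. E 0 x (Uo x)) - (LBINT x. linear_entropy 0 x (Uo x))
      - (LBINT x. ?C x)" .
  show ?thesis
    unfolding M_tx_E(2) M_tx_linear_entropy(2) lhs distrib_left part1 part2 by simp
qed

end

section \<open>Essential ranges and Borel representatives\<close>

lemma vanishes_off_spt_tx:
  assumes "t \<in> I" "(t, x) \<notin> spt_tx I \<zeta>"
  shows "\<zeta> t x w = 0"
proof (rule ccontr)
  assume "\<zeta> t x w \<noteq> 0"
  then have "(t, x) \<in> {(t, x). t \<in> I \<and> (\<exists>u. \<zeta> t x u \<noteq> 0)}" using assms(1) by auto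
  then have "(t, x) \<in> closure {(t, x). t \<in> I \<and> (\<exists>u. \<zeta> t x u \<noteq> 0)}"
    by (rule subsetD[OF closure_subset])
  then show False using assms by (simp add: spt_tx_def)
qed

lemma AE_between_ess_inf_ess_sup: "AE z in M. ess_inf M h \<le> ereal (h z) \<and> ereal (h z) \<le> ess_sup M h"
proof -
  have "AE z in M. - ereal (h z) \<le> esssup M (\<lambda>z. - ereal (h z))"
    by (rule esssup_AE)
  moreover have "AE z in M. ereal (h z) \<le> ess_sup M h"
    unfolding ess_sup_def by (rule esssup_AE)
  ultimately show ?thesis
  proof eventually_elim
    case (elim z)
    have "- esssup M (\<lambda>z. - ereal (h z)) \<le> ereal (h z)"
      using elim(1) ereal_minus_le_minus[of "esssup M (\<lambda>z. - ereal (h z))" "- ereal (h z)"] by simp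
    then show ?case using elim(2) by (simp add: ess_inf_def)
  qed
qed

text \<open>
  A Borel version of \<open>h\<close> is truncated to $[a,b]$; almost everywhere on \<open>S\<close> this
  changes nothing.
\<close>

lemma borel_representative_in_Icc:
  fixes h :: "'a::euclidean_space \<Rightarrow> real"
  assumes S: "S \<in> sets lebesgue" and h: "h \<in> borel_measurable (lebesgue_on S)"
    and range: "AE z in lebesgue_on S. h z \<in> {a..b}" and ab: "a \<le> b"
  obtains U where "U \<in> borel_measurable borel" "\<And>z. U z \<in> {a..b}" "AE z in lborel. z \<in> S \<longrightarrow> h z = U z"
proof -
  have "(\<lambda>z. h z * indicator S z) \<in> borel_measurable lebesgue"
    using h S by (subst (asm) borel_measurable_restrict_space_iff) (auto simp: mult.commute)
  from completion_ex_borel_measurable_real[OF this] obtain U0 where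
    U0: "U0 \<in> borel_measurable lborel" "AE z in lborel. h z * indicator S z = U0 z" by blast
  have "AE z in lebesgue. z \<in> S \<longrightarrow> h z \<in> {a..b}"
    using range S by (subst (asm) AE_restrict_space_iff) auto
  then have r: "AE z in lborel. z \<in> S \<longrightarrow> h z \<in> {a..b}"
    by (simp only: AE_completion_iff)
  show ?thesis
  proof (rule that[of "\<lambda>z. max a (min b (U0 z))"])
    show "(\<lambda>z. max a (min b (U0 z))) \<in> borel_measurable borel" using U0(1) by simp
    show "max a (min b (U0 z)) \<in> {a..b}" for z using ab by auto
    show "AE z in lborel. z \<in> S \<longrightarrow> h z = max a (min b (U0 z))"
      using r U0(2) by eventually_elim auto
  qed
qed

theorem theorem3p10:
  fixes I :: "real set"
    and f :: "real \<Rightarrow> real^'n \<Rightarrow> real \<Rightarrow> real^'n"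
    and g :: "real \<Rightarrow> real^'n \<Rightarrow> real \<Rightarrow> real"
    and uo :: "real^'n \<Rightarrow> real"
    and u :: "real \<times> (real^'n) \<Rightarrow> real"
    and a b :: real
    and E :: "real \<Rightarrow> real^'n \<Rightarrow> real \<Rightarrow> real"
    and F G :: "real \<Rightarrow> real^'n \<Rightarrow> real \<Rightarrow> real^'n"
  defines "L \<equiv> tensor (\<lambda>t x. (du E t x a + du E t x b) / 2) (\<lambda>w. w)"
  assumes "time_interval I"
    and "f \<in> space_F I"
    and "continuous_on (closure I \<times> UNIV \<times> UNIV) (\<lambda>(t, x, w). g t x w)"
    and "Linfty lebesgue uo"
    and "Linfty (lebesgue_on (I \<times> UNIV)) u"
    and "J_range I u uo \<subseteq> {a..b}"
    and "C2_on (I \<times> UNIV \<times> UNIV) (\<lambda>(t, x, w). E t x w)"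
    and "E \<in> space_Fc I"
    and "\<And>v. v \<in> {a..b} \<Longrightarrow> C1_on (I \<times> UNIV) (\<lambda>(t, x). du (du E) t x v)"
    and "(\<lambda>(t, x, v). dt I (du (du E)) t x v) absolutely_integrable_on (I \<times> UNIV \<times> {a..b})"
    and "(\<lambda>(t, x, v). gradx (du (du E)) t x v) absolutely_integrable_on (I \<times> UNIV \<times> {a..b})"
    and "entropy_flux I f E F"
    and "entropy_flux I f L G"
  shows "M_tx I f g uo u E F =
    1 / 2 * (LINT k:{a..b}|lebesgue. mu I f g uo u k (\<lambda>t x. du (du E) t x k))
    + M_tx I f g uo u L G"
proof -
  note I = assms(2)
  let ?S = "I \<times> (UNIV :: (real^'n) set)"
  have S: "?S \<in> sets lebesgue"
  proof -
    have "?S \<in> sets borel" by (intro borel_Times time_interval_basic(3)[OF I]) simp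
    then show ?thesis by simp
  qed
  have J: "v \<in> {a..b}" if "min (ess_inf (lebesgue_on ?S) u) (ess_inf lebesgue uo) \<le> ereal v"
    "ereal v \<le> max (ess_sup (lebesgue_on ?S) u) (ess_sup lebesgue uo)" for v
    using assms(7) that unfolding J_range_def by blast
  have ru: "AE z in lebesgue_on ?S. u z \<in> {a..b}"
    using AE_between_ess_inf_ess_sup[of "lebesgue_on ?S" u]
    by eventually_elim (auto intro!: J simp del: atLeastAtMost_iff simp: min_le_iff_disj le_max_iff_disj)
  have ruo: "AE x in lebesgue. uo x \<in> {a..b}"
    using AE_between_ess_inf_ess_sup[of lebesgue uo]
    by eventually_elim (auto intro!: J simp del: atLeastAtMost_iff simp: min_le_iff_disj le_max_iff_disj)
  have ab: "a \<le> b"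
  proof (rule ccontr)
    assume "\<not> a \<le> b"
    then have "AE x in lborel. (x :: real^'n) \<in> {}"
      using ruo unfolding AE_completion_iff by (auto elim: eventually_mono)
    then have "emeasure lborel (UNIV :: (real^'n) set) = 0"
      by (subst (asm) AE_iff_measurable[of UNIV]) auto
    then show False by simp
  qed
  obtain U where U: "U \<in> borel_measurable borel" "\<And>z. U z \<in> {a..b}" "AE z in lborel. z \<in> ?S \<longrightarrow> u z = U z"
    using borel_representative_in_Icc[OF S _ ru ab] assms(6) unfolding Linfty_def by blast
  obtain Uo where Uo: "Uo \<in> borel_measurable borel" "\<And>z. Uo z \<in> {a..b}" "AE x in lborel. x \<in> UNIV \<longrightarrow> uo x = Uo x"
    using borel_representative_in_Icc[of UNIV uo a b] ruo ab assms(5)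
    unfolding Linfty_def lebesgue_on_UNIV_eq by auto
  define K where "K = spt_tx I E \<union> spt_tx I F \<union> spt_tx I G"
  have sub: "I \<times> UNIV \<times> UNIV \<subseteq> closure I \<times> UNIV \<times> UNIV" using closure_subset by auto
  have cl: "t \<in> closure I" if "t \<in> I" for t using closure_subset that by auto
  interpret kruzkov_state I f g a b E F G K u U uo Uo
  proof
    show "continuous_on (I \<times> UNIV \<times> UNIV) (\<lambda>(t, x, w). g t x w)"
      by (rule continuous_on_subset[OF assms(4) sub])
    show "E \<in> space_F I" "F \<in> space_F I" "G \<in> space_F I"
      using assms(9,13,14) by (auto simp: entropy_flux_def space_Fc_def)
    show "compact K" "K \<subseteq> I \<times> UNIV"
      using assms(9,13,14) by (auto simp: entropy_flux_def space_Fc_def K_def spt_tx_def)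
    show "du F t x w = du E t x w *\<^sub>R du f t x w" if "t \<in> I" for t x w
      using assms(13) cl[OF that] by (simp add: entropy_flux_def)
    show "du G t x w = ((du E t x a + du E t x b) / 2) *\<^sub>R du f t x w" if "t \<in> I" for t x w
      using assms(14) cl[OF that] by (simp add: entropy_flux_def L_def du_tensor_id)
    show "E t x w = 0" "F t x w = 0" "G t x w = 0" if "t \<in> I" "(t, x) \<notin> K" for t x w
      using that by (auto simp: K_def intro: vanishes_off_spt_tx)
    show "AE z in lborel. fst z \<in> I \<longrightarrow> u z = U z"
      using U(3) by eventually_elim (simp add: mem_Times_iff)
    show "AE x in lborel. uo x = Uo x" using Uo(3) by simp
  qed (fact assms ab U Uo)+
  show ?thesis
    using entropy_representation unfolding linear_entropy_def L_def by simp
qed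

end
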